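(* Let $\{V(\mathbf t):\mathbf t\in\mathbb Z^2\}$ be a stationary random field with mean $\mu$, and let $T=\{(t_1,t_2)\in\mathbb Z^2:1\le t_k\le d_k,\ k=1,2\}$. Assume: (1) there exist $0<\xi\le1/2$ and $c_1,c_2>0$ such that, for all sufficiently large $|T|$, $d_1>c_1|T|^\xi$ and $d_2>c_2|T|^\xi$; (2) $\sum_{\mathbf j\in\mathbb Z^2}|\gamma(\mathbf j)|<\infty$, where $\gamma(\mathbf j)=\mathrm{Cov}(V(\mathbf 0),V(\mathbf j))$; let $f(\lambda)=\frac1{4\pi^2}\sum_{\mathbf j\in\mathbb Z^2}e^{-i\lambda'\mathbf j}\gamma(\mathbf j)$ be the spectral density; (3) the kernel $K$ is a real, positive (i.e. $K\ge0$), even function on $\mathbb R^2$ with $\int_{\mathbb R^2}K(\lambda)\,d\lambda=1$ and $\frac{4\pi^2}{|\mathbf h_T||T|}\sum_{\mathbf j\in\mathbb Z^2}K\big(\frac{2\pi j_1}{h_{T1}d_1},\frac{2\pi j_2}{h_{T2}d_2}\big)=1+o(1)$. Let $k(\mathbf x)=\int_{\mathbb R^2}K(\lambda)\exp(i\mathbf x'\lambda)\,d\lambda$ be the inverse Fourier transform of $K$, and let $\widehat f_T$ be the kernel spectral density estimator. (a) Suppose that: $\int_{\mathbb R^2}|K(\lambda)|\,d\lambda<\infty$ and $|k(\mathbf x)|\le\widetilde k(\mathbf x)$ for an even function $\widetilde k$ that is monotonically decreasing with respect to $\|\mathbf x\|$ on $[0,\infty)^2$ (i.e. $\widetilde k(\mathbf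 x)\ge\widetilde k(\mathbf y)$ if $\|\mathbf x\|\le\|\mathbf y\|$) with $\int_{\mathbb R_+^2}\widetilde k(\mathbf x)\,d\mathbf x<\infty$; for some $0<v\le1/2$, the sample autocovariance function $R_V(\mathbf r)=|T|^{-1}\sum_{\mathbf j,\mathbf j+\mathbf r\in T}(V(\mathbf j)-\mu)(V(\mathbf j+\mathbf r)-\mu)$ satisfies $|R_V(\mathbf r)-\mathbb E(R_V(\mathbf r))|=O_p(|T|^{-v})$ uniformly in $\mathbf r\in\mathbb Z^2$; and $|\mathbf h_T|+|\mathbf h_T|^{-1}|T|^{-v}\to0$. Then, as $T\to\infty$, $$\max_{\lambda\in[0,2\pi]^2}\big|\widehat f_T(\lambda)-f(\lambda)\big|\xrightarrow{p}0.$$ (b) Suppose that: $k$ is Lipschitz continuous with support $[-1,1]^2$; $f(\lambda)\ge c$ for some $c>0$ and all $\lambda\in[0,2\pi]^2$; $V$ is $p$-stable for some $p\ge2$ and satisfies the geometric-moment contraction condition; $\mathbb E(|V(\mathbf 0)|^\phi)<\infty$ for some $4<\phi\le8$; and $|\mathbf h_T|\to0$ with $(|\mathbf h_T||T|^\eta)^{-1}=O(1)$ for some $0<\eta<\frac{\phi-4}\phi$. Then, as $T\to\infty$, $$\max_{\lambda\in[0,2\pi]^2}\big|\widehat f_T(\lambda)-f(\lambda)\big|\xrightarrow{p}0.$$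
   Context: Notation: for a vector $\mathbf a=(a_1,a_2)$, $|\mathbf a|=|a_1||a_2|$ (product of absolute values; in particular $|\mathbf h_T|=|h_{T1}h_{T2}|$) and $\|\mathbf a\|=\max_i|a_i|$; $|T|=d_1d_2$; $T\to\infty$ means $d_1,d_2\to\infty$; $\mathbf a'\mathbf b$ is the dot product; $\|X\|_p=(\mathbb E|X|^p)^{1/p}$; $a\asymp b$ means $a=O(b)$ and $b=O(a)$. Standing assumption on the bandwidth: $\mathbf h_T=(h_{T1},h_{T2})\in\mathbb R^2$ satisfies $h_{Tk}\to0$, $h_{T1}\asymp h_{T2}$ and $h_{Tk}d_k\to\infty$ for $k=1,2$. Fourier coefficients: for $\mathbf j\in\mathbb Z^2$ let $\lambda_{\mathbf j}=(\lambda_{j1},\lambda_{j2})=(2\pi j_1/d_1,2\pi j_2/d_2)$, $x(\mathbf j)=|T|^{-1/2}\sum_{\mathbf t\in T}V(\mathbf t)\cos(-\lambda_{\mathbf j}'\mathbf t)$, $y(\mathbf j)=|T|^{-1/2}\sum_{\mathbf t\in T}V(\mathbf t)\sin(-\lambda_{\mathbf j}'\mathbf t)$. Periodogram: $I(\mathbf j)=0$ if $\mathbf j\in D=\{(c_1d_1,c_2d_2):(c_1,c_2)\in\mathbb Z^2\}$ and $I(\mathbf j)=x^2(\mathbf j)+y^2(\mathbf j)$ if $\mathbf j\in\mathbb Z^2\setminus D$. Kernel spectral density estimator: for $\lambda=(\lambda_1,\lambda_2)\in[0,2\pi]^2$, $$\widehat f_T(\lambda)=\frac1{4\pi^2}\sum_{\mathbf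 j\in\mathbb Z^2}\left(\frac{K\big(\frac{\lambda_1-\lambda_{j1}}{h_{T1}},\frac{\lambda_2-\lambda_{j2}}{h_{T2}}\big)}{\sum_{\mathbf k\in\mathbb Z^2}K\big(\frac{\lambda_{k1}}{h_{T1}},\frac{\lambda_{k2}}{h_{T2}}\big)}\right)I(\mathbf j).$$ Couplings (used in (b)): suppose $V(\mathbf j)-\mu=G(\varepsilon_{\mathbf j-\mathbf s}:\mathbf s\in\mathbb Z^2)$ for all $\mathbf j\in\mathbb Z^2$, with $G$ measurable and $\{\varepsilon_{\mathbf i}\}_{\mathbf i\in\mathbb Z^2}$ an i.i.d. random field, and let $\{\widetilde\varepsilon_{\mathbf i}\}$ be an i.i.d. (independent) copy of $\{\varepsilon_{\mathbf i}\}$. $p$-stability: $V(\mathbf j)\in\mathbb L^p$ and $\sum_{\mathbf j\in\mathbb Z^2}\|V(\mathbf j)-\widetilde V(\mathbf j)\|_p<\infty$, where $\widetilde V(\mathbf j)-\mu=G(\varepsilon^*_{\mathbf j-\mathbf s}:\mathbf s\in\mathbb Z^2)$ with $\varepsilon^*_{\mathbf i}=\varepsilon_{\mathbf i}$ for $\mathbf i\ne\mathbf 0$ and $\varepsilon^*_{\mathbf 0}=\widetilde\varepsilon_{\mathbf 0}$. Geometric-moment contraction condition: there exist $\alpha>0$, $C>0$ and $0<\rho=\rho(\alpha)<1$ with $\mathbb E(|V(\mathbf j)-\widetilde V^\dagger(\mathbf j)|^\alpha)\le C\rho^{\|\mathbf j\|}$ for all $\mathbf j\in\mathbb Z^2$,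 where $\widetilde V^\dagger(\mathbf j)-\mu=G(\varepsilon^\dagger_{\mathbf j-\mathbf s}:\mathbf s\in\mathbb Z^2)$ with $\varepsilon^\dagger_{\mathbf j-\mathbf s}=\varepsilon_{\mathbf j-\mathbf s}$ if $\|\mathbf s\|<\|\mathbf j\|$ and $\varepsilon^\dagger_{\mathbf j-\mathbf s}=\widetilde\varepsilon_{\mathbf j-\mathbf s}$ if $\|\mathbf s\|\ge\|\mathbf j\|$.
   Formalization: The kernel K is assumed to equal, at every point, the Fourier transform of its inverse transform k (the continuous version of K), since changing K on a null set can break the claim; the even majorant k̃ is taken to be even in each coordinate. *)

theory Defs
  imports "HOL-Probability.Probability" "HOL-Library.Landau_Symbols"
begin

text \<open>The library norm on a product type is Euclidean, hence separate names for the maximum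
  norm \<open>\<parallel>a\<parallel> = max\<^sub>i |a\<^sub>i|\<close> and the product of absolute values \<open>|a| = |a\<^sub>1| |a\<^sub>2|\<close>.\<close>

definition max_norm :: "'a::linordered_idom \<times> 'a \<Rightarrow> 'a"
  where "max_norm a = max \<bar>fst a\<bar> \<bar>snd a\<bar>"

definition prod_abs :: "real \<times> real \<Rightarrow> real"
  where "prod_abs a = \<bar>fst a\<bar> * \<bar>snd a\<bar>"

text \<open>The limit \<open>T \<rightarrow> \<infinity>\<close> is taken along a sequence \<open>d\<close> of side-length pairs with both components
  tending to infinity. Over all pairs at once, a growth condition \<open>d\<^sub>k > c\<^sub>k |T| powr \<xi>\<close> would be
  unsatisfiable.\<close>

definition obs_region :: "nat \<times> nat \<Rightarrow> (int \<times> int) set"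
  where "obs_region d = {1..int (fst d)} \<times> {1..int (snd d)}"

definition obs_size :: "nat \<times> nat \<Rightarrow> real"
  where "obs_size d = real (fst d) * real (snd d)"

definition real_pair :: "int \<times> int \<Rightarrow> real \<times> real"
  where "real_pair j = (real_of_int (fst j), real_of_int (snd j))"


section \<open>Second-order structure of a random field\<close>

definition cov :: "'w measure \<Rightarrow> ('w \<Rightarrow> real) \<Rightarrow> ('w \<Rightarrow> real) \<Rightarrow> real"
  where "cov M X Y =
    (\<integral>\<omega>. (X \<omega> - (\<integral>\<omega>'. X \<omega>' \<partial>M)) * (Y \<omega> - (\<integral>\<omega>'. Y \<omega>' \<partial>M)) \<partial>M)"

definition weakly_stationary :: "'w measure \<Rightarrow> (int \<times> int \<Rightarrow> 'w \<Rightarrow> real) \<Rightarrow> bool"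
  where "weakly_stationary M V \<longleftrightarrow>
    (\<forall>t. V t \<in> borel_measurable M \<and> integrable M (\<lambda>\<omega>. (V t \<omega>)\<^sup>2)) \<and>
    (\<forall>t. (\<integral>\<omega>. V t \<omega> \<partial>M) = (\<integral>\<omega>. V 0 \<omega> \<partial>M)) \<and>
    (\<forall>s t. cov M (V s) (V (s + t)) = cov M (V 0) (V t))"

definition autocov :: "'w measure \<Rightarrow> (int \<times> int \<Rightarrow> 'w \<Rightarrow> real) \<Rightarrow> int \<times> int \<Rightarrow> real"
  where "autocov M V j = cov M (V 0) (V j)"

text \<open>The autocovariance function of a stationary field is even, so the series below is real;
  taking the real part only changes the type.\<close>

definition spectral_density ::
    "'w measure \<Rightarrow> (int \<times> int \<Rightarrow> 'w \<Rightarrow> real) \<Rightarrow> real \<times> real \<Rightarrow> real"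
  where "spectral_density M V l =
    Re (1 / (4 * of_real pi ^ 2) *
        (\<Sum>\<^sub>\<infinity>j. exp (- \<i> * of_real (l \<bullet> real_pair j)) * of_real (autocov M V j)))"

text \<open>In what follows \<open>v\<close> is a realisation of the field.\<close>

definition sample_autocov ::
    "real \<Rightarrow> nat \<times> nat \<Rightarrow> (int \<times> int \<Rightarrow> real) \<Rightarrow> int \<times> int \<Rightarrow> real"
  where "sample_autocov \<mu> d v r =
    (\<Sum>j | j \<in> obs_region d \<and> j + r \<in> obs_region d. (v j - \<mu>) * (v (j + r) - \<mu>)) / obs_size d"


section \<open>Kernel spectral density estimator\<close>

definition fourier_freq :: "nat \<times> nat \<Rightarrow> int \<times> int \<Rightarrow> real \<times> real"
  where "fourier_freq d j =
    (2 * pi * real_of_int (fst j) / real (fst d), 2 * pi * real_of_int (snd j) / real (snd d))"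

definition fourier_cos :: "nat \<times> nat \<Rightarrow> (int \<times> int \<Rightarrow> real) \<Rightarrow> int \<times> int \<Rightarrow> real"
  where "fourier_cos d v j =
    (\<Sum>t\<in>obs_region d. v t * cos (- (fourier_freq d j \<bullet> real_pair t))) / sqrt (obs_size d)"

definition fourier_sin :: "nat \<times> nat \<Rightarrow> (int \<times> int \<Rightarrow> real) \<Rightarrow> int \<times> int \<Rightarrow> real"
  where "fourier_sin d v j =
    (\<Sum>t\<in>obs_region d. v t * sin (- (fourier_freq d j \<bullet> real_pair t))) / sqrt (obs_size d)"

definition periodogram :: "nat \<times> nat \<Rightarrow> (int \<times> int \<Rightarrow> real) \<Rightarrow> int \<times> int \<Rightarrow> real"
  where "periodogram d v j =
    (if j \<in> {(c1 * int (fst d), c2 * int (snd d)) | c1 c2. True} then 0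
     else (fourier_cos d v j)\<^sup>2 + (fourier_sin d v j)\<^sup>2)"

definition spec_est ::
    "(real \<times> real \<Rightarrow> real) \<Rightarrow> real \<times> real \<Rightarrow> nat \<times> nat \<Rightarrow> (int \<times> int \<Rightarrow> real) \<Rightarrow>
     real \<times> real \<Rightarrow> real"
  where "spec_est K h d v l =
    1 / (4 * pi\<^sup>2) *
    (\<Sum>\<^sub>\<infinity>j. K ((fst l - fst (fourier_freq d j)) / fst h, (snd l - snd (fourier_freq d j)) / snd h)
          / (\<Sum>\<^sub>\<infinity>k. K (fst (fourier_freq d k) / fst h, snd (fourier_freq d k) / snd h))
          * periodogram d v j)"

text \<open>An integrable \<open>inv_fourier K\<close> determines \<open>K\<close> only almost everywhere, while \<open>spec_est\<close> evaluates
  \<open>K\<close> pointwise. The inversion formula \<open>K = fourier (inv_fourier K)\<close>, required at every point in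
  the theorem, singles out the continuous version of \<open>K\<close>.\<close>

definition inv_fourier :: "(real \<times> real \<Rightarrow> real) \<Rightarrow> real \<times> real \<Rightarrow> complex"
  where "inv_fourier K x = (\<integral>l. of_real (K l) * exp (\<i> * of_real (x \<bullet> l)) \<partial>lborel)"

definition fourier :: "(real \<times> real \<Rightarrow> complex) \<Rightarrow> real \<times> real \<Rightarrow> complex"
  where "fourier k l =
    1 / (4 * of_real pi ^ 2) * (\<integral>x. k x * exp (- \<i> * of_real (x \<bullet> l)) \<partial>lborel)"


section \<open>Stochastic order symbols\<close>

text \<open>\<open>X\<^sub>n\<close> converges to \<open>c\<close> in probability. The exceptional set is required to be covered by events
  of vanishing probability, which agrees with the usual definition for measurable \<open>X\<^sub>n\<close> and
  prevents a non-measurable set from counting as a null set (\<open>measure\<close> is 0 there); the intended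
  \<open>X\<^sub>n\<close> is a supremum over an uncountable set.\<close>

definition conv_in_prob :: "'w measure \<Rightarrow> (nat \<Rightarrow> 'w \<Rightarrow> real) \<Rightarrow> real \<Rightarrow> bool"
  where "conv_in_prob M X c \<longleftrightarrow>
    (\<forall>e>0. \<exists>A. (\<forall>n. A n \<in> sets M \<and> {\<omega> \<in> space M. \<bar>X n \<omega> - c\<bar> > e} \<subseteq> A n) \<and>
               (\<lambda>n. measure M (A n)) \<longlonglongrightarrow> 0)"

definition bigO_prob :: "'w measure \<Rightarrow> (nat \<Rightarrow> 'w \<Rightarrow> real) \<Rightarrow> (nat \<Rightarrow> real) \<Rightarrow> bool"
  where "bigO_prob M X a \<longleftrightarrow>
    (\<forall>e>0. \<exists>C>0. \<forall>\<^sub>F n in sequentially. measure M {\<omega> \<in> space M. \<bar>X n \<omega>\<bar> > C * a n} < e)"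


section \<open>Functionals of i.i.d. innovations and their coupled versions\<close>

definition iid_with_copy ::
    "'w measure \<Rightarrow> 'e measure \<Rightarrow> (int \<times> int \<Rightarrow> 'w \<Rightarrow> 'e) \<Rightarrow> (int \<times> int \<Rightarrow> 'w \<Rightarrow> 'e) \<Rightarrow> bool"
  where "iid_with_copy M S \<epsilon> \<epsilon>' \<longleftrightarrow>
    prob_space.indep_vars M (\<lambda>_. S) (case_sum \<epsilon> \<epsilon>') UNIV \<and>
    (\<forall>i. distr M S (\<epsilon> i) = distr M S (\<epsilon> 0) \<and> distr M S (\<epsilon>' i) = distr M S (\<epsilon> 0))"

definition bernoulli_shift ::
    "'w measure \<Rightarrow> 'e measure \<Rightarrow> (int \<times> int \<Rightarrow> 'w \<Rightarrow> real) \<Rightarrow> real \<Rightarrow>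
     ((int \<times> int \<Rightarrow> 'e) \<Rightarrow> real) \<Rightarrow> (int \<times> int \<Rightarrow> 'w \<Rightarrow> 'e) \<Rightarrow> bool"
  where "bernoulli_shift M S V \<mu> G \<epsilon> \<longleftrightarrow>
    G \<in> borel_measurable (Pi\<^sub>M UNIV (\<lambda>_. S)) \<and>
    (\<forall>j. AE \<omega> in M. V j \<omega> - \<mu> = G (\<lambda>s. \<epsilon> (j - s) \<omega>))"

definition coupled_origin ::
    "real \<Rightarrow> ((int \<times> int \<Rightarrow> 'e) \<Rightarrow> real) \<Rightarrow> (int \<times> int \<Rightarrow> 'w \<Rightarrow> 'e) \<Rightarrow> (int \<times> int \<Rightarrow> 'w \<Rightarrow> 'e) \<Rightarrow>
     int \<times> int \<Rightarrow> 'w \<Rightarrow> real"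
  where "coupled_origin \<mu> G \<epsilon> \<epsilon>' j \<omega> =
    \<mu> + G (\<lambda>s. if j - s = 0 then \<epsilon>' (j - s) \<omega> else \<epsilon> (j - s) \<omega>)"

definition coupled_far ::
    "real \<Rightarrow> ((int \<times> int \<Rightarrow> 'e) \<Rightarrow> real) \<Rightarrow> (int \<times> int \<Rightarrow> 'w \<Rightarrow> 'e) \<Rightarrow> (int \<times> int \<Rightarrow> 'w \<Rightarrow> 'e) \<Rightarrow>
     int \<times> int \<Rightarrow> 'w \<Rightarrow> real"
  where "coupled_far \<mu> G \<epsilon> \<epsilon>' j \<omega> =
    \<mu> + G (\<lambda>s. if max_norm s < max_norm j then \<epsilon> (j - s) \<omega> else \<epsilon>' (j - s) \<omega>)"

definition Lp_norm :: "'w measure \<Rightarrow> real \<Rightarrow> ('w \<Rightarrow> real) \<Rightarrow> real"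
  where "Lp_norm M p X = (\<integral>\<omega>. \<bar>X \<omega>\<bar> powr p \<partial>M) powr (1 / p)"

text \<open>Only \<open>V j\<close> needs to be required in \<open>L\<^sup>p\<close>: the coupled variable has the same law, so the
  differences are in \<open>L\<^sup>p\<close> as well.\<close>

definition p_stable ::
    "'w measure \<Rightarrow> real \<Rightarrow> (int \<times> int \<Rightarrow> 'w \<Rightarrow> real) \<Rightarrow> real \<Rightarrow>
     ((int \<times> int \<Rightarrow> 'e) \<Rightarrow> real) \<Rightarrow> (int \<times> int \<Rightarrow> 'w \<Rightarrow> 'e) \<Rightarrow> (int \<times> int \<Rightarrow> 'w \<Rightarrow> 'e) \<Rightarrow> bool"
  where "p_stable M p V \<mu> G \<epsilon> \<epsilon>' \<longleftrightarrow>
    (\<forall>j. integrable M (\<lambda>\<omega>. \<bar>V j \<omega>\<bar> powr p)) \<and>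
    (\<lambda>j. Lp_norm M p (\<lambda>\<omega>. V j \<omega> - coupled_origin \<mu> G \<epsilon> \<epsilon>' j \<omega>)) summable_on UNIV"

text \<open>The expectation is a nonnegative integral, so that an infinite moment of order \<open>\<alpha>\<close> violates
  the bound.\<close>

definition geometric_moment_contraction ::
    "'w measure \<Rightarrow> (int \<times> int \<Rightarrow> 'w \<Rightarrow> real) \<Rightarrow> real \<Rightarrow>
     ((int \<times> int \<Rightarrow> 'e) \<Rightarrow> real) \<Rightarrow> (int \<times> int \<Rightarrow> 'w \<Rightarrow> 'e) \<Rightarrow> (int \<times> int \<Rightarrow> 'w \<Rightarrow> 'e) \<Rightarrow> bool"
  where "geometric_moment_contraction M V \<mu> G \<epsilon> \<epsilon>' \<longleftrightarrow>
    (\<exists>\<alpha>>0. \<exists>C>0. \<exists>\<rho>>0. \<rho> < 1 \<and>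
      (\<forall>j. (\<integral>\<^sup>+\<omega>. ennreal (\<bar>V j \<omega> - coupled_far \<mu> G \<epsilon> \<epsilon>' j \<omega>\<bar> powr \<alpha>) \<partial>M)
           \<le> ennreal (C * \<rho> ^ nat (max_norm j))))"

end

theory Submission
  imports Defs "HOL-Real_Asymp.Real_Asymp"
begin

text \<open>Let \<open>A(u) = \<Sum>\<^sub>m k(h (u + m d)) exp (- i \<lambda>\<cdot>(u + m d))\<close>, products of pairs being taken componentwise.
The estimator is a weighted sum of sample autocovariances in disguise: up to the normalising
factor and the frequencies at which the periodogram is set to zero,
\<open>4 \<pi>\<^sup>2 f\<^sub>T(\<lambda>) = \<Sum>\<^sub>u R(u) A(u)\<close>, where \<open>u\<close> runs over the lags inside the observation region. Two facts
give this formula: Poisson summation turns the kernel weights at the Fourier frequencies congruent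
modulo \<open>2 \<pi>\<close> into a series in \<open>k\<close> (\<open>poisson_summation\<close>), and orthogonality of the discrete Fourier
basis turns the periodogram into autocovariances (\<open>smoothed_periodogram\<close>).

In both parts of the theorem \<open>k\<close> is bounded by an integrable function \<open>g\<close> that decreases with the
maximum norm: in part (a) by assumption, and in part (b) by the indicator of the unit square, as \<open>k\<close>
has support \<open>[-1,1]\<^sup>2\<close> and \<open>|k| \<le> \<integral> K = 1\<close>. Lattice sums of such a \<open>g\<close> are comparable to its integral
(\<open>lattice_sum\<close>), so the weights \<open>A(u)\<close> have total mass \<open>O(1/|h|)\<close> uniformly in \<open>\<lambda>\<close>
(\<open>sum_coset_mass_le\<close>), and the aliases \<open>m \<noteq> 0\<close> of a fixed lag vanish in the limit because
\<open>h d \<rightarrow> \<infinity>\<close> (\<open>coset_tail_le\<close>). Hence the error splits, uniformly in \<open>\<lambda>\<close>, into three parts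
(\<open>deviation_bound\<close>).

\<^item> The bias \<open>\<Sum>\<^sub>u E R(u) A(u) - \<Sum>\<^sub>u \<gamma>(u) exp (- i \<lambda>\<cdot>u)\<close> tends to \<open>0\<close> by dominated convergence, as \<open>\<gamma>\<close> is
  summable, \<open>E R(u) \<rightarrow> \<gamma>(u)\<close> and \<open>k(h u) \<rightarrow> k(0) = 1\<close>.
\<^item> The zeroed frequencies contribute a multiple of the squared sample mean, of expectation
  \<open>O(1/(|h| |T|))\<close>.
\<^item> The noise is at most \<open>\<Sum>\<^sub>u |R(u) - E R(u)|\<close> weighted with total mass \<open>O(1/|h|)\<close>.

In part (a) the noise is \<open>O\<^sub>p(|T|\<^sup>-\<^sup>v/|h|)\<close> by assumption. In part (b) it is enough to bound the variance
of \<open>R(u)\<close> by \<open>C/|T|\<close>, uniformly in \<open>u\<close>: the noise then has mean \<open>O(|h|\<^sup>-\<^sup>1 |T|\<^sup>-\<^sup>1\<^sup>/\<^sup>2)\<close>, and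
\<open>|h|\<^sup>-\<^sup>1 = O(|T|\<^sup>\<eta>)\<close> with \<open>\<eta> < (\<phi> - 4)/\<phi> \<le> 1/2\<close> since \<open>\<phi> \<le> 8\<close>. The variance bound follows from geometric decay
of the covariances of products of the field (\<open>covariance_decay\<close>). For that decay each variable is
replaced by its conditional mean given the innovations in a window around its site: by Jensen's
inequality the error is no larger than that of the coupling in the contraction condition
(\<open>local_approx_moment4\<close>), and conditional means over disjoint windows are independent.\<close>

section \<open>Diagonal scaling of the plane and the maximum norm\<close>

lemma lborel_diagonal_scaling:
  fixes a b :: real
  assumes "a \<noteq> 0" "b \<noteq> 0"
  shows "(lborel :: (real \<times> real) measure)
    = density (distr lborel borel (\<lambda>y. (a * fst y, b * snd y))) (\<lambda>_. ennreal (\<bar>a\<bar> * \<bar>b\<bar>))"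
proof -
  define c where "c = (\<lambda>j::real \<times> real. a * fst j + b * snd j)"
  have B: "(Basis :: (real \<times> real) set) = {(1, 0), (0, 1)}"
    by (auto simp: Basis_prod_def)
  have "c j \<noteq> 0" if "j \<in> Basis" for j
    using that assms by (auto simp: B c_def)
  from lborel_affine_euclidean[of c 0, OF this]
  show ?thesis
    by (simp add: B c_def ennreal_mult inner_prod_def)
qed

lemma diagonal_scaling_measurable [measurable]:
  "(\<lambda>y :: real \<times> real. (a * fst y, b * snd y)) \<in> borel_measurable borel"
  by (intro borel_measurable_continuous_onI continuous_intros)

lemma integrable_diagonal_scaling:
  fixes F :: "real \<times> real \<Rightarrow> 'b :: {banach, second_countable_topology}"
  assumes "a \<noteq> 0" "b \<noteq> 0" and F: "integrable lborel F"
  shows "integrable lborel (\<lambda>y. F (a * fst y, b * snd y))"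
proof -
  have [measurable]: "F \<in> borel_measurable borel"
    using F by auto
  have "integrable (density (distr lborel borel (\<lambda>y. (a * fst y, b * snd y)))
      (\<lambda>_. ennreal (\<bar>a\<bar> * \<bar>b\<bar>))) F"
    using F lborel_diagonal_scaling[OF assms(1,2)] by simp
  then have "integrable (distr lborel borel (\<lambda>y. (a * fst y, b * snd y))) (\<lambda>x. (\<bar>a\<bar> * \<bar>b\<bar>) *\<^sub>R F x)"
    by (subst (asm) integrable_density) auto
  then have "integrable (distr lborel borel (\<lambda>y. (a * fst y, b * snd y))) F"
    using assms(1,2) integrable_scaleR_right[of "inverse \<bar>a\<bar> * inverse \<bar>b\<bar>" _
      "\<lambda>x. (\<bar>a\<bar> * \<bar>b\<bar>) *\<^sub>R F x"] by (simp add: field_simps)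
  then show ?thesis
    by (subst (asm) integrable_distr_eq) auto
qed

lemma integral_diagonal_scaling:
  fixes F :: "real \<times> real \<Rightarrow> 'b :: {banach, second_countable_topology}"
  assumes "a \<noteq> 0" "b \<noteq> 0" and F: "F \<in> borel_measurable borel"
  shows "integral\<^sup>L lborel F = (\<bar>a\<bar> * \<bar>b\<bar>) *\<^sub>R (\<integral>y. F (a * fst y, b * snd y) \<partial>lborel)"
proof -
  note [measurable] = F
  have "integral\<^sup>L lborel F = integral\<^sup>L (density (distr lborel borel (\<lambda>y. (a * fst y, b * snd y)))
      (\<lambda>_. ennreal (\<bar>a\<bar> * \<bar>b\<bar>))) F"
    using lborel_diagonal_scaling[OF assms(1,2)] by simp
  also have "\<dots> = (\<bar>a\<bar> * \<bar>b\<bar>) *\<^sub>R integral\<^sup>L (distr lborel borel (\<lambda>y. (a * fst y, b * snd y))) F"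
    by (subst integral_density) auto
  also have "integral\<^sup>L (distr lborel borel (\<lambda>y. (a * fst y, b * snd y))) F
      = (\<integral>y. F (a * fst y, b * snd y) \<partial>lborel)"
    by (subst integral_distr) auto
  finally show ?thesis .
qed

lemma max_norm_nonneg: "0 \<le> max_norm (x :: 'a::linordered_idom \<times> 'a)"
  by (simp add: max_norm_def le_max_iff_disj)

lemma max_norm_triangle: "max_norm (x + y) \<le> max_norm x + max_norm (y :: real \<times> real)"
  unfolding max_norm_def fst_add snd_add by linarith

lemma max_norm_minus: "max_norm (- x) = max_norm (x :: real \<times> real)"
  by (simp add: max_norm_def)

lemma max_norm_diff_commute: "max_norm (x - y) = max_norm (y - x :: real \<times> real)"
  by (metis max_norm_minus minus_diff_eq)

definition open_cell :: "real \<Rightarrow> real \<times> real \<Rightarrow> (real \<times> real) set" where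
  "open_cell \<tau> p = box (p - (\<tau>/2, \<tau>/2)) (p + (\<tau>/2, \<tau>/2))"

lemma Basis_plane: "(Basis :: (real \<times> real) set) = {(1, 0), (0, 1)}"
  by (auto simp: Basis_prod_def)

lemma open_cell_measurable [measurable]: "open_cell \<tau> p \<in> sets borel"
  by (simp add: open_cell_def)

lemma in_open_cell_iff: "y \<in> open_cell \<tau> p \<longleftrightarrow> max_norm (y - p) < \<tau> / 2"
proof -
  have *: "\<bar>u - v\<bar> < \<tau> / 2 \<longleftrightarrow> v - \<tau> / 2 < u \<and> u < v + \<tau> / 2" for u v :: real
    by arith
  show ?thesis
    unfolding max_norm_def max_less_iff_conj fst_diff snd_diff *
    by (auto simp: open_cell_def box_def Basis_plane inner_prod_def)
qed

lemma measure_open_cell: "\<tau> > 0 \<Longrightarrow> measure lborel (open_cell \<tau> p) = \<tau>\<^sup>2"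
  unfolding open_cell_def
  by (subst measure_lborel_box) (auto simp: Basis_plane inner_prod_def power2_eq_square)

lemma emeasure_open_cell: "emeasure lborel (open_cell \<tau> p) < \<infinity>"
  unfolding open_cell_def by (rule emeasure_lborel_box_finite)

section \<open>Lattice sums of radially decreasing functions\<close>

locale radial_majorant =
  fixes g :: "real \<times> real \<Rightarrow> real"
  assumes nonneg: "0 \<le> g x"
    and antimono: "max_norm x \<le> max_norm y \<Longrightarrow> g y \<le> g x"
    and integrable: "integrable lborel g"
begin

definition mass :: real where "mass = integral\<^sup>L lborel g"

lemma mass_nonneg: "0 \<le> mass"
  unfolding mass_def by (intro Bochner_Integration.integral_nonneg nonneg)

text \<open>The squares of side \<open>\<tau>\<close> around the points are disjoint, and every \<open>y\<close> in the square around \<open>p\<close>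
satisfies \<open>\<parallel>y/2\<parallel> \<le> \<parallel>p\<parallel>\<close> when \<open>\<tau> \<le> \<parallel>p\<parallel>\<close>. So the sum, multiplied by the area \<open>\<tau>\<^sup>2\<close>, is at most the
integral of \<open>y \<mapsto> g (y/2)\<close>; the dilation by \<open>2\<close> produces the factor \<open>4\<close>.\<close>

lemma separated_sum_le:
  assumes \<tau>: "\<tau> > 0" and F: "finite F"
    and sep: "\<And>i j. i \<in> F \<Longrightarrow> j \<in> F \<Longrightarrow> i \<noteq> j \<Longrightarrow> \<tau> \<le> max_norm (p i - p j)"
    and far: "\<And>i. i \<in> F \<Longrightarrow> \<tau> \<le> max_norm (p i)"
  shows "(\<Sum>i\<in>F. g (p i)) \<le> 4 * mass / \<tau>\<^sup>2"
proof -
  let ?C = "\<lambda>i. open_cell \<tau> (p i)"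
  let ?G = "\<lambda>y. g ((1/2) * fst y, (1/2) * snd y)"
  have intG: "integrable lborel ?G"
    by (rule integrable_diagonal_scaling[OF _ _ integrable]) auto
  have G: "integral\<^sup>L lborel ?G = 4 * mass"
    using integral_diagonal_scaling[of "1/2" "1/2" g] integrable by (auto simp: mass_def)
  have disj: "disjoint_family_on ?C F"
    unfolding disjoint_family_on_def
  proof (intro ballI impI equals0I)
    fix i j y assume ij: "i \<in> F" "j \<in> F" "i \<noteq> j" and y: "y \<in> ?C i \<inter> ?C j"
    have "max_norm (p i - p j) \<le> max_norm (p i - y) + max_norm (y - p j)"
      using max_norm_triangle[of "p i - y" "y - p j"] by simp
    also have "\<dots> < \<tau>"
      using y by (simp add: in_open_cell_iff max_norm_diff_commute[of "p i" y])
    finally show False using sep[OF ij] by simp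
  qed
  have point: "(\<Sum>i\<in>F. g (p i) * indicator (?C i) y) \<le> ?G y" for y
  proof (cases "\<exists>i\<in>F. y \<in> ?C i")
    case True
    then obtain i where i: "i \<in> F" "y \<in> ?C i" by auto
    have "(\<Sum>j\<in>F. g (p j) * indicator (?C j) y) = (\<Sum>j\<in>F. if j = i then g (p i) else 0)"
      using disj i by (intro sum.cong) (auto simp: disjoint_family_on_def indicator_def)
    also have "\<dots> = g (p i)" using i F by simp
    also have "\<dots> \<le> ?G y"
    proof (rule antimono)
      have "max_norm y \<le> max_norm (y - p i) + max_norm (p i)"
        using max_norm_triangle[of "y - p i" "p i"] by simp
      then have "max_norm y \<le> 2 * max_norm (p i)"
        using i far[of i] max_norm_nonneg[of "p i"] by (simp add: in_open_cell_iff)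
      then show "max_norm ((1/2) * fst y, (1/2) * snd y) \<le> max_norm (p i)"
        by (auto simp: max_norm_def)
    qed
    finally show ?thesis .
  next
    case False
    then have "(\<Sum>i\<in>F. g (p i) * indicator (?C i) y) = 0"
      by (intro sum.neutral) auto
    then show ?thesis using nonneg by simp
  qed
  have intC: "integrable lborel (\<lambda>y. g (p i) * indicator (?C i) y)" for i
    using emeasure_open_cell by (intro integrable_mult_right) simp
  have "\<tau>\<^sup>2 * (\<Sum>i\<in>F. g (p i)) = (\<Sum>i\<in>F. \<integral>y. g (p i) * indicator (?C i) y \<partial>lborel)"
    using \<tau> by (simp add: sum_distrib_left measure_open_cell mult.commute)
  also have "\<dots> = (\<integral>y. (\<Sum>i\<in>F. g (p i) * indicator (?C i) y) \<partial>lborel)"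
    using intC by (subst Bochner_Integration.integral_sum) auto
  also have "\<dots> \<le> 4 * mass"
    unfolding G[symmetric] using intC intG point
    by (intro integral_mono Bochner_Integration.integrable_sum) auto
  finally show ?thesis using \<tau> by (simp add: field_simps)
qed

lemma lattice_far_sum:
  assumes ab: "\<tau> > 0" "\<tau> \<le> a" "\<tau> \<le> b"
    and far: "\<And>m. m \<in> I \<Longrightarrow> \<tau> \<le> max_norm (x + a * of_int (fst m), y + b * of_int (snd m))"
  shows "(\<lambda>m. g (x + a * of_int (fst m), y + b * of_int (snd m))) summable_on I"
    and "(\<Sum>\<^sub>\<infinity>m\<in>I. g (x + a * of_int (fst m), y + b * of_int (snd m))) \<le> 4 * mass / \<tau>\<^sup>2"
proof -
  let ?p = "\<lambda>m :: int \<times> int. (x + a * of_int (fst m), y + b * of_int (snd m))"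
  have step: "\<tau> \<le> \<bar>c * of_int k - c * of_int l\<bar>" if "\<tau> \<le> c" "k \<noteq> l" for c and k l :: int
  proof -
    have "1 \<le> \<bar>of_int (k - l) :: real\<bar>" using that by linarith
    then have "c * 1 \<le> c * \<bar>of_int (k - l)\<bar>" using ab that by (intro mult_left_mono) auto
    also have "\<dots> = \<bar>c * of_int k - c * of_int l\<bar>"
      using ab that by (simp add: abs_mult right_diff_distrib[symmetric])
    finally show ?thesis using that by simp
  qed
  have sep: "\<tau> \<le> max_norm (?p m - ?p n)" if "m \<noteq> n" for m n
    using that step[of a "fst m" "fst n"] step[of b "snd m" "snd n"] ab
    by (auto simp: max_norm_def prod_eq_iff le_max_iff_disj)
  have fin: "(\<Sum>m\<in>F. g (?p m)) \<le> 4 * mass / \<tau>\<^sup>2" if "finite F" "F \<subseteq> I" for F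
    using that sep far ab by (intro separated_sum_le) auto
  show s: "(\<lambda>m. g (?p m)) summable_on I"
    by (rule nonneg_bdd_above_summable_on) (auto intro!: nonneg bdd_aboveI[of _ "4 * mass / \<tau>\<^sup>2"] fin)
  show "(\<Sum>\<^sub>\<infinity>m\<in>I. g (?p m)) \<le> 4 * mass / \<tau>\<^sup>2"
    by (rule infsum_le_finite_sums[OF s]) (auto intro: fin)
qed

text \<open>At most two points of an arithmetic progression with step \<open>a \<ge> \<tau>\<close> lie in \<open>(-\<tau>, \<tau>)\<close>, so at most four
lattice points have norm below \<open>\<tau>\<close>; the others are covered by \<open>lattice_far_sum\<close>. The bound holds for
every offset \<open>(x, y)\<close>.\<close>

lemma lattice_sum:
  assumes ab: "\<tau> > 0" "\<tau> \<le> a" "\<tau> \<le> b"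
  shows "(\<lambda>m. g (x + a * of_int (fst m), y + b * of_int (snd m))) summable_on I"
    and "(\<Sum>\<^sub>\<infinity>m\<in>I. g (x + a * of_int (fst m), y + b * of_int (snd m))) \<le> 4 * g 0 + 4 * mass / \<tau>\<^sup>2"
proof -
  let ?p = "\<lambda>m :: int \<times> int. (x + a * of_int (fst m), y + b * of_int (snd m))"
  define N where "N = {m \<in> I. max_norm (?p m) < \<tau>}"
  have two: "l \<in> {\<lfloor>- (z / c)\<rfloor>, \<lfloor>- (z / c)\<rfloor> + 1}" if "\<tau> \<le> c" "\<bar>z + c * of_int l\<bar> < \<tau>" for z c l
  proof -
    have c: "c > 0" using that ab by simp
    have "\<bar>z + c * of_int l\<bar> < c" using that by simp
    then have "c * \<bar>z / c + of_int l\<bar> < c * 1"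
      using c by (simp add: abs_mult[of c, symmetric, unfolded abs_of_pos[OF c]] algebra_simps)
    then have "\<bar>z / c + of_int l\<bar> < 1" using c by simp
    then show ?thesis by (simp; linarith)
  qed
  let ?R = "\<lambda>z c. {\<lfloor>- (z / c)\<rfloor>, \<lfloor>- (z / c)\<rfloor> + 1} :: int set"
  have N_sub: "N \<subseteq> ?R x a \<times> ?R y b"
  proof
    fix m assume "m \<in> N"
    then have "\<bar>x + a * of_int (fst m)\<bar> < \<tau>" "\<bar>y + b * of_int (snd m)\<bar> < \<tau>"
      by (auto simp: N_def max_norm_def)
    from two[OF ab(2) this(1)] two[OF ab(3) this(2)] show "m \<in> ?R x a \<times> ?R y b"
      unfolding mem_Times_iff by blast
  qed
  have "card N \<le> card (?R x a \<times> ?R y b)"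
    by (rule card_mono[OF _ N_sub]) auto
  also have "\<dots> = 4" by (simp add: card_cartesian_product)
  finally have card: "card N \<le> 4" .
  have finN: "finite N" by (rule finite_subset[OF N_sub]) auto
  have "(\<Sum>m\<in>N. g (?p m)) \<le> (\<Sum>m\<in>N. g 0)"
    by (intro sum_mono antimono) (auto simp: max_norm_def le_max_iff_disj)
  also have "\<dots> \<le> 4 * g 0" using card nonneg by (simp add: mult_right_mono)
  finally have near: "(\<Sum>m\<in>N. g (?p m)) \<le> 4 * g 0" .
  have far: "\<tau> \<le> max_norm (?p m)" if "m \<in> I - N" for m
    using that by (auto simp: N_def)
  note F = lattice_far_sum[where I = "I - N", OF ab far]
  have sN: "(\<lambda>m. g (?p m)) summable_on N" using finN by simp
  have split: "N \<union> (I - N) = I" by (auto simp: N_def)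
  show "(\<lambda>m. g (?p m)) summable_on I"
    using summable_on_Un_disjoint[OF sN F(1)] unfolding split by auto
  have "(\<Sum>\<^sub>\<infinity>m\<in>I. g (?p m)) = (\<Sum>\<^sub>\<infinity>m\<in>N. g (?p m)) + (\<Sum>\<^sub>\<infinity>m\<in>I - N. g (?p m))"
    using infsum_Un_disjoint[OF sN F(1)] unfolding split by auto
  then show "(\<Sum>\<^sub>\<infinity>m\<in>I. g (?p m)) \<le> 4 * g 0 + 4 * mass / \<tau>\<^sup>2"
    using near F(2) finN by simp
qed

end

section \<open>The Fejer kernel\<close>

text \<open>The Fejer kernel, normalised to have integral \<open>1\<close> over a period of length \<open>1\<close>.\<close>

definition fejer :: "nat \<Rightarrow> real \<Rightarrow> real" where
  "fejer N y = (\<Sum>i<N. \<Sum>j<N. cos (2 * pi * (real i - real j) * y)) / real N"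

lemma fejer_nonneg: "0 \<le> fejer N y"
proof -
  have "(\<Sum>i<N. \<Sum>j<N. cos (2 * pi * (real i - real j) * y))
    = (\<Sum>i<N. cos (2 * pi * real i * y))\<^sup>2 + (\<Sum>i<N. sin (2 * pi * real i * y))\<^sup>2"
    by (simp add: power2_eq_square sum_product sum.distrib[symmetric] cos_diff[symmetric]
        algebra_simps)
  then show ?thesis by (simp add: fejer_def)
qed

lemma fejer_bound: "fejer N y \<le> real N"
proof -
  have "(\<Sum>i<N. \<Sum>j<N. cos (2 * pi * (real i - real j) * y)) \<le> (\<Sum>i<N. \<Sum>j<N. 1)"
    by (intro sum_mono) simp
  then show ?thesis by (cases "N = 0") (simp_all add: fejer_def field_simps)
qed

lemma fejer_cis:
  "complex_of_real (fejer N y) = (\<Sum>i<N. \<Sum>j<N. cis (2 * pi * (real i - real j) * y)) / real N"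
proof -
  let ?s = "\<lambda>i j. sin (2 * pi * (real i - real j) * y)"
  have anti: "?s i j = - ?s j i" for i j
    by (simp add: sin_minus[symmetric] algebra_simps del: sin_minus)
  have "(\<Sum>i<N. \<Sum>j<N. ?s i j) = (\<Sum>i<N. \<Sum>j<N. - ?s j i)"
    by (intro sum.cong refl anti)
  also have "\<dots> = - (\<Sum>i<N. \<Sum>j<N. ?s j i)"
    by (simp add: sum_negf)
  also have "(\<Sum>i<N. \<Sum>j<N. ?s j i) = (\<Sum>i<N. \<Sum>j<N. ?s i j)"
    by (rule sum.swap)
  finally have "(\<Sum>i<N. \<Sum>j<N. ?s i j) = 0" by simp
  then have "(\<Sum>i<N. \<Sum>j<N. cis (2 * pi * (real i - real j) * y))
      = complex_of_real (\<Sum>i<N. \<Sum>j<N. cos (2 * pi * (real i - real j) * y))"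
    by (simp add: complex_eq_iff)
  then show ?thesis by (simp add: fejer_def)
qed

lemma fejer_measurable [measurable]: "fejer N \<in> borel_measurable borel"
  unfolding fejer_def by measurable

definition unit_interval :: "int \<Rightarrow> real set" where
  "unit_interval r = {of_int r - 1/2..<of_int r + 1/2}"

lemma unit_interval_measurable [measurable]: "unit_interval r \<in> sets borel"
  by (simp add: unit_interval_def)

lemma has_bochner_integral_cos_period:
  "has_bochner_integral lborel (\<lambda>y. cos (2 * pi * of_int m * y) * indicator (unit_interval r) y)
    (if m = 0 then 1 else 0)"
proof -
  let ?a = "of_int r - 1/2 :: real" and ?b = "of_int r + 1/2 :: real"
  have "has_bochner_integral lborel (\<lambda>y. cos (2 * pi * of_int m * y) * indicator {?a..?b} y)
    (if m = 0 then 1 else 0)"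
  proof (cases "m = 0")
    case True
    have "has_bochner_integral lborel (\<lambda>y. 1 * indicator {?a..?b} y) (?b - ?a)"
      by (rule has_bochner_integral_FTC_Icc_real) (auto intro!: derivative_eq_intros)
    then show ?thesis using True by simp
  next
    case False
    let ?F = "\<lambda>y :: real. sin (2 * pi * of_int m * y) / (2 * pi * of_int m)"
    have *: "has_bochner_integral lborel (\<lambda>y. cos (2 * pi * of_int m * y) * indicator {?a..?b} y)
        (?F ?b - ?F ?a)"
      by (rule has_bochner_integral_FTC_Icc_real)
        (use False in \<open>auto intro!: derivative_eq_intros continuous_intros\<close>)
    have "sin (2 * pi * of_int m * ?b) = sin (2 * pi * of_int m * ?a + 2 * pi * of_int m)"
      by (simp add: algebra_simps)
    also have "\<dots> = sin (2 * pi * of_int m * ?a)"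
      using sin_cos_eq_iff[of "2 * pi * of_int m * ?a + 2 * pi * of_int m" "2 * pi * of_int m * ?a"]
      by (simp add: sin_add)
    finally show ?thesis using * False by simp
  qed
  moreover have "AE y in lborel. cos (2 * pi * of_int m * y) * indicator {?a..?b} y
      = cos (2 * pi * of_int m * y) * (indicator (unit_interval r) y :: real)"
    using AE_lborel_singleton[of ?b]
    by eventually_elim (auto simp: unit_interval_def indicator_def)
  ultimately show ?thesis
    by (subst (asm) has_bochner_integral_cong_AE) auto
qed

lemma has_bochner_integral_fejer:
  assumes "N > 0"
  shows "has_bochner_integral lborel (\<lambda>y. fejer N y * indicator (unit_interval r) y) 1"
proof -
  have "has_bochner_integral lborel
     (\<lambda>y. (\<Sum>i<N. \<Sum>j<N. cos (2 * pi * of_int (int i - int j) * y) * indicator (unit_interval r) y) / real N)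
     ((\<Sum>i<N. \<Sum>j<N. if int i - int j = 0 then 1 else 0) / real N)"
    by (intro has_bochner_integral_divide_zero has_bochner_integral_sum
        has_bochner_integral_cos_period)
  moreover have "(\<Sum>i<N. \<Sum>j<N. if int i - int j = 0 then 1 else 0 :: real) = N"
    by simp
  ultimately show ?thesis using assms
    by (simp add: fejer_def sum_distrib_right[symmetric])
qed

text \<open>The first Fourier coefficient \<open>1 - 1/N\<close> tends to \<open>1\<close>. As for Korovkin's test functions, this alone
shows that the kernel concentrates at the integers, without a pointwise estimate of the kernel.\<close>

lemma has_bochner_integral_fejer_cos:
  assumes "N > 0"
  shows "has_bochner_integral lborel
    (\<lambda>y. cos (2 * pi * y) * (fejer N y * indicator (unit_interval r) y)) (1 - 1 / real N)"
proof -
  let ?I = "indicator (unit_interval r) :: real \<Rightarrow> real"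
  let ?e = "\<lambda>i j :: nat. ((if int i - int j + 1 = 0 then 1 else 0) + (if int i - int j - 1 = 0 then 1 else 0)) / 2 :: real"
  have 1: "has_bochner_integral lborel
     (\<lambda>y. (\<Sum>i<N. \<Sum>j<N. (cos (2 * pi * of_int (int i - int j + 1) * y) * ?I y
          + cos (2 * pi * of_int (int i - int j - 1) * y) * ?I y) / 2) / real N)
     ((\<Sum>i<N. \<Sum>j<N. ?e i j) / real N)"
    by (intro has_bochner_integral_divide_zero has_bochner_integral_sum
        has_bochner_integral_add has_bochner_integral_cos_period)
  have prod: "(cos (2 * pi * of_int (int i - int j + 1) * y) * ?I y
          + cos (2 * pi * of_int (int i - int j - 1) * y) * ?I y) / 2
      = cos (2 * pi * y) * (cos (2 * pi * (real i - real j) * y) * ?I y)" for i j y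
  proof -
    have "2 * pi * of_int (int i - int j + 1) * y = 2 * pi * (real i - real j) * y + 2 * pi * y"
      "2 * pi * of_int (int i - int j - 1) * y = 2 * pi * (real i - real j) * y - 2 * pi * y"
      by (simp_all add: algebra_simps)
    then show ?thesis by (simp only: cos_add cos_diff) (simp add: algebra_simps)
  qed
  have up: "(\<Sum>i<N. \<Sum>j<N. if int i - int j + 1 = 0 then 1 else 0 :: real) = real N - 1"
  proof -
    have "(\<Sum>j<N. if int i - int j + 1 = 0 then 1 else 0 :: real) = (if i < N - 1 then 1 else 0)" for i
    proof -
      have "(\<Sum>j<N. if int i - int j + 1 = 0 then 1 else 0 :: real) = (\<Sum>j<N. if j = Suc i then 1 else 0)"
        by (intro sum.cong) auto
      then show ?thesis by auto
    qed
    then have "(\<Sum>i<N. \<Sum>j<N. if int i - int j + 1 = 0 then 1 else 0 :: real)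
        = (\<Sum>i<N. if i < N - 1 then 1 else 0)" by simp
    also have "\<dots> = real (card {i. i < N \<and> i < N - 1})"
      by (simp add: sum.If_cases lessThan_def Int_def)
    also have "{i. i < N \<and> i < N - 1} = {..<N - 1}" by auto
    finally show ?thesis using assms by simp
  qed
  have down: "(\<Sum>i<N. \<Sum>j<N. if int i - int j - 1 = 0 then 1 else 0 :: real) = real N - 1"
  proof -
    have "(\<Sum>i<N. \<Sum>j<N. if int i - int j - 1 = 0 then 1 else 0 :: real)
        = (\<Sum>j<N. \<Sum>i<N. if int j - int i + 1 = 0 then 1 else 0)"
      by (subst sum.swap, intro sum.cong) auto
    with up show ?thesis by simp
  qed
  have "(\<Sum>i<N. \<Sum>j<N. ?e i j) = real N - 1"
    by (simp only: sum_divide_distrib[symmetric] sum.distrib up down) simp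
  then have "(\<Sum>i<N. \<Sum>j<N. ?e i j) / real N = 1 - 1 / real N"
    using assms by (simp add: diff_divide_distrib)
  with 1 show ?thesis
    unfolding prod fejer_def
    by (simp only: sum_distrib_left[symmetric] sum_distrib_right[symmetric]
        times_divide_eq_left times_divide_eq_right)
qed

lemma has_bochner_integral_product:
  fixes f h :: "real \<Rightarrow> real"
  assumes f: "has_bochner_integral lborel f I" and h: "has_bochner_integral lborel h J"
  shows "has_bochner_integral lborel (\<lambda>y. f (fst y) * h (snd y)) (I * J)"
proof -
  have [measurable]: "f \<in> borel_measurable borel" "h \<in> borel_measurable borel"
    using f h by (auto simp: has_bochner_integral_iff)
  have 1: "integrable (lborel \<Otimes>\<^sub>M lborel) (\<lambda>y. f (fst y) * h (snd y))"
    using f h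
    by (intro lborel_pair.Fubini_integrable) (auto simp: has_bochner_integral_iff abs_mult)
  have "(\<integral>y. f (fst y) * h (snd y) \<partial>(lborel \<Otimes>\<^sub>M lborel)) = (\<integral>x. \<integral>y. f x * h y \<partial>lborel \<partial>lborel)"
    using lborel_pair.integral_fst'[OF 1] by simp
  also have "\<dots> = I * J"
    using f h by (simp add: has_bochner_integral_iff)
  finally show ?thesis
    using 1 unfolding lborel_prod has_bochner_integral_iff by simp
qed

definition fejer2 :: "nat \<Rightarrow> real \<times> real \<Rightarrow> real" where
  "fejer2 N y = fejer N (fst y) * fejer N (snd y)"

definition unit_square :: "int \<times> int \<Rightarrow> (real \<times> real) set" where
  "unit_square r = unit_interval (fst r) \<times> unit_interval (snd r)"

lemma unit_square_measurable [measurable]: "unit_square r \<in> sets borel"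
  unfolding unit_square_def by (intro borel_Times) auto

lemma fejer2_measurable [measurable]: "fejer2 N \<in> borel_measurable borel"
  unfolding fejer2_def borel_prod[symmetric] by measurable

lemma fejer2_nonneg: "0 \<le> fejer2 N y"
  by (simp add: fejer2_def fejer_nonneg)

lemma fejer2_bound: "fejer2 N y \<le> (real N)\<^sup>2"
  unfolding fejer2_def power2_eq_square by (intro mult_mono fejer_bound fejer_nonneg) auto

lemma indicator_unit_square:
  "indicator (unit_square r) y
    = (indicator (unit_interval (fst r)) (fst y) * indicator (unit_interval (snd r)) (snd y) :: real)"
  by (auto simp: unit_square_def indicator_def mem_Times_iff)

lemma has_bochner_integral_fejer2:
  assumes "N > 0"
  shows "has_bochner_integral lborel (\<lambda>y. fejer2 N y * indicator (unit_square r) y) 1"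
  using has_bochner_integral_product[OF has_bochner_integral_fejer[OF assms, of "fst r"]
      has_bochner_integral_fejer[OF assms, of "snd r"]]
  by (simp add: fejer2_def indicator_unit_square ac_simps)

lemma has_bochner_integral_fejer2_cos:
  assumes "N > 0"
  shows "has_bochner_integral lborel
    (\<lambda>y. (2 - cos (2 * pi * fst y) - cos (2 * pi * snd y)) * (fejer2 N y * indicator (unit_square r) y))
    (2 / real N)"
proof -
  note F = has_bochner_integral_fejer[OF assms] and C = has_bochner_integral_fejer_cos[OF assms]
  let ?P = "\<lambda>y. fejer2 N y * indicator (unit_square r) y"
  have "has_bochner_integral lborel (\<lambda>y. 2 * ?P y - cos (2 * pi * fst y) * ?P y - cos (2 * pi * snd y) * ?P y)
     (2 * 1 - (1 - 1 / real N) - (1 - 1 / real N))"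
    using has_bochner_integral_product[OF C[of "fst r"] F[of "snd r"]]
      has_bochner_integral_product[OF F[of "fst r"] C[of "snd r"]]
    by (intro has_bochner_integral_diff has_bochner_integral_mult_right has_bochner_integral_fejer2 assms)
      (simp_all add: fejer2_def indicator_unit_square ac_simps)
  then show ?thesis by (simp add: algebra_simps)
qed

lemma unit_square_near:
  assumes "y \<in> unit_square r"
  shows "\<bar>fst y - of_int (fst r)\<bar> \<le> 1/2" "\<bar>snd y - of_int (snd r)\<bar> \<le> 1/2"
proof -
  have "of_int (fst r) - 1/2 \<le> fst y" "fst y < of_int (fst r) + 1/2"
    "of_int (snd r) - 1/2 \<le> snd y" "snd y < of_int (snd r) + 1/2"
    using assms by (auto simp: unit_square_def unit_interval_def mem_Times_iff)
  then show "\<bar>fst y - of_int (fst r)\<bar> \<le> 1/2" "\<bar>snd y - of_int (snd r)\<bar> \<le> 1/2"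
    by arith+
qed

text \<open>On the square around \<open>r\<close> the deviation \<open>|q(y) - q(r)|\<close> is at most \<open>\<epsilon>\<close> plus a multiple of
\<open>2 - cos 2\<pi>y\<^sub>1 - cos 2\<pi>y\<^sub>2\<close>, because the latter stays away from \<open>0\<close> outside a neighbourhood of the centre.
Its integral against the kernel is \<open>2/N\<close>.\<close>

lemma fejer2_concentrates:
  fixes q :: "real \<times> real \<Rightarrow> complex"
  assumes cont: "isCont q (real_pair r)" and q [measurable]: "q \<in> borel_measurable borel"
    and D: "\<And>y. y \<in> unit_square r \<Longrightarrow> cmod (q y) \<le> D"
  shows "(\<lambda>N. \<integral>y. (fejer2 (Suc N) y * indicator (unit_square r) y) *\<^sub>R q y \<partial>lborel)
    \<longlonglongrightarrow> q (real_pair r)"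
proof (rule LIMSEQ_I)
  fix e :: real assume "e > 0"
  define \<epsilon> where "\<epsilon> = e / 2"
  have \<epsilon>: "\<epsilon> > 0" using \<open>e > 0\<close> by (simp add: \<epsilon>_def)
  let ?p = "real_pair r"
  have "?p \<in> unit_square r" by (simp add: unit_square_def unit_interval_def real_pair_def)
  then have Dp: "cmod (q ?p) \<le> D" by (rule D)
  then have D0: "0 \<le> D" using norm_ge_zero order_trans by blast
  from cont \<epsilon> obtain s where s: "s > 0" "\<And>y. dist y ?p < s \<Longrightarrow> dist (q y) (q ?p) < \<epsilon>"
    unfolding continuous_at_eps_delta by blast
  define \<delta> where "\<delta> = min (s / 2) (1/4)"
  have \<delta>: "0 < \<delta>" "\<delta> \<le> 1/4" "2 * \<delta> \<le> s" using s by (auto simp: \<delta>_def)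
  \<comment> \<open>The least value of \<open>1 - cos 2\<pi>z\<close> at distance between \<open>\<delta>\<close> and \<open>1/2\<close> from an integer.\<close>
  define \<kappa> where "\<kappa> = 1 - cos (2 * pi * \<delta>)"
  have \<kappa>: "\<kappa> > 0"
  proof -
    have "2 * pi * \<delta> \<le> pi" using \<delta> by simp
    then have "cos (2 * pi * \<delta>) < cos 0"
      using \<delta> by (intro cos_monotone_0_pi) auto
    then show ?thesis by (simp add: \<kappa>_def)
  qed
  have far: "\<kappa> \<le> 1 - cos (2 * pi * z)" if z: "\<bar>z - of_int k\<bar> \<le> 1/2" "\<delta> \<le> \<bar>z - of_int k\<bar>" for z k
  proof -
    have "cos (2 * pi * z) = cos (2 * pi * (z - of_int k) + 2 * pi * of_int k)"
      by (simp add: algebra_simps)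
    also have "\<dots> = cos (2 * pi * \<bar>z - of_int k\<bar>)"
      by (simp add: cos_add abs_if)
        (metis cos_minus minus_diff_eq mult_minus_right)
    also have "\<dots> \<le> cos (2 * pi * \<delta>)"
      using z \<delta> by (intro cos_monotone_0_pi_le) (auto simp: field_simps)
    finally show ?thesis by (simp add: \<kappa>_def)
  qed
  define B where "B = 2 * D / \<kappa>"
  have B0: "0 \<le> B" using D0 \<kappa> by (simp add: B_def)
  let ?c = "\<lambda>y :: real \<times> real. 2 - cos (2 * pi * fst y) - cos (2 * pi * snd y)"
  have c0: "0 \<le> ?c y" for y
    using cos_le_one[of "2 * pi * fst y"] cos_le_one[of "2 * pi * snd y"] by linarith
  have point: "cmod (q y - q ?p) \<le> \<epsilon> + B * ?c y" if y: "y \<in> unit_square r" for y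
  proof (cases "\<bar>fst y - of_int (fst r)\<bar> < \<delta> \<and> \<bar>snd y - of_int (snd r)\<bar> < \<delta>")
    case True
    have "dist y ?p \<le> \<bar>fst y - of_int (fst r)\<bar> + \<bar>snd y - of_int (snd r)\<bar>"
      using norm_Pair_le[of "fst y - of_int (fst r)" "snd y - of_int (snd r)"]
      by (simp add: dist_norm real_pair_def minus_prod_def)
    also have "\<dots> < s" using True \<delta> by linarith
    finally have "cmod (q y - q ?p) < \<epsilon>" using s(2)[of y] by (simp add: dist_norm)
    moreover have "0 \<le> B * ?c y" using B0 c0 by simp
    ultimately show ?thesis by linarith
  next
    case False
    have "\<kappa> \<le> 1 - cos (2 * pi * fst y) \<or> \<kappa> \<le> 1 - cos (2 * pi * snd y)"
      using False unit_square_near[OF y] far by (meson not_less)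
    then have "\<kappa> \<le> ?c y"
      using cos_le_one[of "2 * pi * fst y"] cos_le_one[of "2 * pi * snd y"] by linarith
    then have "B * \<kappa> \<le> B * ?c y" using B0 by (rule mult_left_mono)
    then have "2 * D \<le> B * ?c y" using \<kappa> by (simp add: B_def)
    moreover have "cmod (q y - q ?p) \<le> 2 * D"
      using norm_triangle_ineq4[of "q y" "q ?p"] D[OF y] Dp by linarith
    ultimately show ?thesis using \<epsilon> by linarith
  qed
  have est: "cmod ((\<integral>y. (fejer2 N y * indicator (unit_square r) y) *\<^sub>R q y \<partial>lborel) - q ?p)
      \<le> \<epsilon> + B * (2 / real N)" if N: "N > 0" for N
  proof -
    let ?P = "\<lambda>y. fejer2 N y * indicator (unit_square r) y"
    have P0: "0 \<le> ?P y" for y using fejer2_nonneg by simp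
    note P = has_bochner_integral_fejer2[OF N, of r]
    note C = has_bochner_integral_fejer2_cos[OF N, of r]
    have intq: "integrable lborel (\<lambda>y. ?P y *\<^sub>R q y)"
    proof (rule Bochner_Integration.integrable_bound)
      show "integrable lborel (\<lambda>y. D * ?P y)"
        using P by (auto simp: has_bochner_integral_iff)
      show "AE y in lborel. norm (?P y *\<^sub>R q y) \<le> norm (D * ?P y)"
      proof (rule AE_I2)
        fix y show "norm (?P y *\<^sub>R q y) \<le> norm (D * ?P y)"
          using D[of y] fejer2_nonneg[of N y] D0
          by (cases "y \<in> unit_square r") (auto simp: mult.commute[of D] intro!: mult_left_mono)
      qed
    qed (auto intro: borel_measurable_scaleR)
    have intp: "integrable lborel (\<lambda>y. ?P y *\<^sub>R q ?p)"
      using P by (intro integrable_scaleR_left) (auto simp: has_bochner_integral_iff)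
    have "(\<integral>y. ?P y *\<^sub>R q ?p \<partial>lborel) = q ?p"
      using P by (subst integral_scaleR_left) (auto simp: has_bochner_integral_iff)
    then have "(\<integral>y. ?P y *\<^sub>R q y \<partial>lborel) - q ?p = (\<integral>y. ?P y *\<^sub>R (q y - q ?p) \<partial>lborel)"
      using intq intp by (simp add: scaleR_diff_right)
    also have "cmod \<dots> \<le> (\<integral>y. \<epsilon> * ?P y + B * (?c y * ?P y) \<partial>lborel)"
    proof (rule order_trans[OF integral_norm_bound], rule integral_mono)
      show "integrable lborel (\<lambda>y. norm (?P y *\<^sub>R (q y - q ?p)))"
        using intq intp by (intro integrable_norm) (simp add: scaleR_diff_right)
      show "integrable lborel (\<lambda>y. \<epsilon> * ?P y + B * (?c y * ?P y))"
        using P C by (auto simp: has_bochner_integral_iff)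
      fix y show "norm (?P y *\<^sub>R (q y - q ?p)) \<le> \<epsilon> * ?P y + B * (?c y * ?P y)"
      proof (cases "y \<in> unit_square r")
        case True
        have "norm (?P y *\<^sub>R (q y - q ?p)) = ?P y * cmod (q y - q ?p)"
          using P0[of y] by (simp add: norm_mult)
        also have "\<dots> \<le> ?P y * (\<epsilon> + B * ?c y)"
          using point[OF True] P0 by (intro mult_left_mono)
        finally show ?thesis by (simp add: algebra_simps)
      qed simp
    qed
    also have "\<dots> = \<epsilon> * 1 + B * (2 / real N)"
      using P C by (simp add: has_bochner_integral_iff)
    finally show ?thesis by simp
  qed
  have "(\<lambda>N. B * (2 / real (Suc N))) \<longlonglongrightarrow> 0" by real_asymp
  then obtain n0 where n0: "\<And>n. n \<ge> n0 \<Longrightarrow> \<bar>B * (2 / real (Suc n))\<bar> < \<epsilon>"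
    using LIMSEQ_D[OF _ \<epsilon>] by (metis diff_0_right real_norm_def)
  show "\<exists>n0. \<forall>n\<ge>n0. norm ((\<integral>y. (fejer2 (Suc n) y * indicator (unit_square r) y) *\<^sub>R q y \<partial>lborel) - q ?p) < e"
  proof (intro exI allI impI)
    fix n assume "n \<ge> n0"
    then show "norm ((\<integral>y. (fejer2 (Suc n) y * indicator (unit_square r) y) *\<^sub>R q y \<partial>lborel) - q ?p) < e"
      using est[OF zero_less_Suc, of n] n0[of n] unfolding \<epsilon>_def by linarith
  qed
qed

section \<open>Poisson summation for nonnegative kernels\<close>

lemma in_unit_square_round: "y \<in> unit_square (\<lfloor>fst y + 1/2\<rfloor>, \<lfloor>snd y + 1/2\<rfloor>)"
proof -
  have "z \<in> unit_interval \<lfloor>z + 1/2\<rfloor>" for z :: real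
    unfolding unit_interval_def by (simp; linarith)
  then show ?thesis by (simp add: unit_square_def mem_Times_iff)
qed

lemma unit_square_disjoint:
  assumes "y \<in> unit_square r" "y \<in> unit_square s"
  shows "r = s"
proof -
  have "k = l" if "z \<in> unit_interval k" "z \<in> unit_interval l" for z and k l :: int
    using that unfolding unit_interval_def by auto
  with assms show ?thesis by (auto simp: unit_square_def mem_Times_iff prod_eq_iff)
qed

lemma nn_integral_count_space_infsum:
  assumes "D summable_on A" "\<And>r. r \<in> A \<Longrightarrow> 0 \<le> D r"
  shows "(\<integral>\<^sup>+r. ennreal (D r) \<partial>count_space A) = ennreal (\<Sum>\<^sub>\<infinity>r\<in>A. D r)"
proof -
  have "(\<lambda>r. norm (D r)) summable_on A"
    by (rule iffD1[OF summable_on_iff_abs_summable_on_real assms(1)])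
  then have "Infinite_Set_Sum.abs_summable_on D A"
    by (simp only: abs_summable_equivalent)
  then show ?thesis
    using assms(2) by (simp add: nn_integral_conv_infsetsum infsetsum_infsum)
qed

lemma infsum_tail_small:
  fixes D :: "'a \<Rightarrow> real"
  assumes "D summable_on UNIV" "\<epsilon> > 0"
  obtains A where "finite A" "\<bar>\<Sum>\<^sub>\<infinity>r\<in>- A. D r\<bar> < \<epsilon>"
proof -
  have "((\<lambda>A. sum D A) \<longlongrightarrow> infsum D UNIV) (finite_subsets_at_top UNIV)"
    using assms(1) by (simp add: has_sum_def[symmetric])
  then have "\<forall>\<^sub>F A in finite_subsets_at_top UNIV. dist (sum D A) (infsum D UNIV) < \<epsilon>"
    using assms(2) by (rule tendstoD)
  then obtain A where A: "finite A" "dist (sum D A) (infsum D UNIV) < \<epsilon>"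
    by (auto simp: eventually_finite_subsets_at_top)
  have "infsum D UNIV = infsum D A + infsum D (- A)"
    using infsum_Un_disjoint[of D A "- A"] A(1) assms(1)
    by (auto intro: summable_on_subset_banach)
  with A have "\<bar>infsum D (- A)\<bar> < \<epsilon>"
    by (simp add: dist_real_def)
  with A that show ?thesis by blast
qed

text \<open>Concentration at each lattice point, with \<open>D\<close> as a dominating sequence: outside finitely many unit
squares both the integral and the sum are bounded by a tail of \<open>D\<close>.\<close>

lemma fejer2_sums_lattice:
  fixes q :: "real \<times> real \<Rightarrow> complex"
  assumes cont: "\<And>y. isCont q y" and int: "integrable lborel q"
    and D: "\<And>r y. y \<in> unit_square r \<Longrightarrow> cmod (q y) \<le> D r" and sumD: "D summable_on UNIV"
  shows "(\<lambda>N. \<integral>y. fejer2 (Suc N) y *\<^sub>R q y \<partial>lborel) \<longlonglongrightarrow> (\<Sum>\<^sub>\<infinity>r. q (real_pair r))"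
proof (rule LIMSEQ_I)
  fix e :: real assume "e > 0"
  have [measurable]: "q \<in> borel_measurable borel" using int by auto
  have pin: "real_pair r \<in> unit_square r" for r
    by (simp add: unit_square_def unit_interval_def real_pair_def)
  have D0: "0 \<le> D r" for r using D[OF pin, of r] norm_ge_zero order_trans by blast
  obtain A where A: "finite A" "\<bar>\<Sum>\<^sub>\<infinity>r\<in>- A. D r\<bar> < e / 4"
    using infsum_tail_small[OF sumD, of "e / 4"] \<open>e > 0\<close> by auto
  have sumD': "D summable_on B" for B using sumD by (rule summable_on_subset_banach) auto
  have qs: "(\<lambda>r. norm (q (real_pair r))) summable_on B" for B
    by (rule Infinite_Sum.abs_summable_on_comparison_test[OF iffD1[OF summable_on_iff_abs_summable_on_real sumD'[of B]]])
      (use D[OF pin] D0 in auto)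
  let ?L = "\<Sum>\<^sub>\<infinity>r. q (real_pair r)"
  have L: "?L = (\<Sum>r\<in>A. q (real_pair r)) + (\<Sum>\<^sub>\<infinity>r\<in>- A. q (real_pair r))"
    using infsum_Un_disjoint[of "\<lambda>r. q (real_pair r)" A "- A"] A(1) abs_summable_summable[OF qs]
    by auto
  have tailL: "cmod (\<Sum>\<^sub>\<infinity>r\<in>- A. q (real_pair r)) \<le> e / 4"
  proof -
    have "cmod (\<Sum>\<^sub>\<infinity>r\<in>- A. q (real_pair r)) \<le> (\<Sum>\<^sub>\<infinity>r\<in>- A. D r)"
      by (rule norm_infsum_le[OF has_sum_infsum has_sum_infsum])
        (use abs_summable_summable[OF qs] sumD' D[OF pin] in auto)
    with A show ?thesis by linarith
  qed
  let ?cell = "\<lambda>N r. \<integral>y. (fejer2 N y * indicator (unit_square r) y) *\<^sub>R q y \<partial>lborel"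
  have intF: "integrable lborel (\<lambda>y. (fejer2 N y * indicator B y) *\<^sub>R q y)"
    if [measurable]: "B \<in> sets borel" for N and B :: "(real \<times> real) set"
  proof (rule Bochner_Integration.integrable_bound)
    show "integrable lborel (\<lambda>y. (real N)\<^sup>2 *\<^sub>R q y)" using int by simp
    show "AE y in lborel. norm ((fejer2 N y * indicator B y) *\<^sub>R q y) \<le> norm ((real N)\<^sup>2 *\<^sub>R q y)"
    proof (rule AE_I2)
      fix y show "norm ((fejer2 N y * indicator B y) *\<^sub>R q y) \<le> norm ((real N)\<^sup>2 *\<^sub>R q y)"
        using fejer2_bound[of N y] fejer2_nonneg[of N y]
        by (auto simp: indicator_def abs_mult intro!: mult_right_mono)
    qed
  qed (auto intro: borel_measurable_scaleR)
  have tail: "cmod ((\<integral>y. fejer2 N y *\<^sub>R q y \<partial>lborel) - (\<Sum>r\<in>A. ?cell N r)) \<le> e / 4" if N: "N > 0" for N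
  proof -
    define R where "R = - (\<Union>r\<in>A. unit_square r)"
    have [measurable]: "R \<in> sets borel"
      unfolding R_def using A(1) by (intro borel_comp sets.finite_UN) auto
    have split: "fejer2 N y *\<^sub>R q y = (\<Sum>r\<in>A. (fejer2 N y * indicator (unit_square r) y) *\<^sub>R q y)
        + (fejer2 N y * indicator R y) *\<^sub>R q y" for y
    proof -
      have "(\<Sum>r\<in>A. indicator (unit_square r) y) + indicator R y = (1 :: real)"
      proof (cases "\<exists>r\<in>A. y \<in> unit_square r")
        case True
        then obtain r where r: "r \<in> A" "y \<in> unit_square r" by auto
        have "(\<Sum>s\<in>A. indicator (unit_square s) y) = (\<Sum>s\<in>A. if s = r then 1 else 0 :: real)"
          by (intro sum.cong refl) (use r in \<open>auto simp: indicator_def dest: unit_square_disjoint[OF r(2)]\<close>)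
        moreover have "indicator R y = (0 :: real)" using r by (auto simp: R_def indicator_def)
        ultimately show ?thesis using r A(1) by simp
      next
        case False
        then have "(\<Sum>s\<in>A. indicator (unit_square s) y) = (0 :: real)"
          by (intro sum.neutral) auto
        moreover have "indicator R y = (1 :: real)" using False by (auto simp: R_def indicator_def)
        ultimately show ?thesis by simp
      qed
      then have "fejer2 N y *\<^sub>R q y
          = (fejer2 N y * ((\<Sum>r\<in>A. indicator (unit_square r) y) + indicator R y)) *\<^sub>R q y" by simp
      then show ?thesis
        by (simp only: distrib_left scaleR_add_left sum_distrib_left scaleR_sum_left)
    qed
    have "(\<integral>y. fejer2 N y *\<^sub>R q y \<partial>lborel)
        = (\<integral>y. (\<Sum>r\<in>A. (fejer2 N y * indicator (unit_square r) y) *\<^sub>R q y)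
            + (fejer2 N y * indicator R y) *\<^sub>R q y \<partial>lborel)"
      by (rule Bochner_Integration.integral_cong[OF refl split])
    also have "\<dots> = (\<Sum>r\<in>A. ?cell N r) + (\<integral>y. (fejer2 N y * indicator R y) *\<^sub>R q y \<partial>lborel)"
      by (subst Bochner_Integration.integral_add)
        (auto intro!: intF Bochner_Integration.integrable_sum simp: Bochner_Integration.integral_sum intF)
    finally have "cmod ((\<integral>y. fejer2 N y *\<^sub>R q y \<partial>lborel) - (\<Sum>r\<in>A. ?cell N r))
        = cmod (\<integral>y. (fejer2 N y * indicator R y) *\<^sub>R q y \<partial>lborel)" by simp
    moreover have "ennreal (cmod (\<integral>y. (fejer2 N y * indicator R y) *\<^sub>R q y \<partial>lborel)) \<le> ennreal (e / 4)"
    proof -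
      let ?H = "\<lambda>r y. ennreal (D r) * ennreal (fejer2 N y * indicator (unit_square r) y)"
      have "ennreal (cmod (\<integral>y. (fejer2 N y * indicator R y) *\<^sub>R q y \<partial>lborel))
          \<le> (\<integral>\<^sup>+y. ennreal (norm ((fejer2 N y * indicator R y) *\<^sub>R q y)) \<partial>lborel)"
        by (rule integral_norm_bound_ennreal) (auto intro: intF)
      also have "\<dots> \<le> (\<integral>\<^sup>+y. (\<integral>\<^sup>+r. ?H r y \<partial>count_space (- A)) \<partial>lborel)"
      proof (rule nn_integral_mono)
        fix y :: "real \<times> real"
        show "ennreal (norm ((fejer2 N y * indicator R y) *\<^sub>R q y)) \<le> (\<integral>\<^sup>+r. ?H r y \<partial>count_space (- A))"
        proof (cases "y \<in> R")
          case True
          define r where "r = (\<lfloor>fst y + 1/2\<rfloor>, \<lfloor>snd y + 1/2\<rfloor>)"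
          have yr: "y \<in> unit_square r" unfolding r_def by (rule in_unit_square_round)
          with True have rA: "r \<in> - A" by (auto simp: R_def)
          have "norm ((fejer2 N y * indicator R y) *\<^sub>R q y) = fejer2 N y * cmod (q y)"
            using True fejer2_nonneg[of N y] by simp
          also have "\<dots> \<le> fejer2 N y * D r"
            using D[OF yr] fejer2_nonneg by (intro mult_left_mono)
          finally have "ennreal (norm ((fejer2 N y * indicator R y) *\<^sub>R q y)) \<le> ?H r y"
            using yr D0 fejer2_nonneg by (simp add: ennreal_mult[symmetric] mult.commute ennreal_leI)
          also have "?H r y \<le> (\<integral>\<^sup>+r. ?H r y \<partial>count_space (- A))"
            using rA by (rule nn_integral_ge_point)
          finally show ?thesis .
        qed simp
      qed
      also have "\<dots> = (\<integral>\<^sup>+r. (\<integral>\<^sup>+y. ?H r y \<partial>lborel) \<partial>count_space (- A))"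
        by (rule nn_integral_count_space_nn_integral) auto
      also have "\<dots> = (\<integral>\<^sup>+r. ennreal (D r) \<partial>count_space (- A))"
      proof (rule nn_integral_cong)
        fix r
        have "(\<integral>\<^sup>+y. ennreal (fejer2 N y * indicator (unit_square r) y) \<partial>lborel) = ennreal 1"
          using has_bochner_integral_fejer2[OF N, of r] fejer2_nonneg
          by (subst nn_integral_eq_integral) (auto simp: has_bochner_integral_iff)
        then show "(\<integral>\<^sup>+y. ?H r y \<partial>lborel) = ennreal (D r)"
          by (subst nn_integral_cmult) auto
      qed
      also have "\<dots> = ennreal (\<Sum>\<^sub>\<infinity>r\<in>- A. D r)"
        using D0 by (intro nn_integral_count_space_infsum sumD') auto
      also have "\<dots> \<le> ennreal (e / 4)" using A(2) by (intro ennreal_leI) linarith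
      finally show ?thesis .
    qed
    ultimately show ?thesis using \<open>e > 0\<close> by simp
  qed
  have lim: "(\<lambda>N. \<Sum>r\<in>A. ?cell (Suc N) r) \<longlonglongrightarrow> (\<Sum>r\<in>A. q (real_pair r))"
    by (rule tendsto_sum, rule fejer2_concentrates[OF cont _ D]) auto
  obtain n0 where n0: "\<And>n. n \<ge> n0 \<Longrightarrow> norm ((\<Sum>r\<in>A. ?cell (Suc n) r) - (\<Sum>r\<in>A. q (real_pair r))) < e / 4"
    using LIMSEQ_D[OF lim, of "e / 4"] \<open>e > 0\<close> by auto
  show "\<exists>n0. \<forall>n\<ge>n0. norm ((\<integral>y. fejer2 (Suc n) y *\<^sub>R q y \<partial>lborel) - ?L) < e"
  proof (intro exI allI impI)
    fix n assume n: "n \<ge> n0"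
    let ?a = "\<integral>y. fejer2 (Suc n) y *\<^sub>R q y \<partial>lborel" and ?b = "\<Sum>r\<in>A. ?cell (Suc n) r"
      and ?c = "\<Sum>r\<in>A. q (real_pair r)"
    have tri: "norm (u - l) \<le> norm (u - v) + norm (v - w) + norm t" if "l = w + t" for u v w l t :: complex
      using that norm_triangle_ineq4[of "(u - v) + (v - w)" t] norm_triangle_ineq[of "u - v" "v - w"]
      by (simp add: diff_diff_eq)
    have "norm (?a - ?L) \<le> norm (?a - ?b) + norm (?b - ?c) + norm (\<Sum>\<^sub>\<infinity>r\<in>- A. q (real_pair r))"
      by (rule tri[OF L])
    also have "\<dots> < e" using tail[of "Suc n"] n0[OF n] tailL \<open>e > 0\<close> by simp
    finally show "norm (?a - ?L) < e" .
  qed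
qed

lemma card_difference_eq_le: "card {(i, j). i < N \<and> j < N \<and> int i - int j = m} \<le> N"
proof -
  have "inj_on fst {(i, j). i < N \<and> j < N \<and> int i - int j = m}"
    by (auto simp: inj_on_def)
  then have "card {(i, j). i < N \<and> j < N \<and> int i - int j = m}
      = card (fst ` {(i, j). i < N \<and> j < N \<and> int i - int j = m})"
    by (simp add: card_image)
  also have "\<dots> \<le> card {..<N}" by (intro card_mono) auto
  finally show ?thesis by simp
qed

lemma card_difference_eq_ge: "int N - \<bar>m\<bar> \<le> int (card {(i, j). i < N \<and> j < N \<and> int i - int j = m})"
proof -
  let ?S = "{(i, j). i < N \<and> j < N \<and> int i - int j = m}"
  let ?f = "\<lambda>t. (t + nat m, t + nat (- m))"
  have fin: "finite ?S" by (rule finite_subset[of _ "{..<N} \<times> {..<N}"]) auto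
  have "?f ` {..<N - nat \<bar>m\<bar>} \<subseteq> ?S"
    by (cases "m \<ge> 0") auto
  then have "card (?f ` {..<N - nat \<bar>m\<bar>}) \<le> card ?S" by (rule card_mono[OF fin])
  moreover have "card (?f ` {..<N - nat \<bar>m\<bar>}) = N - nat \<bar>m\<bar>"
    by (subst card_image) (auto simp: inj_on_def)
  ultimately show ?thesis by linarith
qed

text \<open>Index set of the double sums that define a product of two Fejer kernels; \<open>grid_diff\<close> gives the
frequency of a term.\<close>

definition difference_grid :: "nat \<Rightarrow> ((nat \<times> nat) \<times> nat \<times> nat) set" where
  "difference_grid N = ({..<N} \<times> {..<N}) \<times> ({..<N} \<times> {..<N})"

definition grid_diff :: "(nat \<times> nat) \<times> nat \<times> nat \<Rightarrow> int \<times> int" where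
  "grid_diff w = (int (fst (fst w)) - int (snd (fst w)), int (fst (snd w)) - int (snd (snd w)))"

lemma finite_difference_grid [simp]: "finite (difference_grid N)"
  by (simp add: difference_grid_def)

lemma grid_fibre:
  "{w \<in> difference_grid N. grid_diff w = m}
    = {(i, j). i < N \<and> j < N \<and> int i - int j = fst m} \<times> {(i, j). i < N \<and> j < N \<and> int i - int j = snd m}"
  by (auto simp: difference_grid_def grid_diff_def prod_eq_iff)

lemma card_grid_fibre_le: "real (card {w \<in> difference_grid N. grid_diff w = m}) \<le> (real N)\<^sup>2"
  unfolding grid_fibre card_cartesian_product of_nat_mult power2_eq_square
  by (intro mult_mono) (use card_difference_eq_le in auto)

lemma card_grid_fibre_density:
  "(\<lambda>N. real (card {w \<in> difference_grid (Suc N). grid_diff w = m}) / (real (Suc N))\<^sup>2) \<longlonglongrightarrow> 1"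
proof (rule tendsto_sandwich)
  let ?c = "\<lambda>N m. real (card {(i, j). i < N \<and> j < N \<and> int i - int j = m})"
  let ?l = "\<lambda>m N. 1 - real_of_int \<bar>m\<bar> / real (Suc N)"
  have lim1: "?l m \<longlonglongrightarrow> 1" for m by real_asymp
  have "(\<lambda>N. ?l (fst m) N * ?l (snd m) N) \<longlonglongrightarrow> 1 * 1" by (intro tendsto_mult lim1)
  then show "(\<lambda>N. ?l (fst m) N * ?l (snd m) N) \<longlonglongrightarrow> 1" by simp
  have ge: "?l k N * real (Suc N) \<le> ?c (Suc N) k" for k N
  proof -
    have "?l k N * real (Suc N) = real (Suc N) - real_of_int \<bar>k\<bar>"
      by (simp add: left_diff_distrib)
    also have "\<dots> = real_of_int (int (Suc N) - \<bar>k\<bar>)" by simp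
    also have "\<dots> \<le> real_of_int (int (card {(i, j). i < Suc N \<and> j < Suc N \<and> int i - int j = k}))"
      using card_difference_eq_ge[of "Suc N" k] by (simp only: of_int_le_iff)
    finally show ?thesis by simp
  qed
  have "\<forall>\<^sub>F N in sequentially. 0 \<le> ?l k N" for k
    using order_tendstoD(1)[OF lim1[of k], of 0] by (auto elim: eventually_mono)
  then have "\<forall>\<^sub>F N in sequentially. 0 \<le> ?l (fst m) N \<and> 0 \<le> ?l (snd m) N"
    by (intro eventually_conj)
  then show "\<forall>\<^sub>F N in sequentially. ?l (fst m) N * ?l (snd m) N
      \<le> real (card {w \<in> difference_grid (Suc N). grid_diff w = m}) / (real (Suc N))\<^sup>2"
  proof eventually_elim
    case (elim N)
    have "(?l (fst m) N * real (Suc N)) * (?l (snd m) N * real (Suc N)) \<le> ?c (Suc N) (fst m) * ?c (Suc N) (snd m)"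
      by (intro mult_mono ge) (use elim in auto)
    then have "?l (fst m) N * ?l (snd m) N * (real (Suc N))\<^sup>2 \<le> ?c (Suc N) (fst m) * ?c (Suc N) (snd m)"
      by (simp only: power2_eq_square ac_simps)
    then show ?case
      unfolding grid_fibre card_cartesian_product of_nat_mult
      by (subst pos_le_divide_eq) auto
  qed
  show "\<forall>\<^sub>F N in sequentially. real (card {w \<in> difference_grid (Suc N). grid_diff w = m}) / (real (Suc N))\<^sup>2 \<le> 1"
  proof (intro always_eventually allI)
    fix N
    show "real (card {w \<in> difference_grid (Suc N). grid_diff w = m}) / (real (Suc N))\<^sup>2 \<le> 1"
      using card_grid_fibre_le[of "Suc N" m] by (simp only: divide_le_eq_1) simp
  qed
qed simp

text \<open>Summability by Fejer means implies summability for nonnegative terms. The weight of \<open>F m\<close> in the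
average is at most \<open>1\<close> and tends to \<open>1\<close>, so each finite partial sum is at most \<open>L\<close>, and each average is
at most the full sum.\<close>

lemma has_sum_of_grid_averages:
  fixes F :: "int \<times> int \<Rightarrow> real"
  assumes F0: "\<And>m. 0 \<le> F m"
    and lim: "(\<lambda>N. (\<Sum>w\<in>difference_grid (Suc N). F (grid_diff w)) / (real (Suc N))\<^sup>2) \<longlonglongrightarrow> L"
  shows "(F has_sum L) UNIV"
proof -
  let ?c = "\<lambda>N m. real (card {w \<in> difference_grid N. grid_diff w = m})"
  have fib: "(\<Sum>w\<in>{w \<in> difference_grid N. grid_diff w = m}. F (grid_diff w)) = ?c N m * F m" for N m
    by simp
  have upper: "sum F A \<le> L" if A: "finite A" for A
  proof (rule LIMSEQ_le)
    have "(\<lambda>N. \<Sum>m\<in>A. ?c (Suc N) m / (real (Suc N))\<^sup>2 * F m) \<longlonglongrightarrow> (\<Sum>m\<in>A. 1 * F m)"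
      by (intro tendsto_sum tendsto_mult card_grid_fibre_density tendsto_const)
    then show "(\<lambda>N. \<Sum>m\<in>A. ?c (Suc N) m / (real (Suc N))\<^sup>2 * F m) \<longlonglongrightarrow> sum F A" by simp
    show "(\<lambda>N. (\<Sum>w\<in>difference_grid (Suc N). F (grid_diff w)) / (real (Suc N))\<^sup>2) \<longlonglongrightarrow> L" by (rule lim)
    have "(\<Sum>m\<in>A. ?c N m / (real N)\<^sup>2 * F m) \<le> (\<Sum>w\<in>difference_grid N. F (grid_diff w)) / (real N)\<^sup>2" for N
    proof -
      have "(\<Sum>m\<in>A. ?c N m * F m) = (\<Sum>m\<in>A. \<Sum>w\<in>{w \<in> {w \<in> difference_grid N. grid_diff w \<in> A}. grid_diff w = m}. F (grid_diff w))"
        unfolding fib[symmetric] by (intro sum.cong refl) auto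
      also have "\<dots> = (\<Sum>w\<in>{w \<in> difference_grid N. grid_diff w \<in> A}. F (grid_diff w))"
        using A by (intro sum.group) auto
      also have "\<dots> \<le> (\<Sum>w\<in>difference_grid N. F (grid_diff w))"
        by (intro sum_mono2) (auto intro: F0)
      finally have "(\<Sum>m\<in>A. ?c N m * F m) / (real N)\<^sup>2 \<le> (\<Sum>w\<in>difference_grid N. F (grid_diff w)) / (real N)\<^sup>2"
        by (intro divide_right_mono) auto
      then show ?thesis by (simp add: sum_divide_distrib)
    qed
    then show "\<exists>N. \<forall>n\<ge>N. (\<Sum>m\<in>A. ?c (Suc n) m / (real (Suc n))\<^sup>2 * F m)
        \<le> (\<Sum>w\<in>difference_grid (Suc n). F (grid_diff w)) / (real (Suc n))\<^sup>2" by blast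
  qed
  have summable: "F summable_on UNIV"
    by (rule nonneg_bdd_above_summable_on) (auto intro!: F0 bdd_aboveI[of _ L] upper)
  have "infsum F UNIV \<le> L"
    by (rule infsum_le_finite_sums[OF summable]) (auto intro: upper)
  moreover have "L \<le> infsum F UNIV"
  proof (rule LIMSEQ_le_const2[OF lim], intro exI allI impI)
    fix N :: nat
    let ?n = "Suc N" and ?A = "grid_diff ` difference_grid (Suc N)"
    have "(\<Sum>w\<in>difference_grid ?n. F (grid_diff w)) = (\<Sum>m\<in>?A. ?c ?n m * F m)"
      unfolding fib[symmetric] by (intro sum.group[symmetric]) auto
    also have "\<dots> \<le> (\<Sum>m\<in>?A. (real ?n)\<^sup>2 * F m)"
      by (intro sum_mono mult_right_mono card_grid_fibre_le F0)
    also have "\<dots> = (real ?n)\<^sup>2 * sum F ?A" by (simp only: sum_distrib_left)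
    also have "\<dots> \<le> (real ?n)\<^sup>2 * infsum F UNIV"
      by (intro mult_left_mono finite_sum_le_infsum summable) (auto intro: F0)
    finally show "(\<Sum>w\<in>difference_grid ?n. F (grid_diff w)) / (real ?n)\<^sup>2 \<le> infsum F UNIV"
      by (subst pos_divide_le_eq) (auto simp: mult.commute)
  qed
  ultimately show ?thesis using summable has_sum_infsum by fastforce
qed

lemma fejer2_cis:
  "complex_of_real (fejer2 N y)
    = (\<Sum>w\<in>difference_grid N. cis (2 * pi * (real_pair (grid_diff w) \<bullet> y))) / (real N)\<^sup>2"
proof -
  let ?e = "\<lambda>i j t. cis (2 * pi * (real i - real j) * t)"
  have "complex_of_real (fejer2 N y)
      = (\<Sum>(i,j)\<in>{..<N} \<times> {..<N}. ?e i j (fst y)) / real N * ((\<Sum>(i,j)\<in>{..<N} \<times> {..<N}. ?e i j (snd y)) / real N)"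
    by (simp add: fejer2_def fejer_cis sum.cartesian_product)
  also have "\<dots> = (\<Sum>u\<in>{..<N} \<times> {..<N}. \<Sum>v\<in>{..<N} \<times> {..<N}.
      ?e (fst u) (snd u) (fst y) * ?e (fst v) (snd v) (snd y)) / (real N)\<^sup>2"
    by (simp add: sum_product power2_eq_square case_prod_beta)
  also have "\<dots> = (\<Sum>w\<in>difference_grid N. ?e (fst (fst w)) (snd (fst w)) (fst y) * ?e (fst (snd w)) (snd (snd w)) (snd y)) / (real N)\<^sup>2"
    unfolding difference_grid_def by (simp add: sum.cartesian_product case_prod_beta)
  also have "\<dots> = (\<Sum>w\<in>difference_grid N. cis (2 * pi * (real_pair (grid_diff w) \<bullet> y))) / (real N)\<^sup>2"
    by (intro arg_cong2[where f = "(/)"] sum.cong refl)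
      (simp add: cis_mult grid_diff_def real_pair_def inner_prod_def algebra_simps)
  finally show ?thesis .
qed

locale dominated_kernel = radial_majorant g for g +
  fixes K :: "real \<times> real \<Rightarrow> real" and k :: "real \<times> real \<Rightarrow> complex"
  assumes K_nonneg: "0 \<le> K l"
    and K_eq_fourier: "complex_of_real (K l) = fourier k l"
    and k_isCont: "isCont k x"
    and k_dominated: "cmod (k x) \<le> g x"
begin

text \<open>Finite Fejer averages of the left-hand series are, by the inversion formula for \<open>K\<close>, integrals over
the plane of \<open>q(y) = k(a y\<^sub>1, b y\<^sub>2) exp (- i \<theta>\<cdot>y)\<close> against the Fejer kernel, and these converge to the
sum of \<open>q\<close> over the lattice. As \<open>K \<ge> 0\<close>, convergence of the averages is convergence of the series at
every point \<open>\<theta>\<close>; the summability of the kernel weights is part of the conclusion.\<close>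

lemma poisson_summation:
  assumes ab: "a > 0" "b > 0"
  obtains s where
    "((\<lambda>m. K ((fst \<theta> - 2 * pi * of_int (fst m)) / a, (snd \<theta> - 2 * pi * of_int (snd m)) / b)) has_sum s) UNIV"
    "complex_of_real s = of_real (a * b / (4 * pi\<^sup>2))
      * (\<Sum>\<^sub>\<infinity>r. k (a * of_int (fst r), b * of_int (snd r)) * cis (- (\<theta> \<bullet> real_pair r)))"
proof -
  let ?F = "\<lambda>m. K ((fst \<theta> - 2 * pi * of_int (fst m)) / a, (snd \<theta> - 2 * pi * of_int (snd m)) / b)"
  let ?L = "of_real (a * b / (4 * pi\<^sup>2))
      * (\<Sum>\<^sub>\<infinity>r. k (a * of_int (fst r), b * of_int (snd r)) * cis (- (\<theta> \<bullet> real_pair r)))"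
  define q where "q = (\<lambda>y. k (a * fst y, b * snd y) * cis (- (\<theta> \<bullet> y)))"
  have q_cont: "isCont q y" for y
  proof -
    have "isCont (\<lambda>y. k (a * fst y, b * snd y)) y"
      by (rule isCont_o2[OF _ k_isCont]) (intro continuous_intros)
    moreover have "isCont (\<lambda>y. cis (- (\<theta> \<bullet> y))) y"
      unfolding cis_conv_exp by (intro continuous_intros)
    ultimately show ?thesis unfolding q_def by (rule isCont_mult)
  qed
  have [measurable]: "k \<in> borel_measurable borel"
    using k_isCont by (intro borel_measurable_continuous_onI continuous_at_imp_continuous_on) auto
  have q_meas [measurable]: "q \<in> borel_measurable borel"
    using q_cont by (intro borel_measurable_continuous_onI continuous_at_imp_continuous_on) auto
  have q_le: "cmod (q y) \<le> g (a * fst y, b * snd y)" for y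
    using k_dominated by (simp add: q_def norm_mult)
  have q_int: "integrable lborel q"
    by (rule Bochner_Integration.integrable_bound[OF integrable_diagonal_scaling[of a b, OF _ _ integrable]])
      (use ab q_le in \<open>auto intro: order_trans[OF q_le abs_ge_self]\<close>)
  \<comment> \<open>A point in the unit square around an integer point has coordinates at least half as large,
    so one lattice sum with halved spacing dominates \<open>q\<close> on all the squares.\<close>
  let ?D = "\<lambda>r :: int \<times> int. g (0 + a / 2 * of_int (fst r), 0 + b / 2 * of_int (snd r))"
  have D: "cmod (q y) \<le> ?D r" if y: "y \<in> unit_square r" for r y
  proof -
    have half: "\<bar>of_int n\<bar> / 2 \<le> \<bar>z\<bar>" if "\<bar>z - of_int n\<bar> \<le> 1/2" for z :: real and n :: int
      using that by (cases "n = 0") linarith+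
    have "max_norm (a / 2 * of_int (fst r), b / 2 * of_int (snd r)) \<le> max_norm (a * fst y, b * snd y)"
      unfolding max_norm_def
      using ab mult_left_mono[OF half[OF unit_square_near(1)[OF y]], of a]
        mult_left_mono[OF half[OF unit_square_near(2)[OF y]], of b]
      by (intro max.mono) (auto simp: abs_mult)
    then have "g (a * fst y, b * snd y) \<le> ?D r" using antimono by simp
    with q_le show ?thesis by (rule order_trans)
  qed
  have sumD: "?D summable_on UNIV"
    by (rule lattice_sum(1)[of "min (a/2) (b/2)"]) (use ab in auto)
  have limq: "(\<lambda>N. \<integral>y. fejer2 (Suc N) y *\<^sub>R q y \<partial>lborel) \<longlonglongrightarrow> (\<Sum>\<^sub>\<infinity>r. q (real_pair r))"
    by (rule fejer2_sums_lattice[OF q_cont q_int D sumD])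
  let ?c = "of_real (a * b / (4 * pi\<^sup>2)) :: complex"
  have KF: "complex_of_real (?F m) = ?c * (\<integral>y. cis (2 * pi * (real_pair m \<bullet> y)) * q y \<partial>lborel)" for m
  proof -
    let ?l = "((fst \<theta> - 2 * pi * of_int (fst m)) / a, (snd \<theta> - 2 * pi * of_int (snd m)) / b)"
    have "(\<integral>x. k x * exp (- \<i> * of_real (x \<bullet> ?l)) \<partial>lborel)
      = (\<bar>a\<bar> * \<bar>b\<bar>) *\<^sub>R (\<integral>y. k (a * fst y, b * snd y) * exp (- \<i> * of_real ((a * fst y, b * snd y) \<bullet> ?l)) \<partial>lborel)"
      by (rule integral_diagonal_scaling) (use ab in auto)
    also have "(\<lambda>y. k (a * fst y, b * snd y) * exp (- \<i> * of_real ((a * fst y, b * snd y) \<bullet> ?l)))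
        = (\<lambda>y. cis (2 * pi * (real_pair m \<bullet> y)) * q y)"
    proof
      fix y
      have "(a * fst y, b * snd y) \<bullet> ?l = \<theta> \<bullet> y - 2 * pi * (real_pair m \<bullet> y)"
        using ab by (simp add: inner_prod_def real_pair_def field_simps)
      then have "exp (- \<i> * of_real ((a * fst y, b * snd y) \<bullet> ?l)) = cis (2 * pi * (real_pair m \<bullet> y)) * cis (- (\<theta> \<bullet> y))"
        by (simp only:) (simp add: cis_conv_exp exp_add[symmetric] algebra_simps)
      then show "k (a * fst y, b * snd y) * exp (- \<i> * of_real ((a * fst y, b * snd y) \<bullet> ?l))
          = cis (2 * pi * (real_pair m \<bullet> y)) * q y" by (simp add: q_def)
    qed
    finally show ?thesis
      unfolding K_eq_fourier fourier_def using ab by (simp add: scaleR_conv_of_real)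
  qed
  have int_cis: "integrable lborel (\<lambda>y. cis (2 * pi * (real_pair m \<bullet> y)) * q y)" for m
  proof (rule Bochner_Integration.integrable_bound[OF q_int])
    have [measurable]: "(\<lambda>y. cis (2 * pi * (real_pair m \<bullet> y))) \<in> borel_measurable borel"
      unfolding cis_conv_exp by (intro borel_measurable_continuous_onI continuous_intros)
    show "(\<lambda>y. cis (2 * pi * (real_pair m \<bullet> y)) * q y) \<in> borel_measurable lborel"
      by measurable
  qed (auto simp: norm_mult)
  have avg: "complex_of_real ((\<Sum>w\<in>difference_grid N. ?F (grid_diff w)) / (real N)\<^sup>2)
      = ?c * (\<integral>y. fejer2 N y *\<^sub>R q y \<partial>lborel)" for N
  proof -
    have "complex_of_real ((\<Sum>w\<in>difference_grid N. ?F (grid_diff w)) / (real N)\<^sup>2)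
        = ?c * ((\<Sum>w\<in>difference_grid N. \<integral>y. cis (2 * pi * (real_pair (grid_diff w) \<bullet> y)) * q y \<partial>lborel) / (real N)\<^sup>2)"
      by (simp only: of_real_divide of_real_sum KF sum_distrib_left[symmetric] of_real_power times_divide_eq_right of_real_of_nat_eq)
    also have "(\<Sum>w\<in>difference_grid N. \<integral>y. cis (2 * pi * (real_pair (grid_diff w) \<bullet> y)) * q y \<partial>lborel)
        = (\<integral>y. (\<Sum>w\<in>difference_grid N. cis (2 * pi * (real_pair (grid_diff w) \<bullet> y)) * q y) \<partial>lborel)"
      using int_cis by (simp add: Bochner_Integration.integral_sum)
    also have "\<dots> / (real N)\<^sup>2 = (\<integral>y. (\<Sum>w\<in>difference_grid N. cis (2 * pi * (real_pair (grid_diff w) \<bullet> y)) * q y) / (real N)\<^sup>2 \<partial>lborel)"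
      by simp
    also have "\<dots> = (\<integral>y. fejer2 N y *\<^sub>R q y \<partial>lborel)"
      by (simp only: scaleR_conv_of_real fejer2_cis sum_distrib_right[symmetric] times_divide_eq_left)
    finally show ?thesis .
  qed
  have limF: "(\<lambda>N. complex_of_real ((\<Sum>w\<in>difference_grid (Suc N). ?F (grid_diff w)) / (real (Suc N))\<^sup>2)) \<longlonglongrightarrow> ?L"
    unfolding avg using tendsto_mult_left[OF limq, of ?c] by (simp add: q_def real_pair_def)
  have "(\<lambda>N. Re (complex_of_real ((\<Sum>w\<in>difference_grid (Suc N). ?F (grid_diff w)) / (real (Suc N))\<^sup>2))) \<longlonglongrightarrow> Re ?L"
    by (rule tendsto_Re[OF limF])
  then have lim_re: "(\<lambda>N. (\<Sum>w\<in>difference_grid (Suc N). ?F (grid_diff w)) / (real (Suc N))\<^sup>2) \<longlonglongrightarrow> Re ?L"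
    by simp
  have "(\<lambda>N. complex_of_real ((\<Sum>w\<in>difference_grid (Suc N). ?F (grid_diff w)) / (real (Suc N))\<^sup>2)) \<longlonglongrightarrow> of_real (Re ?L)"
    by (intro tendsto_of_real lim_re)
  then have "of_real (Re ?L) = ?L" using limF LIMSEQ_unique by blast
  moreover have "(?F has_sum Re ?L) UNIV"
    by (rule has_sum_of_grid_averages[OF K_nonneg lim_re])
  ultimately show thesis by (intro that)
qed

end

section \<open>The periodogram and the discrete Fourier transform\<close>

lemma has_sum_finite_sum:
  fixes f :: "'i \<Rightarrow> 'a \<Rightarrow> 'b :: {topological_comm_monoid_add}"
  assumes "\<And>i. i \<in> I \<Longrightarrow> (f i has_sum s i) A"
  shows "((\<lambda>x. \<Sum>i\<in>I. f i x) has_sum (\<Sum>i\<in>I. s i)) A"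
  using assms by (induction I rule: infinite_finite_induct) (auto intro: has_sum_add)

definition grid_dvd :: "nat \<times> nat \<Rightarrow> int \<times> int \<Rightarrow> bool" where
  "grid_dvd d u \<longleftrightarrow> int (fst d) dvd fst u \<and> int (snd d) dvd snd u"

lemma sum_roots_of_unity:
  assumes "n > 0"
  shows "(\<Sum>j\<in>{1..int n}. cis (2 * pi * of_int j * of_int u / real n)) = (if int n dvd u then of_nat n else 0)"
proof -
  define z where "z = cis (2 * pi * of_int u / real n)"
  have power_term: "cis (2 * pi * of_int (int i + 1) * of_int u / real n) = z * z ^ i" for i
  proof -
    have "z * z ^ i = z ^ Suc i" by simp
    also have "\<dots> = cis (real (Suc i) * (2 * pi * of_int u / real n))"
      unfolding z_def by (rule Complex.DeMoivre)
    finally show ?thesis by (simp add: algebra_simps)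
  qed
  have "(\<Sum>j\<in>{1..int n}. cis (2 * pi * of_int j * of_int u / real n))
      = (\<Sum>i<n. cis (2 * pi * of_int (int i + 1) * of_int u / real n))"
    by (rule sum.reindex_bij_witness[of _ "\<lambda>i. int i + 1" "\<lambda>j. nat (j - 1)"]) auto
  also have "\<dots> = z * (\<Sum>i<n. z ^ i)"
    by (simp only: power_term sum_distrib_left)
  finally have S: "(\<Sum>j\<in>{1..int n}. cis (2 * pi * of_int j * of_int u / real n)) = z * (\<Sum>i<n. z ^ i)" .
  show ?thesis
  proof (cases "int n dvd u")
    case True
    then obtain c where "u = int n * c" by auto
    then have "2 * pi * of_int u / real n = 2 * pi * of_int c" using assms by simp
    then have "z = 1"
      unfolding z_def by (simp only: complex_eq_iff cis.sel cos_int_2pin sin_int_2pin) simp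
    then show ?thesis using S True by simp
  next
    case False
    have "z \<noteq> 1"
    proof
      assume "z = 1"
      then obtain c :: int where "2 * pi * of_int u / real n = of_int (2 * c) * pi"
        by (auto simp: z_def cis_conv_exp exp_eq_1)
      then have "2 * pi * of_int u = 2 * pi * of_int (c * int n)"
        using assms by (simp add: field_simps)
      then have "u = c * int n"
        by (simp only: mult_cancel_left of_int_eq_iff) simp
      then show False using False by simp
    qed
    moreover have "z ^ n = 1"
    proof -
      have "z ^ n = cis (real n * (2 * pi * of_int u / real n))"
        unfolding z_def by (rule Complex.DeMoivre)
      also have "real n * (2 * pi * of_int u / real n) = 2 * pi * of_int u" using assms by simp
      also have "cis (2 * pi * of_int u) = 1"
        by (simp only: complex_eq_iff cis.sel cos_int_2pin sin_int_2pin) simp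
      finally show ?thesis .
    qed
    ultimately have "(\<Sum>i<n. z ^ i) = 0" by (simp add: geometric_sum)
    then show ?thesis using S False by simp
  qed
qed

lemma fourier_freq_symmetric:
  "fourier_freq d j \<bullet> real_pair t = fourier_freq d t \<bullet> real_pair j"
  by (simp add: fourier_freq_def real_pair_def inner_prod_def mult_ac)

lemma sum_cis_fourier_freq:
  assumes "fst d > 0" "snd d > 0"
  shows "(\<Sum>j\<in>obs_region d. cis (fourier_freq d j \<bullet> real_pair u))
    = (if grid_dvd d u then of_real (obs_size d) else 0)"
proof -
  have "(\<Sum>j\<in>obs_region d. cis (fourier_freq d j \<bullet> real_pair u))
      = (\<Sum>j\<in>{1..int (fst d)}. \<Sum>l\<in>{1..int (snd d)}.
          cis (2 * pi * of_int j * of_int (fst u) / real (fst d)) * cis (2 * pi * of_int l * of_int (snd u) / real (snd d)))"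
    unfolding obs_region_def sum.cartesian_product
    by (intro sum.cong refl) (auto simp: cis_mult fourier_freq_def real_pair_def inner_prod_def)
  also have "\<dots> = (\<Sum>j\<in>{1..int (fst d)}. cis (2 * pi * of_int j * of_int (fst u) / real (fst d)))
      * (\<Sum>l\<in>{1..int (snd d)}. cis (2 * pi * of_int l * of_int (snd u) / real (snd d)))"
    by (simp add: sum_product)
  also have "\<dots> = (if grid_dvd d u then of_real (obs_size d) else 0)"
    unfolding sum_roots_of_unity[OF assms(1)] sum_roots_of_unity[OF assms(2)]
    by (auto simp: grid_dvd_def obs_size_def)
  finally show ?thesis .
qed

definition dft :: "nat \<times> nat \<Rightarrow> (int \<times> int \<Rightarrow> real) \<Rightarrow> int \<times> int \<Rightarrow> complex" where
  "dft d X j = (\<Sum>t\<in>obs_region d. of_real (X t) * cis (- (fourier_freq d j \<bullet> real_pair t)))"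

lemma grid_dvd_uminus: "grid_dvd d (- u) = grid_dvd d u"
  by (simp add: grid_dvd_def)

text \<open>Away from the zeroed frequencies the exponentials sum to \<open>0\<close> over the observation region, so any
constant may be subtracted from the data.\<close>

lemma periodogram_eq_dft:
  assumes d: "fst d > 0" "snd d > 0"
  shows "periodogram d v j = (if grid_dvd d j then 0 else (cmod (dft d (\<lambda>t. v t - \<mu>) j))\<^sup>2 / obs_size d)"
proof (cases "grid_dvd d j")
  case True
  then have "j \<in> {(c1 * int (fst d), c2 * int (snd d)) | c1 c2. True}"
    by (cases j) (auto simp: grid_dvd_def dvd_def mult.commute)
  then show ?thesis using True by (simp add: periodogram_def)
next
  case False
  then have "j \<notin> {(c1 * int (fst d), c2 * int (snd d)) | c1 c2. True}"
    by (auto simp: grid_dvd_def)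
  then have "periodogram d v j = (fourier_cos d v j)\<^sup>2 + (fourier_sin d v j)\<^sup>2"
    by (simp add: periodogram_def)
  also have "\<dots> = (cmod (dft d v j))\<^sup>2 / obs_size d"
  proof -
    have "fourier_cos d v j = Re (dft d v j) / sqrt (obs_size d)"
      "fourier_sin d v j = Im (dft d v j) / sqrt (obs_size d)"
      by (simp_all add: fourier_cos_def fourier_sin_def dft_def)
    moreover have "0 \<le> obs_size d" by (simp add: obs_size_def)
    ultimately show ?thesis
      by (simp add: power_divide cmod_power2 add_divide_distrib)
  qed
  also have "dft d v j = dft d (\<lambda>t. v t - \<mu>) j"
  proof -
    have "(\<Sum>t\<in>obs_region d. cis (- (fourier_freq d j \<bullet> real_pair t)))
        = (\<Sum>t\<in>obs_region d. cis (fourier_freq d t \<bullet> real_pair (- j)))"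
      by (intro sum.cong refl)
        (simp add: fourier_freq_symmetric[of d j], simp add: real_pair_def inner_prod_def)
    also have "\<dots> = 0" using False by (simp add: sum_cis_fourier_freq[OF d] grid_dvd_uminus)
    finally have "(\<Sum>t\<in>obs_region d. of_real \<mu> * cis (- (fourier_freq d j \<bullet> real_pair t))) = 0"
      by (simp add: sum_distrib_left[symmetric])
    then show ?thesis by (simp add: dft_def left_diff_distrib sum_subtractf)
  qed
  finally show ?thesis using False by simp
qed

lemma cmod_dft_squared:
  "complex_of_real ((cmod (dft d X j))\<^sup>2)
    = (\<Sum>s\<in>obs_region d. \<Sum>t\<in>obs_region d. of_real (X s * X t) * cis (fourier_freq d j \<bullet> real_pair (t - s)))"
proof -
  have "complex_of_real ((cmod (dft d X j))\<^sup>2) = dft d X j * cnj (dft d X j)"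
    by (rule complex_norm_square)
  also have "\<dots> = (\<Sum>s\<in>obs_region d. \<Sum>t\<in>obs_region d.
      (of_real (X s) * cis (- (fourier_freq d j \<bullet> real_pair s))) * (of_real (X t) * cis (fourier_freq d j \<bullet> real_pair t)))"
    by (simp add: dft_def sum_product cis_cnj)
  also have "\<dots> = (\<Sum>s\<in>obs_region d. \<Sum>t\<in>obs_region d. of_real (X s * X t) * cis (fourier_freq d j \<bullet> real_pair (t - s)))"
  proof (intro sum.cong refl)
    fix s t
    have "fourier_freq d j \<bullet> real_pair (t - s) = - (fourier_freq d j \<bullet> real_pair s) + fourier_freq d j \<bullet> real_pair t"
      by (simp add: real_pair_def inner_prod_def algebra_simps)
    then show "(of_real (X s) * cis (- (fourier_freq d j \<bullet> real_pair s))) * (of_real (X t) * cis (fourier_freq d j \<bullet> real_pair t))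
        = of_real (X s * X t) * cis (fourier_freq d j \<bullet> real_pair (t - s))"
      by (simp only: cis_mult[symmetric] of_real_mult) (simp only: mult_ac)
  qed
  finally show ?thesis .
qed

text \<open>The inverse transform of the periodogram is the circular autocovariance: a pair of sites contributes
whenever its lag is congruent to \<open>r\<close> modulo the side lengths.\<close>

lemma sum_cmod_dft_cis:
  assumes d: "fst d > 0" "snd d > 0"
  shows "(\<Sum>j\<in>obs_region d. complex_of_real ((cmod (dft d X j))\<^sup>2 / obs_size d) * cis (fourier_freq d j \<bullet> real_pair r))
    = (\<Sum>s\<in>obs_region d. \<Sum>t\<in>obs_region d. of_real (X s * X t) * (if grid_dvd d (r - (s - t)) then 1 else 0))"
proof -
  have N: "obs_size d > 0" using d by (simp add: obs_size_def)
  have "(\<Sum>j\<in>obs_region d. complex_of_real ((cmod (dft d X j))\<^sup>2 / obs_size d) * cis (fourier_freq d j \<bullet> real_pair r))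
      = (\<Sum>j\<in>obs_region d. \<Sum>s\<in>obs_region d. \<Sum>t\<in>obs_region d.
          of_real (X s * X t / obs_size d) * cis (fourier_freq d j \<bullet> real_pair (r - (s - t))))"
  proof (rule sum.cong[OF refl])
    fix j
    have "cis (fourier_freq d j \<bullet> real_pair (t - s)) * cis (fourier_freq d j \<bullet> real_pair r)
        = cis (fourier_freq d j \<bullet> real_pair (r - (s - t)))" for s t
      by (simp add: cis_mult real_pair_def inner_prod_def algebra_simps)
    then show "complex_of_real ((cmod (dft d X j))\<^sup>2 / obs_size d) * cis (fourier_freq d j \<bullet> real_pair r)
      = (\<Sum>s\<in>obs_region d. \<Sum>t\<in>obs_region d.
          of_real (X s * X t / obs_size d) * cis (fourier_freq d j \<bullet> real_pair (r - (s - t))))"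
      unfolding of_real_divide cmod_dft_squared sum_divide_distrib sum_distrib_right
      by (intro sum.cong refl) (simp add: mult.assoc)
  qed
  also have "\<dots> = (\<Sum>s\<in>obs_region d. \<Sum>j\<in>obs_region d. \<Sum>t\<in>obs_region d.
          of_real (X s * X t / obs_size d) * cis (fourier_freq d j \<bullet> real_pair (r - (s - t))))"
    by (rule sum.swap)
  also have "\<dots> = (\<Sum>s\<in>obs_region d. \<Sum>t\<in>obs_region d. \<Sum>j\<in>obs_region d.
          of_real (X s * X t / obs_size d) * cis (fourier_freq d j \<bullet> real_pair (r - (s - t))))"
    by (rule sum.cong[OF refl], rule sum.swap)
  also have "\<dots> = (\<Sum>s\<in>obs_region d. \<Sum>t\<in>obs_region d. of_real (X s * X t) * (if grid_dvd d (r - (s - t)) then 1 else 0))"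
    unfolding sum_distrib_left[symmetric] sum_cis_fourier_freq[OF d]
    using N by (intro sum.cong refl) auto
  finally show ?thesis .
qed

definition lags :: "nat \<times> nat \<Rightarrow> (int \<times> int) set" where
  "lags d = (\<lambda>(s, t). s - t) ` (obs_region d \<times> obs_region d)"

lemma finite_obs_region [simp]: "finite (obs_region d)"
  by (simp add: obs_region_def)

lemma finite_lags [simp]: "finite (lags d)"
  by (simp add: lags_def)

lemma double_sum_by_lag:
  assumes N: "obs_size d > 0"
  shows "(\<Sum>s\<in>obs_region d. \<Sum>t\<in>obs_region d. of_real ((v s - \<mu>) * (v t - \<mu>)) * A (s - t))
    = of_real (obs_size d) * (\<Sum>u\<in>lags d. of_real (sample_autocov \<mu> d v u) * (A u :: complex))"
proof -
  let ?T = "obs_region d" and ?f = "\<lambda>(s, t). of_real ((v s - \<mu>) * (v t - \<mu>)) * A (s - t)"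
  have "(\<Sum>s\<in>?T. \<Sum>t\<in>?T. of_real ((v s - \<mu>) * (v t - \<mu>)) * A (s - t)) = sum ?f (?T \<times> ?T)"
    by (simp add: sum.cartesian_product)
  also have "\<dots> = (\<Sum>u\<in>lags d. sum ?f {p \<in> ?T \<times> ?T. (\<lambda>(s, t). s - t) p = u})"
    unfolding lags_def by (intro sum.group[symmetric]) auto
  also have "\<dots> = (\<Sum>u\<in>lags d. of_real (obs_size d) * (of_real (sample_autocov \<mu> d v u) * A u))"
  proof (rule sum.cong[OF refl])
    fix u
    have "sum ?f {p \<in> ?T \<times> ?T. (\<lambda>(s, t). s - t) p = u}
        = (\<Sum>j | j \<in> ?T \<and> j + u \<in> ?T. of_real ((v j - \<mu>) * (v (j + u) - \<mu>)) * A u)"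
      by (rule sum.reindex_bij_witness[of _ "\<lambda>j. (j + u, j)" snd]) (auto simp: mult.commute)
    also have "\<dots> = of_real (obs_size d) * (of_real (sample_autocov \<mu> d v u) * A u)"
      using N by (simp add: sample_autocov_def sum_distrib_right[symmetric])
    finally show "sum ?f {p \<in> ?T \<times> ?T. (\<lambda>(s, t). s - t) p = u}
        = of_real (obs_size d) * (of_real (sample_autocov \<mu> d v u) * A u)" .
  qed
  finally show ?thesis by (simp add: sum_distrib_left)
qed

text \<open>The observation region starts at \<open>1\<close>, so its coordinates are the residues \<open>1, \<dots>, n\<close> rather than
\<open>0, \<dots>, n - 1\<close>.\<close>

lemma grid_decomposition:
  assumes d: "fst d > 0" "snd d > 0"
  shows "bij_betw (\<lambda>(j, m). (fst j + fst m * int (fst d), snd j + snd m * int (snd d))) (obs_region d \<times> UNIV) UNIV"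
proof (rule bij_betwI')
  have quot: "(j + m * int n - 1) div int n = m" if "1 \<le> j" "j \<le> int n" for j m :: int and n
  proof -
    have "(j + m * int n - 1) div int n = (j - 1 + m * int n) div int n"
      by (simp add: algebra_simps)
    also have "\<dots> = m + (j - 1) div int n"
      using that by (intro div_mult_self1) auto
    also have "(j - 1) div int n = 0"
      using that by (intro div_pos_pos_trivial) auto
    finally show ?thesis by simp
  qed
  have one: "j = j' \<and> m = m'"
    if "j + m * int n = j' + m' * int n" "1 \<le> j" "j \<le> int n" "1 \<le> j'" "j' \<le> int n" for j j' m m' :: int and n
    using quot[OF that(2,3), of m] quot[OF that(4,5), of m'] that(1) by simp
  fix x y :: "(int \<times> int) \<times> int \<times> int" assume "x \<in> obs_region d \<times> UNIV" "y \<in> obs_region d \<times> UNIV"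
  moreover obtain j1 j2 m1 m2 where x: "x = ((j1, j2), (m1, m2))" by (metis surj_pair)
  moreover obtain l1 l2 n1 n2 where y: "y = ((l1, l2), (n1, n2))" by (metis surj_pair)
  ultimately have "1 \<le> j1" "j1 \<le> int (fst d)" "1 \<le> j2" "j2 \<le> int (snd d)"
    "1 \<le> l1" "l1 \<le> int (fst d)" "1 \<le> l2" "l2 \<le> int (snd d)"
    by (auto simp: obs_region_def)
  then show "((\<lambda>(j, m). (fst j + fst m * int (fst d), snd j + snd m * int (snd d))) x
      = (\<lambda>(j, m). (fst j + fst m * int (fst d), snd j + snd m * int (snd d))) y) = (x = y)"
    using one[of j1 m1 "fst d" l1 n1] one[of j2 m2 "snd d" l2 n2] unfolding x y by auto
next
  fix y :: "int \<times> int"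
  have "\<exists>j m. 1 \<le> j \<and> j \<le> int n \<and> z = j + m * int n" if "n > 0" for n and z :: int
  proof (intro exI conjI)
    show "1 \<le> (z - 1) mod int n + 1" "(z - 1) mod int n + 1 \<le> int n" using that by (auto simp: add1_zle_eq)
    show "z = (z - 1) mod int n + 1 + ((z - 1) div int n) * int n"
      using mult_div_mod_eq[of "int n" "z - 1"] by (simp add: algebra_simps)
  qed
  from this[OF d(1), of "fst y"] this[OF d(2), of "snd y"]
  show "\<exists>x\<in>obs_region d \<times> UNIV. y = (\<lambda>(j, m). (fst j + fst m * int (fst d), snd j + snd m * int (snd d))) x"
    by (cases y) (force simp: obs_region_def)
qed simp

section \<open>Aliasing and the smoothed periodogram\<close>

lemma cis_fourier_freq_grid:
  assumes d: "fst d > 0" "snd d > 0" and "grid_dvd d j"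
  shows "cis (fourier_freq d j \<bullet> real_pair t) = 1"
proof -
  obtain c1 c2 where c: "fst j = int (fst d) * c1" "snd j = int (snd d) * c2"
    using assms by (auto simp: grid_dvd_def dvd_def)
  have "fourier_freq d j \<bullet> real_pair t = 2 * pi * of_int (c1 * fst t + c2 * snd t)"
    using d by (simp add: fourier_freq_def real_pair_def inner_prod_def c algebra_simps)
  then show ?thesis
    by (simp only: complex_eq_iff cis.sel cos_int_2pin sin_int_2pin) simp
qed

lemma fourier_freq_add: "fourier_freq d (i + j) = fourier_freq d i + fourier_freq d j"
  by (simp add: fourier_freq_def algebra_simps add_divide_distrib)

lemma dft_grid_periodic:
  assumes d: "fst d > 0" "snd d > 0" and "grid_dvd d i"
  shows "dft d X (j + i) = dft d X j"
proof -
  have "cis (- (fourier_freq d (j + i) \<bullet> real_pair t)) = cis (- (fourier_freq d j \<bullet> real_pair t))" for t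
  proof -
    have "cis (- (fourier_freq d (j + i) \<bullet> real_pair t))
        = cis (- (fourier_freq d j \<bullet> real_pair t)) * cnj (cis (fourier_freq d i \<bullet> real_pair t))"
      by (simp add: fourier_freq_add inner_add_left cis_cnj cis_mult)
    then show ?thesis by (simp add: cis_fourier_freq_grid[OF assms])
  qed
  then show ?thesis by (simp add: dft_def)
qed

lemma grid_dvd_add_cancel: "grid_dvd d i \<Longrightarrow> grid_dvd d (j + i) = grid_dvd d j"
  by (auto simp: grid_dvd_def dvd_add_left_iff)

lemma periodogram_grid_periodic:
  assumes d: "fst d > 0" "snd d > 0" and i: "grid_dvd d i"
  shows "periodogram d v (j + i) = periodogram d v j"
  unfolding periodogram_eq_dft[OF d, of v _ 0] grid_dvd_add_cancel[OF i] dft_grid_periodic[OF assms] ..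

lemma grid_zeros_in_region:
  assumes d: "fst d > 0" "snd d > 0"
  shows "{j \<in> obs_region d. grid_dvd d j} = {(int (fst d), int (snd d))}"
proof -
  have "x = int n" if "int n dvd x" "1 \<le> x" "x \<le> int n" for x n
    using zdvd_imp_le[OF that(1)] that by linarith
  then show ?thesis
    using d by (auto simp: obs_region_def grid_dvd_def)
qed

lemma fourier_freq_grid_shift:
  assumes d: "fst d > 0" "snd d > 0"
  shows "fst (fourier_freq d (j1 + m1 * int (fst d), j2 + m2 * int (snd d)))
      = fst (fourier_freq d (j1, j2)) + 2 * pi * of_int m1"
    and "snd (fourier_freq d (j1 + m1 * int (fst d), j2 + m2 * int (snd d)))
      = snd (fourier_freq d (j1, j2)) + 2 * pi * of_int m2"
  using d by (simp_all add: fourier_freq_def field_simps)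

text \<open>The lags that the discrete Fourier transform cannot distinguish from \<open>u\<close>.\<close>

definition coset :: "nat \<times> nat \<Rightarrow> int \<times> int \<Rightarrow> (int \<times> int) set" where
  "coset d u = {r. grid_dvd d (r - u)}"

lemma coset_bij:
  assumes d: "fst d > 0" "snd d > 0"
  shows "bij_betw (\<lambda>m. (fst u + int (fst d) * fst m, snd u + int (snd d) * snd m)) UNIV (coset d u)"
  unfolding bij_betw_def
proof
  show "inj (\<lambda>m. (fst u + int (fst d) * fst m, snd u + int (snd d) * snd m))"
    using d by (auto simp: inj_on_def)
  show "range (\<lambda>m. (fst u + int (fst d) * fst m, snd u + int (snd d) * snd m)) = coset d u"
  proof (intro equalityI subsetI)
    fix r assume "r \<in> coset d u"
    then obtain c1 c2 where "fst r - fst u = int (fst d) * c1" "snd r - snd u = int (snd d) * c2"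
      by (auto simp: coset_def grid_dvd_def dvd_def)
    then have "r = (fst u + int (fst d) * fst (c1, c2), snd u + int (snd d) * snd (c1, c2))"
      by (cases r) auto
    then show "r \<in> range (\<lambda>m. (fst u + int (fst d) * fst m, snd u + int (snd d) * snd m))"
      by (rule range_eqI)
  qed (auto simp: coset_def grid_dvd_def)
qed

lemma lag_lt:
  assumes "u \<in> lags d"
  shows "\<bar>fst u\<bar> < int (fst d)" "\<bar>snd u\<bar> < int (snd d)"
  using assms by (auto simp: lags_def obs_region_def)

text \<open>In each coordinate a residue class has at most one nonnegative and one negative representative of
absolute value below the side length.\<close>

lemma card_lags_congruent:
  assumes d: "fst d > 0" "snd d > 0"
  shows "card {u \<in> lags d. r \<in> coset d u} \<le> 4"
proof -
  have res: "x \<in> {z mod int n, z mod int n - int n}" if "\<bar>x\<bar> < int n" "int n dvd z - x" for x z n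
  proof -
    have m: "x mod int n = z mod int n" using that(2) by (metis mod_eq_dvd_iff)
    show ?thesis
    proof (cases "x \<ge> 0")
      case True then show ?thesis using that(1) m by auto
    next
      case False
      have "(x + int n) mod int n = x + int n" using that(1) False by (intro mod_pos_pos_trivial) auto
      then show ?thesis using m by auto
    qed
  qed
  let ?R = "\<lambda>z n. {z mod int n, z mod int n - int n}"
  have "{u \<in> lags d. r \<in> coset d u} \<subseteq> ?R (fst r) (fst d) \<times> ?R (snd r) (snd d)"
  proof
    fix u assume "u \<in> {u \<in> lags d. r \<in> coset d u}"
    then have "u \<in> lags d" "int (fst d) dvd fst r - fst u" "int (snd d) dvd snd r - snd u"
      by (auto simp: coset_def grid_dvd_def)
    from res[OF lag_lt(1)[OF this(1)] this(2)] res[OF lag_lt(2)[OF this(1)] this(3)]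
    show "u \<in> ?R (fst r) (fst d) \<times> ?R (snd r) (snd d)" unfolding mem_Times_iff by blast
  qed
  then have "card {u \<in> lags d. r \<in> coset d u} \<le> card (?R (fst r) (fst d) \<times> ?R (snd r) (snd d))"
    by (intro card_mono) auto
  also have "\<dots> \<le> 2 * 2"
    unfolding card_cartesian_product by (intro mult_le_mono) (auto simp: card_insert_if)
  finally show ?thesis by simp
qed

context radial_majorant
begin

definition lattice_value :: "real \<Rightarrow> real \<Rightarrow> int \<times> int \<Rightarrow> real" where
  "lattice_value a b r = g (a * of_int (fst r), b * of_int (snd r))"

text \<open>\<open>coset_mass\<close> bounds the weight that the estimator gives to the lag \<open>u\<close>, and \<open>coset_tail\<close> the part of it
that is due to the aliases of \<open>u\<close> other than \<open>u\<close> itself.\<close>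

definition coset_mass :: "real \<Rightarrow> real \<Rightarrow> nat \<times> nat \<Rightarrow> int \<times> int \<Rightarrow> real" where
  "coset_mass a b d u = infsum (lattice_value a b) (coset d u)"

definition coset_tail :: "real \<Rightarrow> real \<Rightarrow> nat \<times> nat \<Rightarrow> int \<times> int \<Rightarrow> real" where
  "coset_tail a b d u = infsum (lattice_value a b) (coset d u - {u})"

lemma lattice_value_nonneg: "0 \<le> lattice_value a b r"
  by (simp add: lattice_value_def nonneg)

lemma lattice_value_summable:
  assumes "a > 0" "b > 0"
  shows "lattice_value a b summable_on B"
  using lattice_sum(1)[of "min a b" a b 0 0 B] assms by (simp add: lattice_value_def[abs_def])

lemma lattice_value_infsum:
  assumes "\<tau> > 0" "\<tau> \<le> a" "\<tau> \<le> b"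
  shows "infsum (lattice_value a b) B \<le> 4 * g 0 + 4 * mass / \<tau>\<^sup>2"
  using lattice_sum(2)[of \<tau> a b 0 0 B] assms by (simp add: lattice_value_def[abs_def])

lemma coset_sum_reindex:
  assumes d: "fst d > 0" "snd d > 0"
  shows "infsum (lattice_value a b) ((\<lambda>m. (fst u + int (fst d) * fst m, snd u + int (snd d) * snd m)) ` I)
    = (\<Sum>\<^sub>\<infinity>m\<in>I. g (a * of_int (fst u) + (a * real (fst d)) * of_int (fst m),
                  b * of_int (snd u) + (b * real (snd d)) * of_int (snd m)))"
proof -
  let ?f = "\<lambda>m. (fst u + int (fst d) * fst m, snd u + int (snd d) * snd m)"
  have "inj_on ?f I" using coset_bij[OF d, of u] by (auto simp: bij_betw_def intro: inj_on_subset)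
  then have "infsum (lattice_value a b) (?f ` I) = infsum (lattice_value a b \<circ> ?f) I"
    by (rule infsum_reindex)
  then show ?thesis by (simp add: lattice_value_def o_def algebra_simps)
qed

lemma coset_mass_le:
  assumes d: "fst d > 0" "snd d > 0" and \<tau>: "\<tau> > 0" "\<tau> \<le> a * real (fst d)" "\<tau> \<le> b * real (snd d)"
  shows "coset_mass a b d u \<le> 4 * g 0 + 4 * mass / \<tau>\<^sup>2"
  using coset_sum_reindex[OF d, of a b u UNIV] coset_bij[OF d, of u]
    lattice_sum(2)[OF \<tau>, of "a * of_int (fst u)" "b * of_int (snd u)" UNIV]
  by (simp add: coset_mass_def bij_betw_def)

lemma coset_tail_nonneg: "0 \<le> coset_tail a b d u"
  unfolding coset_tail_def by (intro infsum_nonneg lattice_value_nonneg)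

lemma coset_mass_nonneg: "0 \<le> coset_mass a b d u"
  unfolding coset_mass_def by (intro infsum_nonneg lattice_value_nonneg)

lemma coset_tail_le_mass:
  assumes "a > 0" "b > 0"
  shows "coset_tail a b d u \<le> coset_mass a b d u"
  unfolding coset_tail_def coset_mass_def
  by (intro infsum_mono2 lattice_value_summable assms lattice_value_nonneg) auto

text \<open>For a lag at most half as long as the region, each alias other than \<open>u\<close> has a scaled coordinate of
absolute value at least \<open>\<tau>\<close>, so that no near points have to be counted.\<close>

lemma coset_tail_le:
  assumes d: "fst d > 0" "snd d > 0" and ab: "a > 0" "b > 0"
    and \<tau>: "\<tau> > 0" "2 * \<tau> \<le> a * real (fst d)" "2 * \<tau> \<le> b * real (snd d)"
    and u: "2 * \<bar>fst u\<bar> \<le> int (fst d)" "2 * \<bar>snd u\<bar> \<le> int (snd d)"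
  shows "coset_tail a b d u \<le> 4 * mass / \<tau>\<^sup>2"
proof -
  let ?f = "\<lambda>m. (fst u + int (fst d) * fst m, snd u + int (snd d) * snd m)"
  have f0: "?f 0 = u" by simp
  have "coset d u - {u} = ?f ` (UNIV - {0})"
    using coset_bij[OF d, of u] f0 by (subst inj_on_image_set_diff[where C = UNIV]) (auto simp: bij_betw_def)
  moreover have "(\<Sum>\<^sub>\<infinity>m\<in>UNIV - {0}. g (a * of_int (fst u) + (a * real (fst d)) * of_int (fst m),
                  b * of_int (snd u) + (b * real (snd d)) * of_int (snd m))) \<le> 4 * mass / \<tau>\<^sup>2"
  proof (rule lattice_far_sum(2)[OF \<tau>(1)])
    show "\<tau> \<le> a * real (fst d)" "\<tau> \<le> b * real (snd d)" using \<tau> by auto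
    fix m :: "int \<times> int" assume m: "m \<in> UNIV - {0}"
    have far: "\<tau> \<le> \<bar>c * of_int x + (c * real n) * of_int z\<bar>"
      if "c > 0" "2 * \<tau> \<le> c * real n" "2 * \<bar>x\<bar> \<le> int n" "z \<noteq> 0" for c x z n
    proof -
      have "int n \<le> int n * \<bar>z\<bar>" using that(4) by (simp add: mult_le_cancel_left1) linarith
      then have q: "int n \<le> \<bar>int n * z\<bar>" by (simp add: abs_mult)
      have lin: "N \<le> 2 * Y" if "A - X \<le> Y" "N \<le> A" "2 * X \<le> N" for A X Y N :: int
        using that by linarith
      have "\<bar>int n * z\<bar> - \<bar>x\<bar> \<le> \<bar>x + int n * z\<bar>"
        using abs_triangle_ineq2[of "int n * z" "- x"] by (simp add: add.commute)
      from lin[OF this q that(3)] have "real_of_int (int n) \<le> of_int (2 * \<bar>x + int n * z\<bar>)"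
        by (simp only: of_int_le_iff)
      then have "real n \<le> 2 * \<bar>of_int (x + int n * z)\<bar>" by simp
      then have "c * real n \<le> c * (2 * \<bar>of_int (x + int n * z)\<bar>)" using that(1) by (intro mult_left_mono) auto
      also have "\<dots> = 2 * \<bar>c * of_int x + (c * real n) * of_int z\<bar>"
        using that(1) by (simp add: abs_mult[of c, symmetric, unfolded abs_of_pos[OF that(1)]] algebra_simps)
      finally have "2 * \<tau> \<le> 2 * \<bar>c * of_int x + (c * real n) * of_int z\<bar>"
        using that(2) by (rule order_trans[rotated])
      then show ?thesis by simp
    qed
    have "fst m \<noteq> 0 \<or> snd m \<noteq> 0" using m by (auto simp: prod_eq_iff)
    then show "\<tau> \<le> max_norm (a * of_int (fst u) + (a * real (fst d)) * of_int (fst m),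
                  b * of_int (snd u) + (b * real (snd d)) * of_int (snd m))"
      using far[OF ab(1) \<tau>(2) u(1), of "fst m"] far[OF ab(2) \<tau>(3) u(2), of "snd m"]
      by (auto simp: max_norm_def le_max_iff_disj)
  qed
  ultimately show ?thesis
    unfolding coset_tail_def by (simp only: coset_sum_reindex[OF d])
qed

text \<open>Each point of the lattice belongs to the cosets of at most four lags, so the sum over the lags is at
most four times a single lattice sum.\<close>

lemma sum_coset_mass_le:
  assumes d: "fst d > 0" "snd d > 0" and \<tau>: "\<tau> > 0" "\<tau> \<le> a" "\<tau> \<le> b"
  shows "(\<Sum>u\<in>lags d. coset_mass a b d u) \<le> 4 * (4 * g 0 + 4 * mass / \<tau>\<^sup>2)"
proof -
  have ab: "a > 0" "b > 0" using \<tau> by auto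
  have "((\<lambda>r. if r \<in> coset d u then lattice_value a b r else 0) has_sum coset_mass a b d u) UNIV" for u
  proof -
    have "(lattice_value a b has_sum coset_mass a b d u) (coset d u)"
      unfolding coset_mass_def by (intro has_sum_infsum lattice_value_summable ab)
    then show ?thesis by (rule has_sum_cong_neutral[THEN iffD1, rotated -1]) auto
  qed
  then have S: "((\<lambda>r. \<Sum>u\<in>lags d. if r \<in> coset d u then lattice_value a b r else 0)
      has_sum (\<Sum>u\<in>lags d. coset_mass a b d u)) UNIV"
    by (intro has_sum_finite_sum)
  have "(\<Sum>u\<in>lags d. coset_mass a b d u) \<le> (\<Sum>\<^sub>\<infinity>r. 4 * lattice_value a b r)"
  proof (rule has_sum_mono[OF S has_sum_infsum])
    show "(\<lambda>r. 4 * lattice_value a b r) summable_on UNIV"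
      by (intro summable_on_cmult_right lattice_value_summable ab)
    fix r
    have "(\<Sum>u\<in>lags d. if r \<in> coset d u then lattice_value a b r else 0)
        = real (card {u \<in> lags d. r \<in> coset d u}) * lattice_value a b r"
      by (simp add: sum.If_cases Int_def)
    also have "\<dots> \<le> 4 * lattice_value a b r"
      using card_lags_congruent[OF d, of r] by (intro mult_right_mono lattice_value_nonneg) simp
    finally show "(\<Sum>u\<in>lags d. if r \<in> coset d u then lattice_value a b r else 0) \<le> 4 * lattice_value a b r" .
  qed
  also have "\<dots> = 4 * infsum (lattice_value a b) UNIV"
    by (rule infsum_cmult_right) (intro lattice_value_summable ab)
  also have "\<dots> \<le> 4 * (4 * g 0 + 4 * mass / \<tau>\<^sup>2)"
    using lattice_value_infsum[OF \<tau>, of UNIV] by simp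
  finally show ?thesis .
qed

end

context dominated_kernel
begin

definition lag_coeff :: "real \<Rightarrow> real \<Rightarrow> real \<times> real \<Rightarrow> int \<times> int \<Rightarrow> complex" where
  "lag_coeff a b l r = k (a * of_int (fst r), b * of_int (snd r)) * cis (- (l \<bullet> real_pair r))"

definition aliased_coeff :: "real \<Rightarrow> real \<Rightarrow> nat \<times> nat \<Rightarrow> real \<times> real \<Rightarrow> int \<times> int \<Rightarrow> complex" where
  "aliased_coeff a b d l u = infsum (lag_coeff a b l) (coset d u)"

lemma lag_coeff_le: "cmod (lag_coeff a b l r) \<le> lattice_value a b r"
  by (simp add: lag_coeff_def lattice_value_def norm_mult k_dominated)

lemma lag_coeff_summable:
  assumes "a > 0" "b > 0"
  shows "lag_coeff a b l summable_on B"
  by (rule abs_summable_summable, rule summable_on_comparison_test[OF lattice_value_summable[OF assms]])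
    (auto intro: lag_coeff_le)

lemma infsum_lag_coeff_le:
  assumes "a > 0" "b > 0"
  shows "cmod (infsum (lag_coeff a b l) B) \<le> infsum (lattice_value a b) B"
  by (rule norm_infsum_le[OF has_sum_infsum has_sum_infsum])
    (auto intro: lag_coeff_le lag_coeff_summable lattice_value_summable assms)

text \<open>Poisson summation handles the frequencies congruent modulo \<open>2\<pi>\<close>; the remaining sum over the
observation region is an inverse discrete transform, by which the coefficients of the series are
collected into cosets. The subtracted term restores the value \<open>0\<close> of the periodogram at the
frequencies divisible by the side lengths, where the transform of the centred data is their sum.\<close>

lemma smoothed_periodogram:
  assumes ab: "a > 0" "b > 0" and d: "fst d > 0" "snd d > 0"
  shows "complex_of_real (\<Sum>\<^sub>\<infinity>j. K ((fst l - fst (fourier_freq d j)) / a, (snd l - snd (fourier_freq d j)) / b) * periodogram d v j)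
    = of_real (a * b / (4 * pi\<^sup>2)) *
      (of_real (obs_size d) * (\<Sum>u\<in>lags d. of_real (sample_autocov \<mu> d v u) * aliased_coeff a b d l u)
        - infsum (lag_coeff a b l) UNIV * of_real ((cmod (dft d (\<lambda>t. v t - \<mu>) 0))\<^sup>2 / obs_size d))"
proof -
  let ?T = "obs_region d" and ?X = "\<lambda>t. v t - \<mu>" and ?\<kappa> = "lag_coeff a b l"
  let ?f = "\<lambda>j. K ((fst l - fst (fourier_freq d j)) / a, (snd l - snd (fourier_freq d j)) / b) * periodogram d v j"
  let ?c = "of_real (a * b / (4 * pi\<^sup>2)) :: complex"
  define J where "J = (\<lambda>j. (cmod (dft d ?X j))\<^sup>2 / obs_size d)"
  let ?F = "\<lambda>j m. K ((fst (l - fourier_freq d j) - 2 * pi * of_int (fst m)) / a, (snd (l - fourier_freq d j) - 2 * pi * of_int (snd m)) / b)"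
  have N: "obs_size d > 0" using d by (simp add: obs_size_def)
  define s where "s = (\<lambda>j. infsum (?F j) UNIV)"
  have s: "(?F j has_sum s j) UNIV" "complex_of_real (s j) = ?c * (\<Sum>\<^sub>\<infinity>r. ?\<kappa> r * cis (fourier_freq d j \<bullet> real_pair r))" for j
  proof -
    obtain x where x: "(?F j has_sum x) UNIV" "complex_of_real x
        = ?c * (\<Sum>\<^sub>\<infinity>r. k (a * of_int (fst r), b * of_int (snd r)) * cis (- ((l - fourier_freq d j) \<bullet> real_pair r)))"
      using poisson_summation[OF ab, of "l - fourier_freq d j"] by blast
    have "x = s j" using x(1) by (simp add: s_def infsumI)
    moreover have "k (a * of_int (fst r), b * of_int (snd r)) * cis (- ((l - fourier_freq d j) \<bullet> real_pair r))
        = ?\<kappa> r * cis (fourier_freq d j \<bullet> real_pair r)" for r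
      by (simp add: lag_coeff_def mult.assoc cis_mult inner_diff_left)
    ultimately show "(?F j has_sum s j) UNIV" "complex_of_real (s j) = ?c * (\<Sum>\<^sub>\<infinity>r. ?\<kappa> r * cis (fourier_freq d j \<bullet> real_pair r))"
      using x by simp_all
  qed
  have per0: "0 \<le> periodogram d v j" for j by (simp add: periodogram_def)
  have "((\<lambda>(j, m). ?F j m * periodogram d v j) has_sum (\<Sum>j\<in>?T. s j * periodogram d v j)) (?T \<times> UNIV)"
  proof (rule has_sum_SigmaI)
    show "((\<lambda>y. case (j, y) of (j, m) \<Rightarrow> ?F j m * periodogram d v j) has_sum s j * periodogram d v j) UNIV" for j
      using has_sum_cmult_left[OF s(1)[of j], of "periodogram d v j"] by simp
    then show "(\<lambda>(j, m). ?F j m * periodogram d v j) summable_on ?T \<times> UNIV"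
      by (intro summable_on_SigmaI[where g = "\<lambda>j. s j * periodogram d v j"])
        (auto intro!: mult_nonneg_nonneg K_nonneg per0)
  qed (intro has_sum_finite, simp)
  also have "?this \<longleftrightarrow> ((\<lambda>x. ?f ((\<lambda>(j, m). (fst j + fst m * int (fst d), snd j + snd m * int (snd d))) x))
      has_sum (\<Sum>j\<in>?T. s j * periodogram d v j)) (?T \<times> UNIV)"
  proof (intro has_sum_cong, clarify)
    fix j1 j2 m1 m2 :: int
    have "periodogram d v (j1 + m1 * int (fst d), j2 + m2 * int (snd d)) = periodogram d v (j1, j2)"
      using periodogram_grid_periodic[OF d, of "(m1 * int (fst d), m2 * int (snd d))" v "(j1, j2)"]
      by (simp add: grid_dvd_def)
    then show "?F (j1, j2) (m1, m2) * periodogram d v (j1, j2)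
        = ?f (fst (j1, j2) + fst (m1, m2) * int (fst d), snd (j1, j2) + snd (m1, m2) * int (snd d))"
      by (simp add: fourier_freq_grid_shift[OF d] algebra_simps)
  qed
  also have "\<dots> \<longleftrightarrow> (?f has_sum (\<Sum>j\<in>?T. s j * periodogram d v j)) UNIV"
    by (rule has_sum_reindex_bij_betw[OF grid_decomposition[OF d]])
  finally have "infsum ?f UNIV = (\<Sum>j\<in>?T. s j * periodogram d v j)" by (rule infsumI)
  then have total: "complex_of_real (infsum ?f UNIV)
      = ?c * (\<Sum>j\<in>?T. (\<Sum>\<^sub>\<infinity>r. ?\<kappa> r * cis (fourier_freq d j \<bullet> real_pair r)) * of_real (periodogram d v j))"
    by (simp only: of_real_sum of_real_mult s(2) sum_distrib_left mult.assoc)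
  let ?S = "\<lambda>j. \<Sum>\<^sub>\<infinity>r. ?\<kappa> r * cis (fourier_freq d j \<bullet> real_pair r)"
  have per: "of_real (periodogram d v j) = of_real (J j) - (if grid_dvd d j then complex_of_real (J j) else 0)" for j
    using periodogram_eq_dft[OF d, of v j \<mu>] by (simp add: J_def)
  have corr: "(\<Sum>j\<in>?T. ?S j * (if grid_dvd d j then complex_of_real (J j) else 0))
      = infsum ?\<kappa> UNIV * of_real (J 0)"
  proof -
    have "(\<Sum>j\<in>?T. ?S j * (if grid_dvd d j then complex_of_real (J j) else 0))
        = (\<Sum>j\<in>{j \<in> ?T. grid_dvd d j}. ?S j * of_real (J j))"
      by (subst sum.inter_filter) (auto intro!: sum.cong)
    also have "\<dots> = (\<Sum>j\<in>{j \<in> ?T. grid_dvd d j}. infsum ?\<kappa> UNIV * of_real (J 0))"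
    proof (rule sum.cong[OF refl])
      fix j assume "j \<in> {j \<in> ?T. grid_dvd d j}"
      then have j: "grid_dvd d j" by simp
      have "J j = J 0" using dft_grid_periodic[OF d j, of ?X 0] by (simp add: J_def)
      then show "?S j * of_real (J j) = infsum ?\<kappa> UNIV * of_real (J 0)"
        by (simp add: cis_fourier_freq_grid[OF d j])
    qed
    finally show ?thesis by (simp add: grid_zeros_in_region[OF d])
  qed
  have \<kappa>_summable: "(\<lambda>r. ?\<kappa> r * cis (\<theta> \<bullet> real_pair r)) summable_on UNIV" for \<theta>
    by (rule abs_summable_summable, rule summable_on_comparison_test[OF lattice_value_summable[OF ab]])
      (auto intro: lag_coeff_le simp: norm_mult)
  have main: "(\<Sum>j\<in>?T. ?S j * of_real (J j))
      = (\<Sum>s\<in>?T. \<Sum>t\<in>?T. of_real (?X s * ?X t) * aliased_coeff a b d l (s - t))"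
  proof (rule has_sum_unique)
    let ?h = "\<lambda>r. \<Sum>j\<in>?T. ?\<kappa> r * cis (fourier_freq d j \<bullet> real_pair r) * of_real (J j)"
    show "(?h has_sum (\<Sum>j\<in>?T. ?S j * of_real (J j))) UNIV"
      by (intro has_sum_finite_sum has_sum_cmult_left has_sum_infsum \<kappa>_summable)
    have "?h r = (\<Sum>s\<in>?T. \<Sum>t\<in>?T. of_real (?X s * ?X t) * (if r \<in> coset d (s - t) then ?\<kappa> r else 0))" for r
    proof -
      have "?h r = ?\<kappa> r * (\<Sum>j\<in>?T. of_real (J j) * cis (fourier_freq d j \<bullet> real_pair r))"
        by (simp add: sum_distrib_left mult_ac)
      also have "\<dots> = ?\<kappa> r * (\<Sum>s\<in>?T. \<Sum>t\<in>?T. of_real (?X s * ?X t) * (if grid_dvd d (r - (s - t)) then 1 else 0))"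
        unfolding J_def sum_cmod_dft_cis[OF d] ..
      also have "\<dots> = (\<Sum>s\<in>?T. \<Sum>t\<in>?T. of_real (?X s * ?X t) * (if r \<in> coset d (s - t) then ?\<kappa> r else 0))"
        unfolding sum_distrib_left by (intro sum.cong refl) (simp add: coset_def)
      finally show ?thesis .
    qed
    moreover have "((\<lambda>r. if r \<in> coset d u then ?\<kappa> r else 0) has_sum aliased_coeff a b d l u) UNIV" for u
    proof -
      have "(?\<kappa> has_sum aliased_coeff a b d l u) (coset d u)"
        unfolding aliased_coeff_def by (intro has_sum_infsum lag_coeff_summable ab)
      then show ?thesis by (rule has_sum_cong_neutral[THEN iffD1, rotated -1]) auto
    qed
    ultimately show "(?h has_sum (\<Sum>s\<in>?T. \<Sum>t\<in>?T. of_real (?X s * ?X t) * aliased_coeff a b d l (s - t))) UNIV"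
      by (simp only: has_sum_finite_sum has_sum_cmult_right)
  qed
  have "complex_of_real (infsum ?f UNIV) = ?c * ((\<Sum>j\<in>?T. ?S j * of_real (J j)) - infsum ?\<kappa> UNIV * of_real (J 0))"
    unfolding total per right_diff_distrib sum_subtractf corr ..
  then show ?thesis
    unfolding main double_sum_by_lag[OF N] by (simp only: J_def)
qed

end

section \<open>Deviation of the estimator from the spectral density\<close>

definition lag_fraction :: "nat \<times> nat \<Rightarrow> int \<times> int \<Rightarrow> real" where
  "lag_fraction d u = real (card {j \<in> obs_region d. j + u \<in> obs_region d}) / obs_size d"

lemma lag_fraction_nonneg: "0 \<le> lag_fraction d u"
  by (simp add: lag_fraction_def obs_size_def)

lemma lag_fraction_le_1: "lag_fraction d u \<le> 1"
proof -
  have "card {j \<in> obs_region d. j + u \<in> obs_region d} \<le> card (obs_region d)"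
    by (rule card_mono) auto
  also have "\<dots> = fst d * snd d" by (simp add: obs_region_def)
  finally have "real (card {j \<in> obs_region d. j + u \<in> obs_region d}) \<le> obs_size d"
    unfolding obs_size_def of_nat_mult[symmetric] by (simp only: of_nat_le_iff)
  then show ?thesis by (auto simp: lag_fraction_def divide_le_eq_1 obs_size_def zero_less_mult_iff)
qed

lemma lag_fraction_outside: "u \<notin> lags d \<Longrightarrow> lag_fraction d u = 0"
proof -
  assume u: "u \<notin> lags d"
  have "u \<in> lags d" if "j \<in> obs_region d" "j + u \<in> obs_region d" for j
    unfolding lags_def by (rule image_eqI[of _ _ "(j + u, j)"]) (use that in auto)
  with u have "{j \<in> obs_region d. j + u \<in> obs_region d} = {}" by auto
  then show ?thesis by (simp only: lag_fraction_def card.empty of_nat_0 div_0)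
qed

lemma lag_fraction_ge:
  assumes d: "fst d > 0" "snd d > 0" and u: "\<bar>fst u\<bar> \<le> int (fst d)" "\<bar>snd u\<bar> \<le> int (snd d)"
  shows "(1 - \<bar>of_int (fst u)\<bar> / real (fst d)) * (1 - \<bar>of_int (snd u)\<bar> / real (snd d)) \<le> lag_fraction d u"
proof -
  have one: "int n - \<bar>x\<bar> \<le> int (card {j \<in> {1..int n}. j + x \<in> {1..int n}})" for n x
  proof -
    have "{j \<in> {1..int n}. j + x \<in> {1..int n}} = {max 1 (1 - x)..min (int n) (int n - x)}" by auto
    then have "int (card {j \<in> {1..int n}. j + x \<in> {1..int n}})
        = int (nat (min (int n) (int n - x) - max 1 (1 - x) + 1))"
      by (simp only: card_atLeastAtMost_int)
    moreover have "int n - \<bar>x\<bar> \<le> min (int n) (int n - x) - max 1 (1 - x) + 1"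
      by (cases "0 \<le> x") auto
    ultimately show ?thesis by linarith
  qed
  have ge: "1 - \<bar>of_int x\<bar> / real n \<le> real (card {j \<in> {1..int n}. j + x \<in> {1..int n}}) / real n"
    if "n > 0" for n x
  proof -
    have "real n - \<bar>of_int x\<bar> \<le> real (card {j \<in> {1..int n}. j + x \<in> {1..int n}})"
      using one[of n x] by linarith
    then have "(real n - \<bar>of_int x\<bar>) / real n \<le> real (card {j \<in> {1..int n}. j + x \<in> {1..int n}}) / real n"
      by (intro divide_right_mono) auto
    then show ?thesis using that by (simp add: diff_divide_distrib)
  qed
  have "{j \<in> obs_region d. j + u \<in> obs_region d}
      = {j \<in> {1..int (fst d)}. j + fst u \<in> {1..int (fst d)}} \<times> {j \<in> {1..int (snd d)}. j + snd u \<in> {1..int (snd d)}}"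
    by (auto simp: obs_region_def mem_Times_iff)
  then have "lag_fraction d u
      = (real (card {j \<in> {1..int (fst d)}. j + fst u \<in> {1..int (fst d)}}) / real (fst d))
      * (real (card {j \<in> {1..int (snd d)}. j + snd u \<in> {1..int (snd d)}}) / real (snd d))"
    unfolding lag_fraction_def obs_size_def by (simp only: card_cartesian_product of_nat_mult times_divide_times_eq)
  moreover have "0 \<le> 1 - \<bar>of_int (snd u)\<bar> / real (snd d)"
    using u d by (simp add: divide_le_eq_1)
  ultimately show ?thesis
    by (simp only:) (rule mult_mono[OF ge[OF d(1), of "fst u"] ge[OF d(2), of "snd u"]], auto)
qed

lemma lag_fraction_tendsto_1:
  fixes d :: "nat \<Rightarrow> nat \<times> nat"
  assumes d: "filterlim (\<lambda>n. fst (d n)) at_top sequentially" "filterlim (\<lambda>n. snd (d n)) at_top sequentially"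
  shows "(\<lambda>n. lag_fraction (d n) u) \<longlonglongrightarrow> 1"
proof (rule tendsto_sandwich)
  let ?l = "\<lambda>n. (1 - \<bar>of_int (fst u)\<bar> / real (fst (d n))) * (1 - \<bar>of_int (snd u)\<bar> / real (snd (d n)))"
  have "(\<lambda>n. 1 - c / real (e n)) \<longlonglongrightarrow> 1 - 0" if "filterlim e at_top sequentially" for c and e :: "nat \<Rightarrow> nat"
    by (intro tendsto_diff tendsto_const tendsto_divide_0[OF tendsto_const] filterlim_at_top_imp_at_infinity
        filterlim_compose[OF filterlim_real_sequentially that])
  from tendsto_mult[OF this[OF d(1)] this[OF d(2)]]
  show "?l \<longlonglongrightarrow> 1" by simp
  have ev: "\<forall>\<^sub>F n in sequentially. nat x + 1 \<le> e n" if "filterlim e at_top sequentially" for x and e :: "nat \<Rightarrow> nat"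
    using that by (simp add: filterlim_at_top)
  show "\<forall>\<^sub>F n in sequentially. ?l n \<le> lag_fraction (d n) u"
    using ev[OF d(1), of "\<bar>fst u\<bar>"] ev[OF d(2), of "\<bar>snd u\<bar>"]
  proof eventually_elim
    case (elim n)
    then show ?case by (intro lag_fraction_ge) linarith+
  qed
qed (auto intro!: always_eventually lag_fraction_le_1)

text \<open>Dominated convergence for series.\<close>

lemma weighted_infsum_tendsto_zero:
  fixes \<gamma> :: "'a \<Rightarrow> real" and \<beta> :: "nat \<Rightarrow> 'a \<Rightarrow> real"
  assumes \<gamma>: "(\<lambda>u. \<bar>\<gamma> u\<bar>) summable_on UNIV"
    and \<beta>0: "\<And>n u. 0 \<le> \<beta> n u" and bounded: "\<forall>\<^sub>F n in sequentially. \<forall>u. \<beta> n u \<le> C"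
    and lim: "\<And>u. (\<lambda>n. \<beta> n u) \<longlonglongrightarrow> 0"
  shows "(\<lambda>n. \<Sum>\<^sub>\<infinity>u. \<bar>\<gamma> u\<bar> * \<beta> n u) \<longlonglongrightarrow> 0"
proof (rule tendstoI)
  fix e :: real assume "e > 0"
  define D where "D = \<bar>C\<bar> + 1"
  have D: "D > 0" "C \<le> D" by (auto simp: D_def)
  obtain A where A: "finite A" "\<bar>\<Sum>\<^sub>\<infinity>u\<in>- A. \<bar>\<gamma> u\<bar>\<bar> < e / (2 * D)"
    using infsum_tail_small[OF \<gamma>, of "e / (2 * D)"] \<open>e > 0\<close> D by auto
  have "(\<lambda>n. \<Sum>u\<in>A. \<bar>\<gamma> u\<bar> * \<beta> n u) \<longlonglongrightarrow> (\<Sum>u\<in>A. \<bar>\<gamma> u\<bar> * 0)"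
    by (intro tendsto_sum tendsto_mult tendsto_const lim)
  then have "(\<lambda>n. \<Sum>u\<in>A. \<bar>\<gamma> u\<bar> * \<beta> n u) \<longlonglongrightarrow> 0" by simp
  then have "\<forall>\<^sub>F n in sequentially. (\<Sum>u\<in>A. \<bar>\<gamma> u\<bar> * \<beta> n u) < e / 2"
    using \<open>e > 0\<close> by (intro order_tendstoD(2)[of _ 0]) auto
  with bounded show "\<forall>\<^sub>F n in sequentially. dist (\<Sum>\<^sub>\<infinity>u. \<bar>\<gamma> u\<bar> * \<beta> n u) 0 < e"
  proof eventually_elim
    case (elim n)
    have \<gamma>B: "(\<lambda>u. \<bar>\<gamma> u\<bar>) summable_on B" for B using \<gamma> by (rule summable_on_subset_banach) auto
    have le: "\<bar>\<gamma> u\<bar> * \<beta> n u \<le> \<bar>\<gamma> u\<bar> * D" for u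
      using elim(1) D by (intro mult_left_mono) (auto intro: order_trans)
    have sB: "(\<lambda>u. \<bar>\<gamma> u\<bar> * \<beta> n u) summable_on B" for B
      by (rule summable_on_comparison_test[OF summable_on_cmult_left[OF \<gamma>B, of D]])
        (use le \<beta>0 in auto)
    have "(\<Sum>\<^sub>\<infinity>u. \<bar>\<gamma> u\<bar> * \<beta> n u) = (\<Sum>u\<in>A. \<bar>\<gamma> u\<bar> * \<beta> n u) + (\<Sum>\<^sub>\<infinity>u\<in>- A. \<bar>\<gamma> u\<bar> * \<beta> n u)"
      using infsum_Un_disjoint[of "\<lambda>u. \<bar>\<gamma> u\<bar> * \<beta> n u" A "- A"] A(1) sB by auto
    moreover have "(\<Sum>\<^sub>\<infinity>u\<in>- A. \<bar>\<gamma> u\<bar> * \<beta> n u) \<le> (\<Sum>\<^sub>\<infinity>u\<in>- A. \<bar>\<gamma> u\<bar> * D)"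
      by (intro infsum_mono sB summable_on_cmult_left \<gamma>B le)
    moreover have "(\<Sum>\<^sub>\<infinity>u\<in>- A. \<bar>\<gamma> u\<bar> * D) = (\<Sum>\<^sub>\<infinity>u\<in>- A. \<bar>\<gamma> u\<bar>) * D"
      by (rule infsum_cmult_left) (intro \<gamma>B)
    moreover have "(\<Sum>\<^sub>\<infinity>u\<in>- A. \<bar>\<gamma> u\<bar>) * D \<le> e / (2 * D) * D"
      using A(2) D by (intro mult_right_mono) auto
    moreover have "e / (2 * D) * D = e / 2" using D by simp
    moreover have "0 \<le> (\<Sum>\<^sub>\<infinity>u. \<bar>\<gamma> u\<bar> * \<beta> n u)" by (intro infsum_nonneg mult_nonneg_nonneg \<beta>0) auto
    ultimately show ?case using elim(2) by simp
  qed
qed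

text \<open>The periodogram of the centred data at frequency zero, where the estimator ignores it.\<close>

definition mean_periodogram :: "real \<Rightarrow> nat \<times> nat \<Rightarrow> (int \<times> int \<Rightarrow> real) \<Rightarrow> real" where
  "mean_periodogram \<mu> d v = (\<Sum>t\<in>obs_region d. v t - \<mu>)\<^sup>2 / obs_size d"

context dominated_kernel
begin

text \<open>The coefficient of \<open>\<gamma>(u)\<close> in the bias: the aliases of \<open>u\<close>, and the failure of the taper
\<open>k(h u)\<close> and of the proportion of available pairs to equal \<open>1\<close>.\<close>

definition bias_factor :: "real \<times> real \<Rightarrow> nat \<times> nat \<Rightarrow> int \<times> int \<Rightarrow> real" where
  "bias_factor h d u = coset_tail (fst h) (snd h) d u
    + cmod (of_real (lag_fraction d u) * k (fst h * of_int (fst u), snd h * of_int (snd u)) - 1)"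

definition normalization :: "real \<times> real \<Rightarrow> nat \<times> nat \<Rightarrow> real" where
  "normalization h d = (\<Sum>\<^sub>\<infinity>j. K (fst (fourier_freq d j) / fst h, snd (fourier_freq d j) / snd h))"

lemma bias_factor_nonneg: "0 \<le> bias_factor h d u"
  by (simp add: bias_factor_def coset_tail_nonneg)

lemma bias_factor_le: "bias_factor h d u \<le> coset_tail (fst h) (snd h) d u + (g 0 + 1)"
proof -
  let ?k = "k (fst h * of_int (fst u), snd h * of_int (snd u))"
  have "cmod (of_real (lag_fraction d u) * ?k - 1) \<le> cmod (of_real (lag_fraction d u) * ?k) + 1"
    using norm_triangle_ineq4[of "of_real (lag_fraction d u) * ?k" 1] by simp
  also have "cmod (of_real (lag_fraction d u) * ?k) \<le> 1 * g 0"
    unfolding norm_mult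
    using lag_fraction_nonneg[of d u] lag_fraction_le_1[of d u] order_trans[OF k_dominated antimono[of 0]]
    by (intro mult_mono) (auto simp: max_norm_def le_max_iff_disj nonneg)
  finally show ?thesis by (simp add: bias_factor_def)
qed

lemma aliased_coeff_error:
  assumes ab: "fst h > 0" "snd h > 0"
  shows "cmod (of_real (lag_fraction d u) * aliased_coeff (fst h) (snd h) d l u - cis (- (l \<bullet> real_pair u)))
    \<le> bias_factor h d u"
proof -
  let ?\<kappa> = "lag_coeff (fst h) (snd h) l" and ?e = "cis (- (l \<bullet> real_pair u))"
  let ?\<rho> = "lag_fraction d u" and ?k = "k (fst h * of_int (fst u), snd h * of_int (snd u))"
  have "coset d u = {u} \<union> (coset d u - {u})" by (auto simp: coset_def grid_dvd_def)
  then have "aliased_coeff (fst h) (snd h) d l u = ?\<kappa> u + infsum ?\<kappa> (coset d u - {u})"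
    unfolding aliased_coeff_def
    using infsum_Un_disjoint[of ?\<kappa> "{u}" "coset d u - {u}"] lag_coeff_summable[OF ab] by simp
  then have "of_real ?\<rho> * aliased_coeff (fst h) (snd h) d l u - ?e
      = of_real ?\<rho> * infsum ?\<kappa> (coset d u - {u}) + (of_real ?\<rho> * ?k - 1) * ?e"
    by (simp add: lag_coeff_def algebra_simps)
  then have "cmod (of_real ?\<rho> * aliased_coeff (fst h) (snd h) d l u - ?e)
      \<le> cmod (of_real ?\<rho> * infsum ?\<kappa> (coset d u - {u})) + cmod ((of_real ?\<rho> * ?k - 1) * ?e)"
    by (simp only: norm_triangle_ineq)
  also have "cmod (of_real ?\<rho> * infsum ?\<kappa> (coset d u - {u})) \<le> 1 * coset_tail (fst h) (snd h) d u"
    unfolding norm_mult coset_tail_def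
    using lag_fraction_nonneg[of d u] lag_fraction_le_1[of d u]
    by (intro mult_mono infsum_lag_coeff_le ab) auto
  finally show ?thesis by (simp add: norm_mult bias_factor_def)
qed

text \<open>The right-hand side does not depend on the frequency \<open>l\<close>, which makes the estimate uniform. Here \<open>c\<close>
compares the normalisation with the Riemann sum of \<open>\<integral> K\<close>, and the three summands multiplied by \<open>c\<close>
are the noise, the contribution of the zeroed frequencies and the bias.\<close>

lemma deviation_bound:
  fixes \<gamma> :: "int \<times> int \<Rightarrow> real"
  assumes ab: "fst h > 0" "snd h > 0" and d: "fst d > 0" "snd d > 0"
    and N: "normalization h d > 0" and \<gamma>: "(\<lambda>u. \<bar>\<gamma> u\<bar>) summable_on UNIV"
    and f: "f = Re (1 / (4 * of_real pi ^ 2) * (\<Sum>\<^sub>\<infinity>j. exp (- \<i> * of_real (l \<bullet> real_pair j)) * of_real (\<gamma> j)))"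
  defines "c \<equiv> prod_abs h * obs_size d / (4 * pi\<^sup>2 * normalization h d)"
  shows "\<bar>spec_est K h d v l - f\<bar> \<le>
    c * ((\<Sum>u\<in>lags d. \<bar>sample_autocov \<mu> d v u - \<gamma> u * lag_fraction d u\<bar> * coset_mass (fst h) (snd h) d u)
      + infsum (lattice_value (fst h) (snd h)) UNIV * mean_periodogram \<mu> d v / obs_size d
      + (\<Sum>\<^sub>\<infinity>u. \<bar>\<gamma> u\<bar> * bias_factor h d u))
    + \<bar>c - 1\<bar> * (\<Sum>\<^sub>\<infinity>u. \<bar>\<gamma> u\<bar>)"
proof -
  let ?a = "fst h" and ?b = "snd h" and ?\<rho> = "lag_fraction d" and ?R = "sample_autocov \<mu> d v"
  let ?A = "aliased_coeff (fst h) (snd h) d l" and ?B = "infsum (lag_coeff (fst h) (snd h) l) UNIV"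
  let ?J = "mean_periodogram \<mu> d v" and ?W = "infsum (lattice_value (fst h) (snd h)) UNIV"
  let ?e = "\<lambda>u. cis (- (l \<bullet> real_pair u))" and ?\<beta> = "bias_factor h d"
  define F where "F = (\<Sum>\<^sub>\<infinity>u. of_real (\<gamma> u) * ?e u)"
  have T: "obs_size d > 0" using d by (simp add: obs_size_def)
  have c0: "c \<ge> 0" using ab N T by (simp add: c_def prod_abs_def)
  have J0: "0 \<le> ?J" using T by (simp add: mean_periodogram_def)
  have "dft d (\<lambda>t. v t - \<mu>) 0 = of_real (\<Sum>t\<in>obs_region d. v t - \<mu>)"
    by (simp add: dft_def fourier_freq_def inner_prod_def)
  then have J: "(cmod (dft d (\<lambda>t. v t - \<mu>) 0))\<^sup>2 / obs_size d = ?J"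
    by (simp only: mean_periodogram_def norm_of_real power2_abs)
  have "4 * pi\<^sup>2 * spec_est K h d v l
      = (\<Sum>\<^sub>\<infinity>j. K ((fst l - fst (fourier_freq d j)) / ?a, (snd l - snd (fourier_freq d j)) / ?b)
          * periodogram d v j) / normalization h d"
  proof -
    have "(\<Sum>\<^sub>\<infinity>j. K ((fst l - fst (fourier_freq d j)) / ?a, (snd l - snd (fourier_freq d j)) / ?b)
          / normalization h d * periodogram d v j)
        = (\<Sum>\<^sub>\<infinity>j. K ((fst l - fst (fourier_freq d j)) / ?a, (snd l - snd (fourier_freq d j)) / ?b)
          * periodogram d v j * (1 / normalization h d))"
      by (intro infsum_cong) simp
    also have "\<dots> = (\<Sum>\<^sub>\<infinity>j. K ((fst l - fst (fourier_freq d j)) / ?a, (snd l - snd (fourier_freq d j)) / ?b)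
          * periodogram d v j) * (1 / normalization h d)"
      by (rule infsum_cmult_left')
    finally show ?thesis by (simp add: spec_est_def normalization_def)
  qed
  then have "complex_of_real (4 * pi\<^sup>2 * spec_est K h d v l)
      = of_real (?a * ?b / (4 * pi\<^sup>2)) * (of_real (obs_size d) * (\<Sum>u\<in>lags d. of_real (?R u) * ?A u) - ?B * of_real ?J)
        / of_real (normalization h d)"
    by (simp only: of_real_divide smoothed_periodogram[OF ab d, of l v \<mu>] J)
  also have "\<dots> = of_real c * ((\<Sum>u\<in>lags d. of_real (?R u) * ?A u) - ?B * of_real (?J / obs_size d))"
    using T N ab by (simp add: c_def prod_abs_def field_simps)
  finally have est: "complex_of_real (4 * pi\<^sup>2 * spec_est K h d v l)
      = of_real c * ((\<Sum>u\<in>lags d. of_real (?R u) * ?A u) - ?B * of_real (?J / obs_size d))" .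
  have F': "f = Re F / (4 * pi\<^sup>2)"
  proof -
    have "(\<Sum>\<^sub>\<infinity>j. exp (- \<i> * of_real (l \<bullet> real_pair j)) * of_real (\<gamma> j)) = F"
      unfolding F_def by (intro infsum_cong) (simp add: cis_conv_exp mult.commute)
    then have "f = Re (1 / (4 * of_real pi ^ 2) * F)" using f by simp
    also have "1 / (4 * of_real pi ^ 2) * F = of_real (1 / (4 * pi\<^sup>2)) * F" by simp
    finally show ?thesis by simp
  qed
  have \<gamma>c: "(\<lambda>u. of_real (\<gamma> u) * z u) summable_on UNIV" if "\<And>u. cmod (z u) \<le> C" for z :: "int \<times> int \<Rightarrow> complex" and C
    by (rule abs_summable_summable, rule summable_on_comparison_test[OF summable_on_cmult_left[OF \<gamma>, of C]])
      (auto simp: norm_mult intro!: mult_left_mono that)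
  have Fle: "cmod F \<le> (\<Sum>\<^sub>\<infinity>u. \<bar>\<gamma> u\<bar>)"
    unfolding F_def by (rule norm_infsum_le[OF has_sum_infsum has_sum_infsum])
      (auto intro!: \<gamma> \<gamma>c[of _ 1] simp: norm_mult)
  have \<beta>_le: "?\<beta> u \<le> ?W + (g 0 + 1)" for u
  proof -
    have "coset_tail ?a ?b d u \<le> ?W"
      unfolding coset_tail_def by (intro infsum_mono2 lattice_value_summable ab lattice_value_nonneg) auto
    then show ?thesis using bias_factor_le[of h d u] by linarith
  qed
  have \<gamma>\<beta>: "(\<lambda>u. \<bar>\<gamma> u\<bar> * ?\<beta> u) summable_on UNIV"
    by (rule summable_on_comparison_test[OF summable_on_cmult_left[OF \<gamma>, of "?W + (g 0 + 1)"]])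
      (auto intro!: mult_left_mono \<beta>_le mult_nonneg_nonneg bias_factor_nonneg)
  have bias: "cmod ((\<Sum>u\<in>lags d. of_real (\<gamma> u * ?\<rho> u) * ?A u) - F) \<le> (\<Sum>\<^sub>\<infinity>u. \<bar>\<gamma> u\<bar> * ?\<beta> u)"
  proof -
    let ?z = "\<lambda>u. of_real (?\<rho> u) * ?A u - ?e u"
    have sz: "(\<lambda>u. of_real (\<gamma> u) * ?z u) summable_on UNIV"
      by (rule \<gamma>c[of _ "?W + (g 0 + 1)"]) (rule order_trans[OF aliased_coeff_error[OF ab] \<beta>_le])
    have se: "(\<lambda>u. of_real (\<gamma> u) * ?e u) summable_on UNIV" by (rule \<gamma>c[of _ 1]) simp
    have "(\<Sum>\<^sub>\<infinity>u. of_real (\<gamma> u) * ?z u) + F = (\<Sum>\<^sub>\<infinity>u. of_real (\<gamma> u) * ?z u + of_real (\<gamma> u) * ?e u)"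
      unfolding F_def by (rule infsum_add[symmetric, OF sz se])
    also have "\<dots> = (\<Sum>\<^sub>\<infinity>u. of_real (\<gamma> u * ?\<rho> u) * ?A u)"
      by (intro infsum_cong) (simp add: algebra_simps)
    also have "\<dots> = (\<Sum>\<^sub>\<infinity>u\<in>lags d. of_real (\<gamma> u * ?\<rho> u) * ?A u)"
      by (rule infsum_cong_neutral) (auto simp: lag_fraction_outside)
    also have "\<dots> = (\<Sum>u\<in>lags d. of_real (\<gamma> u * ?\<rho> u) * ?A u)" by simp
    finally have "(\<Sum>u\<in>lags d. of_real (\<gamma> u * ?\<rho> u) * ?A u) - F = (\<Sum>\<^sub>\<infinity>u. of_real (\<gamma> u) * ?z u)"
      by (simp add: algebra_simps)
    also have "cmod \<dots> \<le> (\<Sum>\<^sub>\<infinity>u. \<bar>\<gamma> u\<bar> * ?\<beta> u)"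
      by (rule norm_infsum_le[OF has_sum_infsum[OF sz] has_sum_infsum[OF \<gamma>\<beta>]])
        (unfold norm_mult, intro mult_mono aliased_coeff_error ab, auto)
    finally show ?thesis .
  qed
  have noise: "cmod (\<Sum>u\<in>lags d. of_real (?R u - \<gamma> u * ?\<rho> u) * ?A u)
      \<le> (\<Sum>u\<in>lags d. \<bar>?R u - \<gamma> u * ?\<rho> u\<bar> * coset_mass ?a ?b d u)"
    unfolding aliased_coeff_def coset_mass_def
    by (rule order_trans[OF norm_sum], intro sum_mono, unfold norm_mult norm_of_real)
      (intro mult_left_mono infsum_lag_coeff_le ab, auto)
  have zero: "cmod (?B * of_real (?J / obs_size d)) \<le> ?W * ?J / obs_size d"
  proof -
    have "cmod (?B * of_real (?J / obs_size d)) = cmod ?B * (?J / obs_size d)"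
      using J0 T unfolding norm_mult norm_of_real by simp
    also have "\<dots> \<le> ?W * (?J / obs_size d)"
      using J0 T by (intro mult_right_mono infsum_lag_coeff_le ab) auto
    finally show ?thesis by simp
  qed
  let ?x1 = "\<Sum>u\<in>lags d. of_real (?R u - \<gamma> u * ?\<rho> u) * ?A u"
  let ?x2 = "?B * of_real (?J / obs_size d)"
  let ?x3 = "(\<Sum>u\<in>lags d. of_real (\<gamma> u * ?\<rho> u) * ?A u) - F"
  have "complex_of_real (4 * pi\<^sup>2 * spec_est K h d v l) - F
      = of_real c * (?x1 - ?x2 + ?x3) + of_real (c - 1) * F"
    unfolding est by (simp add: sum_subtractf left_diff_distrib right_diff_distrib distrib_left)
  then have "cmod (complex_of_real (4 * pi\<^sup>2 * spec_est K h d v l) - F)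
      \<le> c * cmod (?x1 - ?x2 + ?x3) + \<bar>c - 1\<bar> * cmod F"
    using norm_triangle_ineq[of "of_real c * (?x1 - ?x2 + ?x3)" "of_real (c - 1) * F"] c0
    by (simp only: norm_mult norm_of_real abs_of_nonneg)
  also have "\<dots> \<le> c * ((\<Sum>u\<in>lags d. \<bar>?R u - \<gamma> u * ?\<rho> u\<bar> * coset_mass ?a ?b d u) + ?W * ?J / obs_size d
          + (\<Sum>\<^sub>\<infinity>u. \<bar>\<gamma> u\<bar> * ?\<beta> u)) + \<bar>c - 1\<bar> * (\<Sum>\<^sub>\<infinity>u. \<bar>\<gamma> u\<bar>)"
  proof (intro add_mono mult_left_mono c0 Fle abs_ge_zero)
    have "cmod (?x1 - ?x2 + ?x3) \<le> cmod (?x1 - ?x2) + cmod ?x3" by (rule norm_triangle_ineq)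
    also have "cmod (?x1 - ?x2) \<le> cmod ?x1 + cmod ?x2" by (rule norm_triangle_ineq4)
    also note noise
    also note zero
    also note bias
    finally show "cmod (?x1 - ?x2 + ?x3) \<le> (\<Sum>u\<in>lags d. \<bar>?R u - \<gamma> u * ?\<rho> u\<bar> * coset_mass ?a ?b d u)
        + ?W * ?J / obs_size d + (\<Sum>\<^sub>\<infinity>u. \<bar>\<gamma> u\<bar> * ?\<beta> u)" by simp
  qed
  finally have main: "cmod (complex_of_real (4 * pi\<^sup>2 * spec_est K h d v l) - F)
      \<le> c * ((\<Sum>u\<in>lags d. \<bar>?R u - \<gamma> u * ?\<rho> u\<bar> * coset_mass ?a ?b d u) + ?W * ?J / obs_size d
          + (\<Sum>\<^sub>\<infinity>u. \<bar>\<gamma> u\<bar> * ?\<beta> u)) + \<bar>c - 1\<bar> * (\<Sum>\<^sub>\<infinity>u. \<bar>\<gamma> u\<bar>)" (is "_ \<le> ?bound") .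
  have "\<bar>4 * pi\<^sup>2 * spec_est K h d v l - Re F\<bar> \<le> ?bound"
    using abs_Re_le_cmod[of "complex_of_real (4 * pi\<^sup>2 * spec_est K h d v l) - F"] main by simp
  moreover have "\<bar>spec_est K h d v l - f\<bar> \<le> \<bar>4 * pi\<^sup>2 * spec_est K h d v l - Re F\<bar>"
  proof -
    have "spec_est K h d v l - f = (4 * pi\<^sup>2 * spec_est K h d v l - Re F) / (4 * pi\<^sup>2)"
      by (simp add: F' field_simps)
    moreover have "1 \<le> 4 * pi\<^sup>2"
    proof -
      have "1 * 1 \<le> pi * pi" using pi_gt3 by (intro mult_mono) auto
      then show ?thesis by (simp add: power2_eq_square)
    qed
    moreover have "\<bar>x / P\<bar> \<le> \<bar>x\<bar>" if "1 \<le> P" for x P :: real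
      using that mult_left_mono[of 1 P "\<bar>x\<bar>"] by (simp add: abs_divide divide_le_eq)
    ultimately show ?thesis by (simp only:)
  qed
  ultimately show ?thesis by (rule order_trans[rotated])
qed

end

context dominated_kernel
begin

lemma bias_tendsto_zero:
  fixes d :: "nat \<Rightarrow> nat \<times> nat" and h :: "nat \<Rightarrow> real \<times> real" and \<gamma> :: "int \<times> int \<Rightarrow> real"
  assumes k0: "k 0 = 1"
    and d: "filterlim (\<lambda>n. fst (d n)) at_top sequentially" "filterlim (\<lambda>n. snd (d n)) at_top sequentially"
    and h: "(\<lambda>n. fst (h n)) \<longlonglongrightarrow> 0" "(\<lambda>n. snd (h n)) \<longlonglongrightarrow> 0"
    and hd: "filterlim (\<lambda>n. fst (h n) * real (fst (d n))) at_top sequentially"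
      "filterlim (\<lambda>n. snd (h n) * real (snd (d n))) at_top sequentially"
    and \<gamma>: "(\<lambda>u. \<bar>\<gamma> u\<bar>) summable_on UNIV"
  shows "(\<lambda>n. \<Sum>\<^sub>\<infinity>u. \<bar>\<gamma> u\<bar> * bias_factor (h n) (d n) u) \<longlonglongrightarrow> 0"
proof (rule weighted_infsum_tendsto_zero[where \<beta> = "\<lambda>n. bias_factor (h n) (d n)"
      and C = "(4 * g 0 + 4 * mass) + (g 0 + 1)", OF \<gamma>])
  show "0 \<le> bias_factor (h n) (d n) u" for n u by (rule bias_factor_nonneg)
  have large: "\<forall>\<^sub>F n in sequentially. 2 \<le> fst (h n) * real (fst (d n)) \<and> 2 \<le> snd (h n) * real (snd (d n))"
    using hd by (intro eventually_conj) (simp_all add: filterlim_at_top)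
  have pos: "0 < x \<and> 0 < n" if "2 \<le> x * real n" for x n
  proof -
    have "0 < x * real n" using that by linarith
    then show ?thesis by (simp add: zero_less_mult_iff)
  qed
  show "\<forall>\<^sub>F n in sequentially. \<forall>u. bias_factor (h n) (d n) u \<le> (4 * g 0 + 4 * mass) + (g 0 + 1)"
    using large
  proof eventually_elim
    case (elim n)
    have "fst (h n) > 0" "snd (h n) > 0" "fst (d n) > 0" "snd (d n) > 0"
      using pos elim by blast+
    then have "coset_tail (fst (h n)) (snd (h n)) (d n) u \<le> 4 * g 0 + 4 * mass" for u
      using order_trans[OF coset_tail_le_mass coset_mass_le[of "d n" 1 "fst (h n)" "snd (h n)" u]] elim
      by simp
    then show ?case
      using order_trans[OF bias_factor_le add_right_mono] by blast
  qed
  fix u :: "int \<times> int"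
  let ?\<tau> = "\<lambda>n. min (fst (h n) * real (fst (d n))) (snd (h n) * real (snd (d n))) / 2"
  have tau_lim: "filterlim ?\<tau> at_top sequentially"
    unfolding filterlim_at_top
  proof
    fix Z :: real
    have "\<forall>\<^sub>F n in sequentially. 2 * Z \<le> fst (h n) * real (fst (d n)) \<and> 2 * Z \<le> snd (h n) * real (snd (d n))"
      using hd by (intro eventually_conj) (simp_all add: filterlim_at_top)
    then show "\<forall>\<^sub>F n in sequentially. Z \<le> ?\<tau> n" by eventually_elim simp
  qed
  have tail_lim: "(\<lambda>n. coset_tail (fst (h n)) (snd (h n)) (d n) u) \<longlonglongrightarrow> 0"
  proof (rule tendsto_sandwich[where f = "\<lambda>_. 0" and h = "\<lambda>n. 4 * mass / (?\<tau> n)\<^sup>2"])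
    have "(\<lambda>n. 4 * mass / (?\<tau> n)\<^sup>2) \<longlonglongrightarrow> 0"
      using tau_lim
      by (intro tendsto_divide_0[OF tendsto_const] filterlim_at_top_imp_at_infinity
          filterlim_pow_at_top) auto
    then show "(\<lambda>n. 4 * mass / (?\<tau> n)\<^sup>2) \<longlonglongrightarrow> 0" .
    have "\<forall>\<^sub>F n in sequentially. nat (2 * \<bar>fst u\<bar>) \<le> fst (d n) \<and> nat (2 * \<bar>snd u\<bar>) \<le> snd (d n)"
      using d by (intro eventually_conj) (simp_all add: filterlim_at_top)
    with large show "\<forall>\<^sub>F n in sequentially. coset_tail (fst (h n)) (snd (h n)) (d n) u \<le> 4 * mass / (?\<tau> n)\<^sup>2"
    proof eventually_elim
      case (elim n)
      have "fst (h n) > 0" "snd (h n) > 0" "fst (d n) > 0" "snd (d n) > 0"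
        using pos elim by blast+
      then show ?case
        by (intro coset_tail_le) (use elim in auto)
    qed
  qed (auto intro!: always_eventually coset_tail_nonneg)
  have k_lim: "(\<lambda>n. k (fst (h n) * of_int (fst u), snd (h n) * of_int (snd u)))
      \<longlonglongrightarrow> k (0 * of_int (fst u), 0 * of_int (snd u))"
    by (rule isCont_tendsto_compose[OF k_isCont]) (intro tendsto_Pair tendsto_mult h tendsto_const)
  have "(\<lambda>n. cmod (of_real (lag_fraction (d n) u) * k (fst (h n) * of_int (fst u), snd (h n) * of_int (snd u)) - 1))
      \<longlonglongrightarrow> cmod (of_real 1 * k (0 * of_int (fst u), 0 * of_int (snd u)) - 1)"
    by (intro tendsto_norm tendsto_diff tendsto_mult tendsto_of_real tendsto_const lag_fraction_tendsto_1[OF d] k_lim)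
  from tendsto_add[OF tail_lim this]
  have "(\<lambda>n. bias_factor (h n) (d n) u) \<longlonglongrightarrow> 0 + cmod (of_real 1 * k (0 * of_int (fst u), 0 * of_int (snd u)) - 1)"
    unfolding bias_factor_def .
  then show "(\<lambda>n. bias_factor (h n) (d n) u) \<longlonglongrightarrow> 0"
    using k0 by (simp add: zero_prod_def)
qed

text \<open>As the two bandwidths are comparable, \<open>min h\<^sub>1 h\<^sub>2\<close> squared is of the order of \<open>h\<^sub>1 h\<^sub>2\<close>. Every lattice
sum in \<open>deviation_bound\<close> is therefore \<open>O(1/|h|)\<close>.\<close>

lemma uniform_deviation_bound:
  fixes d :: "nat \<Rightarrow> nat \<times> nat" and h :: "nat \<Rightarrow> real \<times> real" and \<gamma> :: "int \<times> int \<Rightarrow> real"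
  assumes k0: "k 0 = 1"
    and d: "filterlim (\<lambda>n. fst (d n)) at_top sequentially" "filterlim (\<lambda>n. snd (d n)) at_top sequentially"
    and h: "(\<lambda>n. fst (h n)) \<longlonglongrightarrow> 0" "(\<lambda>n. snd (h n)) \<longlonglongrightarrow> 0"
    and asymp: "(\<lambda>n. fst (h n)) \<in> O(\<lambda>n. snd (h n))" "(\<lambda>n. snd (h n)) \<in> O(\<lambda>n. fst (h n))"
    and hd: "filterlim (\<lambda>n. fst (h n) * real (fst (d n))) at_top sequentially"
      "filterlim (\<lambda>n. snd (h n) * real (snd (d n))) at_top sequentially"
    and \<gamma>: "(\<lambda>u. \<bar>\<gamma> u\<bar>) summable_on UNIV"
    and riemann: "(\<lambda>n. 4 * pi\<^sup>2 / (prod_abs (h n) * obs_size (d n)) * normalization (h n) (d n)) \<longlonglongrightarrow> 1"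
    and f: "\<And>l. f l = Re (1 / (4 * of_real pi ^ 2) * (\<Sum>\<^sub>\<infinity>j. exp (- \<i> * of_real (l \<bullet> real_pair j)) * of_real (\<gamma> j)))"
  obtains C \<delta> where "C > 0" "\<delta> \<longlonglongrightarrow> 0"
    and "\<forall>\<^sub>F n in sequentially. \<forall>v l. \<bar>spec_est K (h n) (d n) v l - f l\<bar> \<le>
        C * (\<Sum>u\<in>lags (d n). \<bar>sample_autocov \<mu> (d n) v u - \<gamma> u * lag_fraction (d n) u\<bar>
              * coset_mass (fst (h n)) (snd (h n)) (d n) u)
        + C / (prod_abs (h n) * obs_size (d n)) * mean_periodogram \<mu> (d n) v + \<delta> n"
    and "\<forall>\<^sub>F n in sequentially. (\<Sum>u\<in>lags (d n). coset_mass (fst (h n)) (snd (h n)) (d n) u) \<le> C / prod_abs (h n)"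
    and "\<forall>\<^sub>F n in sequentially. 0 < prod_abs (h n)"
proof -
  define c where "c = (\<lambda>n. prod_abs (h n) * obs_size (d n) / (4 * pi\<^sup>2 * normalization (h n) (d n)))"
  have c_lim: "c \<longlonglongrightarrow> 1"
  proof -
    have "(\<lambda>n. inverse (4 * pi\<^sup>2 / (prod_abs (h n) * obs_size (d n)) * normalization (h n) (d n))) \<longlonglongrightarrow> inverse 1"
      by (intro tendsto_inverse riemann) simp
    moreover have "inverse (4 * pi\<^sup>2 / (prod_abs (h n) * obs_size (d n)) * normalization (h n) (d n)) = c n" for n
      by (simp add: c_def inverse_eq_divide)
    ultimately show ?thesis by simp
  qed
  define G where "G = (\<Sum>\<^sub>\<infinity>u. \<bar>\<gamma> u\<bar>)"
  define \<delta> where "\<delta> = (\<lambda>n. c n * (\<Sum>\<^sub>\<infinity>u. \<bar>\<gamma> u\<bar> * bias_factor (h n) (d n) u) + \<bar>c n - 1\<bar> * G)"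
  have "\<delta> \<longlonglongrightarrow> 1 * 0 + \<bar>1 - 1\<bar> * G"
    unfolding \<delta>_def
    by (intro tendsto_add tendsto_mult tendsto_rabs tendsto_diff tendsto_const c_lim
        bias_tendsto_zero[OF k0 d h hd \<gamma>])
  then have \<delta>_lim: "\<delta> \<longlonglongrightarrow> 0" by simp
  obtain c1 where c1: "\<forall>\<^sub>F n in sequentially. norm (fst (h n)) \<le> c1 * norm (snd (h n))"
    using asymp(1) by (auto elim: landau_o.bigE)
  obtain c2 where c2: "\<forall>\<^sub>F n in sequentially. norm (snd (h n)) \<le> c2 * norm (fst (h n))"
    using asymp(2) by (auto elim: landau_o.bigE)
  define q where "q = max 1 (max c1 c2)"
  define m where "m = 4 * g 0 + 4 * mass * q"
  have m0: "m \<ge> 0" unfolding m_def q_def by (intro add_nonneg_nonneg mult_nonneg_nonneg nonneg mass_nonneg) auto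
  define C where "C = 4 * m + 2"
  have C0: "C > 0" using m0 by (simp add: C_def)
  have pos: "0 < x \<and> 0 < n" if "1 \<le> x * real n" for x n
  proof -
    have "0 < x * real n" using that by linarith
    then show ?thesis by (simp add: zero_less_mult_iff)
  qed
  have "\<forall>\<^sub>F n in sequentially. 1 \<le> fst (h n) * real (fst (d n)) \<and> 1 \<le> snd (h n) * real (snd (d n))"
    using hd by (intro eventually_conj) (simp_all add: filterlim_at_top)
  then have ev_pos: "\<forall>\<^sub>F n in sequentially. 0 < fst (h n) \<and> 0 < snd (h n) \<and> 0 < fst (d n) \<and> 0 < snd (d n)"
    by eventually_elim (use pos in blast)
  have ev_small: "\<forall>\<^sub>F n in sequentially. fst (h n) < 1 \<and> snd (h n) < 1"
    using order_tendstoD(2)[OF h(1), of 1] order_tendstoD(2)[OF h(2), of 1] by (intro eventually_conj) auto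
  have ev_lattice: "\<forall>\<^sub>F n in sequentially.
      4 * g 0 + 4 * mass / (min (fst (h n)) (snd (h n)))\<^sup>2 \<le> m / prod_abs (h n)"
    using ev_pos ev_small c1 c2
  proof eventually_elim
    case (elim n)
    let ?a = "fst (h n)" and ?b = "snd (h n)"
    have ab: "?a > 0" "?b > 0" "?a < 1" "?b < 1" using elim by auto
    have q: "?a \<le> q * ?b" "?b \<le> q * ?a"
      using elim mult_right_mono[of c1 q ?b] mult_right_mono[of c2 q ?a] ab
      by (auto simp: q_def intro: order_trans)
    have pq: "prod_abs (h n) \<le> q * (min ?a ?b)\<^sup>2"
    proof (cases "?a \<le> ?b")
      case True
      have "?a * ?b \<le> ?a * (q * ?a)" using q ab by (intro mult_left_mono) auto
      then show ?thesis using True ab by (simp add: prod_abs_def power2_eq_square mult_ac)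
    next
      case False
      have "?b * ?a \<le> ?b * (q * ?b)" using q ab by (intro mult_left_mono) auto
      then show ?thesis using False ab by (simp add: prod_abs_def power2_eq_square mult_ac)
    qed
    have p: "0 < prod_abs (h n)" "prod_abs (h n) \<le> 1"
      using ab mult_mono[of ?a 1 ?b 1] by (auto simp: prod_abs_def)
    have "4 * g 0 \<le> 4 * g 0 / prod_abs (h n)"
      using p nonneg[of 0] by (simp add: le_divide_eq mult_left_le)
    moreover have "4 * mass / (min ?a ?b)\<^sup>2 \<le> 4 * mass * q / prod_abs (h n)"
    proof -
      have t: "0 < (min ?a ?b)\<^sup>2" using ab by simp
      have "4 * mass * prod_abs (h n) \<le> 4 * mass * (q * (min ?a ?b)\<^sup>2)"
        using pq mass_nonneg by (intro mult_left_mono) auto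
      then show ?thesis using p t by (simp add: divide_le_eq le_divide_eq mult_ac)
    qed
    ultimately show ?case by (simp add: m_def add_divide_distrib)
  qed
  have ev_c: "\<forall>\<^sub>F n in sequentially. 0 < c n \<and> c n < 2"
    using order_tendstoD(1)[OF c_lim, of 0] order_tendstoD(2)[OF c_lim, of 2] by (intro eventually_conj) auto
  have ev_abs: "\<forall>\<^sub>F n in sequentially. 0 < prod_abs (h n)"
    using ev_pos by eventually_elim (simp add: prod_abs_def)
  have ev_sum: "\<forall>\<^sub>F n in sequentially. (\<Sum>u\<in>lags (d n). coset_mass (fst (h n)) (snd (h n)) (d n) u) \<le> C / prod_abs (h n)"
    using ev_pos ev_lattice ev_abs
  proof eventually_elim
    case (elim n)
    have "(\<Sum>u\<in>lags (d n). coset_mass (fst (h n)) (snd (h n)) (d n) u)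
        \<le> 4 * (4 * g 0 + 4 * mass / (min (fst (h n)) (snd (h n)))\<^sup>2)"
      by (rule sum_coset_mass_le) (use elim in auto)
    also have "\<dots> \<le> 4 * (m / prod_abs (h n))" using elim by simp
    also have "\<dots> \<le> C / prod_abs (h n)" using elim by (simp add: C_def divide_right_mono)
    finally show ?case .
  qed
  have ev_dev: "\<forall>\<^sub>F n in sequentially. \<forall>v l. \<bar>spec_est K (h n) (d n) v l - f l\<bar> \<le>
        C * (\<Sum>u\<in>lags (d n). \<bar>sample_autocov \<mu> (d n) v u - \<gamma> u * lag_fraction (d n) u\<bar>
              * coset_mass (fst (h n)) (snd (h n)) (d n) u)
        + C / (prod_abs (h n) * obs_size (d n)) * mean_periodogram \<mu> (d n) v + \<delta> n"
    using ev_pos ev_lattice ev_abs ev_c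
  proof eventually_elim
    case (elim n)
    show ?case
    proof (intro allI)
      fix v l
      let ?S = "\<Sum>u\<in>lags (d n). \<bar>sample_autocov \<mu> (d n) v u - \<gamma> u * lag_fraction (d n) u\<bar>
              * coset_mass (fst (h n)) (snd (h n)) (d n) u"
      let ?W = "infsum (lattice_value (fst (h n)) (snd (h n))) UNIV"
      let ?J = "mean_periodogram \<mu> (d n) v"
      let ?B = "\<Sum>\<^sub>\<infinity>u. \<bar>\<gamma> u\<bar> * bias_factor (h n) (d n) u"
      have T: "obs_size (d n) > 0" using elim by (simp add: obs_size_def)
      have J0: "0 \<le> ?J" using T by (simp add: mean_periodogram_def)
      have S0: "0 \<le> ?S" by (intro sum_nonneg mult_nonneg_nonneg coset_mass_nonneg) auto
      have N: "normalization (h n) (d n) > 0"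
      proof (rule ccontr)
        assume "\<not> ?thesis"
        then have "c n \<le> 0" unfolding c_def using elim T
          by (intro divide_nonneg_nonpos mult_nonneg_nonpos) auto
        with elim show False by simp
      qed
      have W: "?W \<le> m / prod_abs (h n)"
        using lattice_value_infsum[of "min (fst (h n)) (snd (h n))" "fst (h n)" "snd (h n)" UNIV] elim by auto
      have "\<bar>spec_est K (h n) (d n) v l - f l\<bar> \<le> c n * (?S + ?W * ?J / obs_size (d n) + ?B) + \<bar>c n - 1\<bar> * G"
        using deviation_bound[OF _ _ _ _ N \<gamma> f, of v l \<mu>] elim by (simp only: c_def G_def)
      also have "\<dots> = c n * ?S + c n * (?W * ?J / obs_size (d n)) + \<delta> n"
        by (simp add: \<delta>_def algebra_simps)
      also have "c n * ?S \<le> C * ?S"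
        using elim m0 S0 by (intro mult_right_mono) (auto simp: C_def)
      also have "c n * (?W * ?J / obs_size (d n)) \<le> C * (1 / prod_abs (h n) * ?J / obs_size (d n))"
      proof -
        have "?W * ?J / obs_size (d n) \<le> m / prod_abs (h n) * ?J / obs_size (d n)"
          using W J0 T by (intro divide_right_mono mult_right_mono) auto
        then have "c n * (?W * ?J / obs_size (d n)) \<le> 2 * (m / prod_abs (h n) * ?J / obs_size (d n))"
          using elim J0 T m0 by (intro order_trans[OF mult_left_mono mult_right_mono]) auto
        also have "\<dots> = (2 * m) * (1 / prod_abs (h n) * ?J / obs_size (d n))" by simp
        also have "\<dots> \<le> C * (1 / prod_abs (h n) * ?J / obs_size (d n))"
          using elim J0 T m0 by (intro mult_right_mono) (auto simp: C_def)
        finally show ?thesis .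
      qed
      finally show "\<bar>spec_est K (h n) (d n) v l - f l\<bar> \<le> C * ?S
          + C / (prod_abs (h n) * obs_size (d n)) * ?J + \<delta> n" by simp
    qed
  qed
  show thesis by (rule that[OF C0 \<delta>_lim ev_dev ev_sum ev_abs])
qed

end

section \<open>Convergence in probability\<close>

lemma conv_in_prob_add:
  assumes "prob_space M" "conv_in_prob M X 0" "conv_in_prob M Y 0"
  shows "conv_in_prob M (\<lambda>n \<omega>. X n \<omega> + Y n \<omega>) 0"
  unfolding conv_in_prob_def
proof (intro allI impI)
  interpret prob_space M by fact
  fix e :: real assume "e > 0"
  then have e: "e / 2 > 0" by simp
  obtain A where A: "\<And>n. A n \<in> sets M \<and> {\<omega> \<in> space M. \<bar>X n \<omega> - 0\<bar> > e / 2} \<subseteq> A n" "(\<lambda>n. measure M (A n)) \<longlonglongrightarrow> 0"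
    using assms(2) e unfolding conv_in_prob_def by blast
  obtain B where B: "\<And>n. B n \<in> sets M \<and> {\<omega> \<in> space M. \<bar>Y n \<omega> - 0\<bar> > e / 2} \<subseteq> B n" "(\<lambda>n. measure M (B n)) \<longlonglongrightarrow> 0"
    using assms(3) e unfolding conv_in_prob_def by blast
  have sub: "{\<omega> \<in> space M. \<bar>X n \<omega> + Y n \<omega> - 0\<bar> > e} \<subseteq> A n \<union> B n" for n
  proof
    fix \<omega> assume w: "\<omega> \<in> {\<omega> \<in> space M. \<bar>X n \<omega> + Y n \<omega> - 0\<bar> > e}"
    then have "\<bar>X n \<omega> - 0\<bar> > e / 2 \<or> \<bar>Y n \<omega> - 0\<bar> > e / 2" by (auto; arith)
    with w A(1)[of n] B(1)[of n] show "\<omega> \<in> A n \<union> B n" by blast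
  qed
  have "(\<lambda>n. measure M (A n \<union> B n)) \<longlonglongrightarrow> 0"
  proof (rule tendsto_sandwich[where f = "\<lambda>_. 0" and h = "\<lambda>n. measure M (A n) + measure M (B n)"])
    show "(\<lambda>n. measure M (A n) + measure M (B n)) \<longlonglongrightarrow> 0"
      using tendsto_add[OF A(2) B(2)] by simp
    show "\<forall>\<^sub>F n in sequentially. measure M (A n \<union> B n) \<le> measure M (A n) + measure M (B n)"
      using A(1) B(1) by (intro always_eventually allI measure_Un_le) auto
  qed auto
  then show "\<exists>A. (\<forall>n. A n \<in> sets M \<and> {\<omega> \<in> space M. \<bar>X n \<omega> + Y n \<omega> - 0\<bar> > e} \<subseteq> A n)
      \<and> (\<lambda>n. measure M (A n)) \<longlonglongrightarrow> 0"
    using A(1) B(1) sub by (intro exI[of _ "\<lambda>n. A n \<union> B n"]) auto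
qed

lemma conv_in_prob_dominated:
  assumes "conv_in_prob M Y 0"
    and "\<forall>\<^sub>F n in sequentially. \<forall>\<omega>\<in>space M. \<bar>X n \<omega>\<bar> \<le> \<bar>Y n \<omega>\<bar>"
  shows "conv_in_prob M X 0"
  unfolding conv_in_prob_def
proof (intro allI impI)
  fix e :: real assume "e > 0"
  then obtain A where A: "\<And>n. A n \<in> sets M \<and> {\<omega> \<in> space M. \<bar>Y n \<omega> - 0\<bar> > e} \<subseteq> A n" "(\<lambda>n. measure M (A n)) \<longlonglongrightarrow> 0"
    using assms(1) unfolding conv_in_prob_def by blast
  obtain N where N: "\<And>n \<omega>. n \<ge> N \<Longrightarrow> \<omega> \<in> space M \<Longrightarrow> \<bar>X n \<omega>\<bar> \<le> \<bar>Y n \<omega>\<bar>"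
    using assms(2) by (auto simp: eventually_sequentially)
  let ?B = "\<lambda>n. if n \<ge> N then A n else space M"
  have "\<forall>\<^sub>F n in sequentially. measure M (A n) = measure M (?B n)"
    using eventually_ge_at_top[of N] by eventually_elim simp
  from Lim_transform_eventually[OF A(2) this] have "(\<lambda>n. measure M (?B n)) \<longlonglongrightarrow> 0" .
  moreover have "?B n \<in> sets M \<and> {\<omega> \<in> space M. \<bar>X n \<omega> - 0\<bar> > e} \<subseteq> ?B n" for n
    using A(1)[of n] N[of n] by (fastforce intro: less_le_trans)
  ultimately show "\<exists>A. (\<forall>n. A n \<in> sets M \<and> {\<omega> \<in> space M. \<bar>X n \<omega> - 0\<bar> > e} \<subseteq> A n)
      \<and> (\<lambda>n. measure M (A n)) \<longlonglongrightarrow> 0"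
    by (intro exI[of _ ?B]) auto
qed

lemma conv_in_prob_const:
  assumes "a \<longlonglongrightarrow> 0"
  shows "conv_in_prob M (\<lambda>n _. a n) 0"
  unfolding conv_in_prob_def
proof (intro allI impI)
  fix e :: real assume "e > 0"
  let ?B = "\<lambda>n. if \<bar>a n\<bar> > e then space M else {}"
  have "\<forall>\<^sub>F n in sequentially. \<bar>a n\<bar> < e"
    using assms \<open>e > 0\<close> by (auto dest: tendstoD)
  then have "\<forall>\<^sub>F n in sequentially. 0 = measure M (?B n)" by eventually_elim auto
  from Lim_transform_eventually[OF tendsto_const this] have "(\<lambda>n. measure M (?B n)) \<longlonglongrightarrow> 0" .
  then show "\<exists>A. (\<forall>n. A n \<in> sets M \<and> {\<omega> \<in> space M. \<bar>a n - 0\<bar> > e} \<subseteq> A n)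
      \<and> (\<lambda>n. measure M (A n)) \<longlonglongrightarrow> 0"
    by (intro exI[of _ ?B]) auto
qed

text \<open>Markov's inequality.\<close>

lemma conv_in_prob_L1:
  assumes int: "\<And>n. integrable M (Y n)" and nn: "\<And>n \<omega>. 0 \<le> Y n \<omega>"
    and lim: "(\<lambda>n. \<integral>\<omega>. Y n \<omega> \<partial>M) \<longlonglongrightarrow> 0"
  shows "conv_in_prob M Y 0"
  unfolding conv_in_prob_def
proof (intro allI impI)
  fix e :: real assume e: "e > 0"
  let ?A = "\<lambda>n. {\<omega> \<in> space M. e \<le> Y n \<omega>}"
  have meas [measurable]: "Y n \<in> borel_measurable M" for n using int by auto
  have "(\<lambda>n. measure M (?A n)) \<longlonglongrightarrow> 0"
  proof (rule tendsto_sandwich[where f = "\<lambda>_. 0" and h = "\<lambda>n. (\<integral>\<omega>. Y n \<omega> \<partial>M) / e"])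
    show "(\<lambda>n. (\<integral>\<omega>. Y n \<omega> \<partial>M) / e) \<longlonglongrightarrow> 0"
      using tendsto_divide[OF lim tendsto_const[of e]] e by simp
    show "\<forall>\<^sub>F n in sequentially. measure M (?A n) \<le> (\<integral>\<omega>. Y n \<omega> \<partial>M) / e"
      by (intro always_eventually allI integral_Markov_inequality_measure[OF int sets.empty_sets])
        (use nn e in auto)
  qed auto
  moreover have "?A n \<in> sets M" for n by measurable
  ultimately show "\<exists>A. (\<forall>n. A n \<in> sets M \<and> {\<omega> \<in> space M. \<bar>Y n \<omega> - 0\<bar> > e} \<subseteq> A n)
      \<and> (\<lambda>n. measure M (A n)) \<longlonglongrightarrow> 0"
    using nn by (intro exI[of _ ?A]) auto
qed

lemma conv_in_prob_of_bigO_prob: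
  assumes "prob_space M" and O: "bigO_prob M Z a" and meas: "\<And>n. Z n \<in> borel_measurable M"
    and w: "\<And>n. 0 \<le> w n" and lim: "(\<lambda>n. a n * w n) \<longlonglongrightarrow> 0"
  shows "conv_in_prob M (\<lambda>n \<omega>. Z n \<omega> * w n) 0"
  unfolding conv_in_prob_def
proof (intro allI impI)
  interpret prob_space M by fact
  note [measurable] = meas
  fix e :: real assume e: "e > 0"
  let ?A = "\<lambda>n. {\<omega> \<in> space M. \<bar>Z n \<omega> * w n - 0\<bar> > e}"
  have "(\<lambda>n. measure M (?A n)) \<longlonglongrightarrow> 0"
  proof (rule tendstoI)
    fix \<epsilon> :: real assume "\<epsilon> > 0"
    then obtain C where C: "C > 0" "\<forall>\<^sub>F n in sequentially. measure M {\<omega> \<in> space M. \<bar>Z n \<omega>\<bar> > C * a n} < \<epsilon>"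
      using O unfolding bigO_prob_def by blast
    have "(\<lambda>n. C * (a n * w n)) \<longlonglongrightarrow> C * 0" by (intro tendsto_mult tendsto_const lim)
    then have "\<forall>\<^sub>F n in sequentially. C * (a n * w n) < e"
      using e by (intro order_tendstoD(2)) auto
    with C(2) show "\<forall>\<^sub>F n in sequentially. dist (measure M (?A n)) 0 < \<epsilon>"
    proof eventually_elim
      case (elim n)
      have "?A n \<subseteq> {\<omega> \<in> space M. \<bar>Z n \<omega>\<bar> > C * a n}"
      proof
        fix \<omega> assume \<omega>: "\<omega> \<in> ?A n"
        have "\<not> \<bar>Z n \<omega>\<bar> \<le> C * a n"
        proof
          assume "\<bar>Z n \<omega>\<bar> \<le> C * a n"
          then have "\<bar>Z n \<omega>\<bar> * w n \<le> C * a n * w n" using w by (intro mult_right_mono)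
          with \<omega> elim w[of n] show False by (simp add: abs_mult mult.assoc)
        qed
        with \<omega> show "\<omega> \<in> {\<omega> \<in> space M. \<bar>Z n \<omega>\<bar> > C * a n}" by simp
      qed
      then have "measure M (?A n) \<le> measure M {\<omega> \<in> space M. \<bar>Z n \<omega>\<bar> > C * a n}"
        by (intro finite_measure_mono) auto
      with elim show ?case by simp
    qed
  qed
  moreover have "?A n \<in> sets M" for n by measurable
  ultimately show "\<exists>A. (\<forall>n. A n \<in> sets M \<and> {\<omega> \<in> space M. \<bar>Z n \<omega> * w n - 0\<bar> > e} \<subseteq> A n)
      \<and> (\<lambda>n. measure M (A n)) \<longlonglongrightarrow> 0"
    by (intro exI[of _ ?A]) auto
qed

lemma abs_SUP_le:
  fixes F :: "'a \<Rightarrow> real"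
  assumes "I \<noteq> {}" and "\<And>i. i \<in> I \<Longrightarrow> 0 \<le> F i \<and> F i \<le> B"
  shows "\<bar>SUP i\<in>I. F i\<bar> \<le> B"
proof -
  obtain i where i: "i \<in> I" using assms(1) by auto
  have "F i \<le> (SUP i\<in>I. F i)"
    using assms(2) by (intro cSUP_upper i bdd_aboveI2[where M = B]) auto
  then have "0 \<le> (SUP i\<in>I. F i)" using assms(2)[OF i] by linarith
  moreover have "(SUP i\<in>I. F i) \<le> B" using assms by (intro cSUP_least) auto
  ultimately show ?thesis by simp
qed

section \<open>Sample autocovariances of a stationary field\<close>

locale stationary_field = prob_space M for M :: "'w measure" +
  fixes V :: "int \<times> int \<Rightarrow> 'w \<Rightarrow> real" and \<mu> :: real
  assumes stationary: "weakly_stationary M V" and mean: "(\<integral>\<omega>. V 0 \<omega> \<partial>M) = \<mu>"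
begin

lemma V_measurable [measurable]: "V t \<in> borel_measurable M"
  and V_square_integrable: "integrable M (\<lambda>\<omega>. (V t \<omega>)\<^sup>2)"
  and V_mean: "(\<integral>\<omega>. V t \<omega> \<partial>M) = \<mu>"
  using stationary mean unfolding weakly_stationary_def by (blast, blast, metis)

lemma V_integrable: "integrable M (V t)"
  by (rule square_integrable_imp_integrable) (auto intro: V_square_integrable)

lemma centred_product_integrable: "integrable M (\<lambda>\<omega>. (V s \<omega> - \<mu>) * (V t \<omega> - \<mu>))"
proof -
  have "integrable M (\<lambda>\<omega>. V s \<omega> * V t \<omega>)"
  proof (rule Bochner_Integration.integrable_bound)
    show "integrable M (\<lambda>\<omega>. (V s \<omega>)\<^sup>2 + (V t \<omega>)\<^sup>2)"
      by (intro Bochner_Integration.integrable_add V_square_integrable)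
    have "\<bar>x * y\<bar> \<le> x\<^sup>2 + y\<^sup>2" for x y :: real
      using sum_squares_bound[of "\<bar>x\<bar>" "\<bar>y\<bar>"] mult_nonneg_nonneg[OF abs_ge_zero abs_ge_zero, of x y]
      unfolding abs_mult power2_abs by linarith
    then show "AE \<omega> in M. norm (V s \<omega> * V t \<omega>) \<le> norm ((V s \<omega>)\<^sup>2 + (V t \<omega>)\<^sup>2)" by auto
  qed measurable
  then have "integrable M (\<lambda>\<omega>. V s \<omega> * V t \<omega> - \<mu> * V s \<omega> - \<mu> * V t \<omega> + \<mu> * \<mu>)"
    by (intro Bochner_Integration.integrable_add Bochner_Integration.integrable_diff integrable_mult_right V_integrable) auto
  then show ?thesis by (simp add: algebra_simps)
qed

lemma centred_product_expectation: "(\<integral>\<omega>. (V s \<omega> - \<mu>) * (V (s + u) \<omega> - \<mu>) \<partial>M) = autocov M V u"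
proof -
  have "cov M (V s) (V (s + u)) = autocov M V u"
    using stationary unfolding weakly_stationary_def autocov_def by blast
  then show ?thesis by (simp add: cov_def V_mean)
qed

lemma sample_autocov_integrable: "integrable M (\<lambda>\<omega>. sample_autocov \<mu> d (\<lambda>t. V t \<omega>) u)"
  unfolding sample_autocov_def
  by (intro integrable_divide_zero Bochner_Integration.integrable_sum centred_product_integrable)

lemma sample_autocov_measurable [measurable]:
  "(\<lambda>\<omega>. sample_autocov \<mu> d (\<lambda>t. V t \<omega>) u) \<in> borel_measurable M"
  using sample_autocov_integrable by auto

lemma sample_autocov_expectation:
  "(\<integral>\<omega>. sample_autocov \<mu> d (\<lambda>t. V t \<omega>) u \<partial>M) = autocov M V u * lag_fraction d u"
proof -
  have "(\<integral>\<omega>. sample_autocov \<mu> d (\<lambda>t. V t \<omega>) u \<partial>M)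
      = (\<Sum>j | j \<in> obs_region d \<and> j + u \<in> obs_region d. autocov M V u) / obs_size d"
    unfolding sample_autocov_def
    by (simp add: Bochner_Integration.integral_sum centred_product_integrable centred_product_expectation)
  then show ?thesis by (simp add: lag_fraction_def)
qed

lemma sample_autocov_outside: "u \<notin> lags d \<Longrightarrow> sample_autocov \<mu> d v u = 0"
proof -
  assume u: "u \<notin> lags d"
  have "u \<in> lags d" if "j \<in> obs_region d" "j + u \<in> obs_region d" for j
    unfolding lags_def by (rule image_eqI[of _ _ "(j + u, j)"]) (use that in auto)
  with u have "{j. j \<in> obs_region d \<and> j + u \<in> obs_region d} = {}" by auto
  then show ?thesis by (simp only: sample_autocov_def sum.empty div_0)
qed

definition autocov_noise :: "nat \<times> nat \<Rightarrow> 'w \<Rightarrow> int \<times> int \<Rightarrow> real" where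
  "autocov_noise d \<omega> u = \<bar>sample_autocov \<mu> d (\<lambda>t. V t \<omega>) u - autocov M V u * lag_fraction d u\<bar>"

lemma autocov_noise_bdd: "bdd_above (range (autocov_noise d \<omega>))"
proof (rule bdd_above_mono)
  show "bdd_above (insert 0 (autocov_noise d \<omega> ` lags d))" by simp
  show "range (autocov_noise d \<omega>) \<subseteq> insert 0 (autocov_noise d \<omega> ` lags d)"
  proof
    fix x assume "x \<in> range (autocov_noise d \<omega>)"
    then obtain u where x: "x = autocov_noise d \<omega> u" by blast
    show "x \<in> insert 0 (autocov_noise d \<omega> ` lags d)"
    proof (cases "u \<in> lags d")
      case False
      then show ?thesis by (simp add: x autocov_noise_def sample_autocov_outside lag_fraction_outside)
    qed (use x in blast)
  qed
qed

lemma sup_autocov_noise_measurable [measurable]: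
  "(\<lambda>\<omega>. SUP u. autocov_noise d \<omega> u) \<in> borel_measurable M"
proof (rule borel_measurable_cSUP)
  show "(\<lambda>\<omega>. autocov_noise d \<omega> u) \<in> borel_measurable M" for u
    unfolding autocov_noise_def by measurable
  show "bdd_above ((\<lambda>u. autocov_noise d \<omega> u) ` UNIV)" for \<omega> by (rule autocov_noise_bdd)
qed auto

lemma autocov_noise_le_sup: "autocov_noise d \<omega> u \<le> (SUP u. autocov_noise d \<omega> u)"
  by (rule cSUP_upper[OF UNIV_I autocov_noise_bdd])

lemma mean_periodogram_integrable: "integrable M (\<lambda>\<omega>. mean_periodogram \<mu> d (\<lambda>t. V t \<omega>))"
  unfolding mean_periodogram_def power2_eq_square sum_product
  by (intro integrable_divide_zero Bochner_Integration.integrable_sum centred_product_integrable)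

text \<open>The number of observations times the variance of the sample mean is at most \<open>\<Sum>\<^sub>u |\<gamma>(u)|\<close>.\<close>

lemma mean_periodogram_expectation_le:
  assumes d: "fst d > 0" "snd d > 0" and \<gamma>: "(\<lambda>u. \<bar>autocov M V u\<bar>) summable_on UNIV"
  shows "(\<integral>\<omega>. mean_periodogram \<mu> d (\<lambda>t. V t \<omega>) \<partial>M) \<le> (\<Sum>\<^sub>\<infinity>u. \<bar>autocov M V u\<bar>)"
proof -
  let ?T = "obs_region d" and ?G = "\<Sum>\<^sub>\<infinity>u. \<bar>autocov M V u\<bar>"
  have T: "obs_size d > 0" using d by (simp add: obs_size_def)
  have "(\<integral>\<omega>. mean_periodogram \<mu> d (\<lambda>t. V t \<omega>) \<partial>M)
      = (\<Sum>s\<in>?T. \<Sum>t\<in>?T. \<integral>\<omega>. (V s \<omega> - \<mu>) * (V t \<omega> - \<mu>) \<partial>M) / obs_size d"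
    unfolding mean_periodogram_def power2_eq_square sum_product
    by (simp add: Bochner_Integration.integral_sum centred_product_integrable)
  also have "\<dots> = (\<Sum>s\<in>?T. \<Sum>t\<in>?T. autocov M V (t - s)) / obs_size d"
  proof -
    have "(\<integral>\<omega>. (V s \<omega> - \<mu>) * (V t \<omega> - \<mu>) \<partial>M) = autocov M V (t - s)" for s t
      using centred_product_expectation[of s "t - s"] by simp
    then show ?thesis by (simp only:)
  qed
  also have "\<dots> \<le> (\<Sum>s\<in>?T. ?G) / obs_size d"
  proof (intro divide_right_mono sum_mono)
    fix s
    have "(\<Sum>t\<in>?T. autocov M V (t - s)) \<le> (\<Sum>t\<in>?T. \<bar>autocov M V (t - s)\<bar>)" by (intro sum_mono) auto
    also have "\<dots> = (\<Sum>u\<in>(\<lambda>t. t - s) ` ?T. \<bar>autocov M V u\<bar>)"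
      by (subst sum.reindex) (auto simp: inj_on_def)
    also have "\<dots> \<le> ?G" by (intro finite_sum_le_infsum \<gamma>) auto
    finally show "(\<Sum>t\<in>?T. autocov M V (t - s)) \<le> ?G" .
  qed (use T in auto)
  also have "\<dots> = ?G" using d by (simp add: obs_region_def obs_size_def)
  finally show ?thesis .
qed

end

section \<open>Fields driven by independent innovations\<close>

lemma abs_prod4_le:
  fixes x y z w :: real
  shows "\<bar>x * y * z * w\<bar> \<le> (x ^ 4 + y ^ 4 + z ^ 4 + w ^ 4) / 4"
proof -
  have two: "\<bar>u * v\<bar> \<le> (u\<^sup>2 + v\<^sup>2) / 2" for u v :: real
    using sum_squares_bound[of "\<bar>u\<bar>" "\<bar>v\<bar>"] by (simp add: abs_mult)
  have sq: "(u * v)\<^sup>2 \<le> (u ^ 4 + v ^ 4) / 2" for u v :: real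
    using two[of "u\<^sup>2" "v\<^sup>2"] by (simp add: power_mult_distrib power_mult[symmetric])
  have "\<bar>x * y * z * w\<bar> = \<bar>(x * y) * (z * w)\<bar>" by (simp add: mult.assoc)
  also have "\<dots> \<le> ((x * y)\<^sup>2 + (z * w)\<^sup>2) / 2" by (rule two)
  also have "\<dots> \<le> (x ^ 4 + y ^ 4 + z ^ 4 + w ^ 4) / 4" using sq[of x y] sq[of z w] by simp
  finally show ?thesis .
qed

text \<open>A substitute for Hoelder's inequality with four factors: if \<open>x\<close> has fourth moment \<open>\<eta>\<^sup>4\<close> and the other
factors have bounded fourth moments, integrating this bound shows that the product is of order \<open>\<eta>\<close>
in mean.\<close>

lemma abs_prod4_small_factor:
  fixes x y z w :: real
  assumes "\<eta> > 0"
  shows "\<bar>x * y * z * w\<bar> \<le> \<eta> / 4 * (x ^ 4 / \<eta> ^ 4 + y ^ 4 + z ^ 4 + w ^ 4)"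
proof -
  have "x * y * z * w = \<eta> * ((x / \<eta>) * y * z * w)" using assms by simp
  then have "\<bar>x * y * z * w\<bar> = \<eta> * \<bar>(x / \<eta>) * y * z * w\<bar>"
    using assms by (simp only: abs_mult[of \<eta>] abs_of_pos)
  also have "\<dots> \<le> \<eta> * (((x / \<eta>) ^ 4 + y ^ 4 + z ^ 4 + w ^ 4) / 4)"
    using assms by (intro mult_left_mono abs_prod4_le) auto
  finally show ?thesis by (simp add: power_divide)
qed

lemma diff_power4_le: "(a - b) ^ 4 \<le> 8 * (a ^ 4 + b ^ 4)" for a b :: real
proof -
  have sq: "(u - v)\<^sup>2 \<le> 2 * (u\<^sup>2 + v\<^sup>2)" for u v :: real
    using zero_le_power2[of "u + v"] by (simp add: power2_eq_square algebra_simps)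
  have sq': "(u + v)\<^sup>2 \<le> 2 * (u\<^sup>2 + v\<^sup>2)" for u v :: real
    using zero_le_power2[of "u - v"] by (simp add: power2_eq_square algebra_simps)
  have "(a - b) ^ 4 = ((a - b)\<^sup>2)\<^sup>2" by (simp add: power_mult[symmetric])
  also have "\<dots> \<le> (2 * (a\<^sup>2 + b\<^sup>2))\<^sup>2" by (intro power_mono sq) auto
  also have "\<dots> = 4 * (a\<^sup>2 + b\<^sup>2)\<^sup>2" by (simp only: power_mult_distrib) simp
  also have "\<dots> \<le> 4 * (2 * ((a\<^sup>2)\<^sup>2 + (b\<^sup>2)\<^sup>2))" by (intro mult_left_mono sq') auto
  finally show ?thesis by (simp add: power_mult[symmetric])
qed

lemma (in prob_space) expectation_power4_le:
  fixes f :: "'a \<Rightarrow> real"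
  assumes [measurable]: "f \<in> borel_measurable M" and f4: "integrable M (\<lambda>x. f x ^ 4)"
  shows "integrable M f" and "(expectation f) ^ 4 \<le> expectation (\<lambda>x. f x ^ 4)"
proof -
  have f2: "integrable M (\<lambda>x. (f x)\<^sup>2)"
    by (rule square_integrable_imp_integrable) (use f4 in \<open>auto simp: power_mult[symmetric]\<close>)
  show f1: "integrable M f"
    by (rule square_integrable_imp_integrable) (use f2 in auto)
  have jensen: "(expectation h)\<^sup>2 \<le> expectation (\<lambda>x. (h x)\<^sup>2)"
    if "integrable M h" "integrable M (\<lambda>x. (h x)\<^sup>2)" for h :: "'a \<Rightarrow> real"
    using variance_eq[OF that] variance_positive[of h] by simp
  have "(expectation f) ^ 4 = ((expectation f)\<^sup>2)\<^sup>2" by (simp add: power_mult[symmetric])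
  also have "\<dots> \<le> (expectation (\<lambda>x. (f x)\<^sup>2))\<^sup>2" by (intro power_mono jensen f1 f2) auto
  also have "\<dots> \<le> expectation (\<lambda>x. ((f x)\<^sup>2)\<^sup>2)"
    by (rule jensen[OF f2]) (use f4 in \<open>simp add: power_mult[symmetric]\<close>)
  finally show "(expectation f) ^ 4 \<le> expectation (\<lambda>x. f x ^ 4)" by (simp add: power_mult[symmetric])
qed

locale bernoulli_field = stationary_field M V \<mu> for M :: "'w measure" and V \<mu> +
  fixes S :: "'e measure" and G :: "(int \<times> int \<Rightarrow> 'e) \<Rightarrow> real"
    and \<epsilon> \<epsilon>' :: "int \<times> int \<Rightarrow> 'w \<Rightarrow> 'e"
  assumes iid: "iid_with_copy M S \<epsilon> \<epsilon>'" and shift: "bernoulli_shift M S V \<mu> G \<epsilon>"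
begin

definition innovation :: "(int \<times> int) + (int \<times> int) \<Rightarrow> 'w \<Rightarrow> 'e" where
  "innovation = case_sum \<epsilon> \<epsilon>'"

abbreviation paths :: "(int \<times> int \<Rightarrow> 'e) measure" where "paths \<equiv> PiM UNIV (\<lambda>_. S)"

definition innovation_law :: "'e measure" where "innovation_law = distr M S (\<epsilon> 0)"

definition path_law :: "(int \<times> int \<Rightarrow> 'e) measure" where
  "path_law = PiM UNIV (\<lambda>_. innovation_law)"

lemma innovation_indep: "indep_vars (\<lambda>_. S) innovation UNIV"
  using iid by (simp add: iid_with_copy_def innovation_def)

lemma innovation_measurable [measurable]: "innovation i \<in> M \<rightarrow>\<^sub>M S"
  using innovation_indep by (auto simp: indep_vars_def)

lemma innovation_distr: "distr M S (innovation i) = innovation_law"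
  using iid unfolding iid_with_copy_def innovation_law_def innovation_def
  by (cases i; simp only: sum.case; blast)

lemma innovation_law_prob: "prob_space innovation_law"
  unfolding innovation_law_def
  using innovation_measurable[of "Inl 0"] by (intro prob_space_distr) (simp add: innovation_def)

lemma innovation_law_sets [measurable_cong]: "sets innovation_law = sets S"
  by (simp add: innovation_law_def)

lemma path_law_sets [measurable_cong]: "sets path_law = sets paths"
  unfolding path_law_def by (intro sets_PiM_cong) (auto simp: innovation_law_sets)

lemma path_law_prob: "prob_space path_law"
  unfolding path_law_def by (intro prob_space_PiM innovation_law_prob)

lemma G_measurable [measurable]: "G \<in> borel_measurable paths"
  using shift by (simp add: bernoulli_shift_def)

lemma select_measurable [measurable]: "(\<lambda>\<omega> s. innovation (t s) \<omega>) \<in> M \<rightarrow>\<^sub>M paths"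
  by (rule measurable_PiM_single') (auto simp: PiE_def dest: measurable_space[OF innovation_measurable])

text \<open>Any injective choice of coordinates from the two i.i.d. families has the law of the first family.
Shifted fields and partially replaced fields are all of this form.\<close>

lemma select_law:
  assumes "inj t"
  shows "distr M paths (\<lambda>\<omega> s. innovation (t s) \<omega>) = path_law"
proof -
  let ?L = "PiM UNIV (\<lambda>_ :: (int \<times> int) + (int \<times> int). innovation_law)"
  have full: "distr M (PiM UNIV (\<lambda>_. S)) (\<lambda>\<omega> i. innovation i \<omega>) = ?L"
    using innovation_indep indep_vars_iff_distr_eq_PiM[where I = UNIV and M' = "\<lambda>_. S" and X = innovation]
    by (simp add: innovation_distr restrict_UNIV)
  have [measurable]: "(\<lambda>\<omega> i. innovation i \<omega>) \<in> M \<rightarrow>\<^sub>M PiM UNIV (\<lambda>_. S)"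
    by (rule measurable_PiM_single') (auto simp: PiE_def dest: measurable_space[OF innovation_measurable])
  have re: "distr ?L path_law (\<lambda>x s. x (t s)) = path_law"
    using distr_PiM_reindex[of UNIV "\<lambda>_. innovation_law" t UNIV] assms innovation_law_prob
    by (simp add: path_law_def restrict_UNIV)
  have mt [measurable]: "(\<lambda>x s. x (t s)) \<in> PiM UNIV (\<lambda>_. S) \<rightarrow>\<^sub>M paths"
    by (rule measurable_PiM_single') (auto simp: space_PiM PiE_def)
  have "path_law = distr ?L path_law (\<lambda>x s. x (t s))" by (rule re[symmetric])
  also have "\<dots> = distr ?L paths (\<lambda>x s. x (t s))"
    by (rule distr_cong) (auto simp: path_law_sets)
  also have "\<dots> = distr M paths ((\<lambda>x s. x (t s)) \<circ> (\<lambda>\<omega> i. innovation i \<omega>))"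
    unfolding full[symmetric] by (rule distr_distr) measurable
  finally show ?thesis by (simp add: o_def)
qed

text \<open>The innovations as they are seen from the site \<open>b\<close>: the value of the field at \<open>b\<close> is a fixed function
of \<open>past b\<close>.\<close>

definition past :: "int \<times> int \<Rightarrow> 'w \<Rightarrow> int \<times> int \<Rightarrow> 'e" where
  "past b \<omega> s = \<epsilon> (b - s) \<omega>"

definition past_copy :: "int \<times> int \<Rightarrow> 'w \<Rightarrow> int \<times> int \<Rightarrow> 'e" where
  "past_copy b \<omega> s = \<epsilon>' (b - s) \<omega>"

lemma past_select: "past b = (\<lambda>\<omega> s. innovation (Inl (b - s)) \<omega>)"
  and past_copy_select: "past_copy b = (\<lambda>\<omega> s. innovation (Inr (b - s)) \<omega>)"
  by (auto simp: past_def past_copy_def innovation_def fun_eq_iff)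

lemma past_measurable [measurable]: "past b \<in> M \<rightarrow>\<^sub>M paths" "past_copy b \<in> M \<rightarrow>\<^sub>M paths"
  unfolding past_select past_copy_select by measurable

lemma past_law: "distr M paths (past b) = path_law"
  unfolding past_select by (rule select_law) (auto simp: inj_on_def)

lemma past_copy_law: "distr M paths (past_copy b) = path_law"
  unfolding past_copy_select by (rule select_law) (auto simp: inj_on_def)

lemma past_pair_law: "distr M (paths \<Otimes>\<^sub>M paths) (\<lambda>\<omega>. (past b \<omega>, past_copy b \<omega>)) = path_law \<Otimes>\<^sub>M path_law"
proof -
  have ind: "indep_var (PiM (range Inl) (\<lambda>_. S)) (\<lambda>\<omega>. restrict (\<lambda>i. innovation i \<omega>) (range Inl))
      (PiM (range Inr) (\<lambda>_. S)) (\<lambda>\<omega>. restrict (\<lambda>i. innovation i \<omega>) (range Inr))"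
    by (rule indep_var_restrict[OF innovation_indep]) auto
  have "(\<lambda>x s. x (Inl (b - s))) \<in> PiM (range Inl) (\<lambda>_. S) \<rightarrow>\<^sub>M paths"
    "(\<lambda>x s. x (Inr (b - s))) \<in> PiM (range Inr) (\<lambda>_. S) \<rightarrow>\<^sub>M paths"
    by (rule measurable_PiM_single'; auto simp: space_PiM PiE_def Pi_def)+
  from indep_var_compose[OF ind this]
  have "indep_var paths (past b) paths (past_copy b)"
    by (simp add: o_def past_select past_copy_select)
  then show ?thesis
    by (simp add: indep_var_distribution_eq past_law past_copy_law)
qed

definition splice :: "nat \<Rightarrow> (int \<times> int \<Rightarrow> 'e) \<Rightarrow> (int \<times> int \<Rightarrow> 'e) \<Rightarrow> int \<times> int \<Rightarrow> 'e" where
  "splice n x y s = (if max_norm s < int n then x s else y s)"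

lemma splice_measurable [measurable]: "(\<lambda>(x, y). splice n x y) \<in> paths \<Otimes>\<^sub>M paths \<rightarrow>\<^sub>M paths"
  unfolding splice_def case_prod_beta
  by (rule measurable_PiM_single') (auto simp: space_PiM space_pair_measure PiE_def Pi_def)

definition shifted :: "int \<times> int \<Rightarrow> 'w \<Rightarrow> real" where
  "shifted b \<omega> = G (past b \<omega>)"

text \<open>The value at \<open>b\<close> after the innovations at distance \<open>n\<close> or more are replaced by their copies.\<close>

definition coupled :: "nat \<Rightarrow> int \<times> int \<Rightarrow> 'w \<Rightarrow> real" where
  "coupled n b \<omega> = G (splice n (past b \<omega>) (past_copy b \<omega>))"

text \<open>The conditional mean of \<open>G\<close> given the coordinates of norm below \<open>n\<close>. Unlike \<open>coupled\<close>, the variable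
\<open>local_approx n b\<close> built from it is a function of finitely many innovations only.\<close>

definition window_mean :: "nat \<Rightarrow> (int \<times> int \<Rightarrow> 'e) \<Rightarrow> real" where
  "window_mean n x = (\<integral>y. G (splice n x y) \<partial>path_law)"

definition local_approx :: "nat \<Rightarrow> int \<times> int \<Rightarrow> 'w \<Rightarrow> real" where
  "local_approx n b \<omega> = window_mean n (past b \<omega>)"

lemma V_eq_shifted: "AE \<omega> in M. V b \<omega> - \<mu> = shifted b \<omega>"
  using shift unfolding bernoulli_shift_def shifted_def past_def[abs_def] by blast

lemma G_splice_measurable [measurable]:
  "(\<lambda>(x, y). G (splice n x y)) \<in> borel_measurable (paths \<Otimes>\<^sub>M paths)"
proof -
  have "G \<circ> (\<lambda>(x, y). splice n x y) \<in> borel_measurable (paths \<Otimes>\<^sub>M paths)"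
    by (rule measurable_comp[OF splice_measurable G_measurable])
  then show ?thesis by (simp add: o_def case_prod_beta)
qed

lemma window_mean_measurable [measurable]: "window_mean n \<in> borel_measurable paths"
proof -
  interpret P: prob_space path_law by (rule path_law_prob)
  have "(\<lambda>x. \<integral>y. (\<lambda>(x, y). G (splice n x y)) (x, y) \<partial>path_law) \<in> borel_measurable paths"
    by (rule P.borel_measurable_lebesgue_integral) (use G_splice_measurable in \<open>simp cong: measurable_cong_sets add: path_law_sets\<close>)
  then show ?thesis by (simp add: window_mean_def[abs_def])
qed

lemma shifted_measurable [measurable]: "shifted b \<in> borel_measurable M"
  unfolding shifted_def[abs_def] by measurable

lemma pair_measurable [measurable]: "(\<lambda>\<omega>. (past b \<omega>, past_copy b \<omega>)) \<in> M \<rightarrow>\<^sub>M paths \<Otimes>\<^sub>M paths"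
  by measurable

lemma coupled_measurable [measurable]: "coupled n b \<in> borel_measurable M"
  using measurable_comp[OF pair_measurable[of b] G_splice_measurable[of n]]
  by (simp add: o_def coupled_def[abs_def])

lemma local_approx_measurable [measurable]: "local_approx n b \<in> borel_measurable M"
  unfolding local_approx_def[abs_def] by measurable

lemma coupled_law: "distr M borel (coupled n b) = distr M borel (shifted b)"
proof -
  let ?t = "\<lambda>s. if max_norm s < int n then Inl (b - s) else Inr (b - s)"
  have "inj ?t" by (auto simp: inj_on_def split: if_splits)
  then have "distr M paths (\<lambda>\<omega> s. innovation (?t s) \<omega>) = distr M paths (past b)"
    by (simp only: select_law past_law)
  then have "distr (distr M paths (\<lambda>\<omega> s. innovation (?t s) \<omega>)) borel G = distr (distr M paths (past b)) borel G"
    by simp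
  then have "distr M borel (\<lambda>\<omega>. G (\<lambda>s. innovation (?t s) \<omega>)) = distr M borel (\<lambda>\<omega>. G (past b \<omega>))"
    by (subst (asm) (1 2) distr_distr) (auto simp: o_def)
  moreover have "(\<lambda>s. innovation (?t s) \<omega>) = splice n (past b \<omega>) (past_copy b \<omega>)" for \<omega>
    by (auto simp: splice_def past_def past_copy_def innovation_def fun_eq_iff)
  ultimately show ?thesis by (simp only: coupled_def[abs_def] shifted_def[abs_def])
qed

lemma shifted_law: "distr M borel (shifted b) = distr M borel (shifted c)"
proof -
  have "distr (distr M paths (past b)) borel G = distr (distr M paths (past c)) borel G"
    by (simp only: past_law)
  then show ?thesis by (subst (asm) (1 2) distr_distr) (auto simp: o_def shifted_def[abs_def])
qed

text \<open>Write \<open>x, y\<close> for the innovations and their copies. Then \<open>G x - window_mean n x\<close> is the mean over \<open>y\<close>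
of \<open>G x - G (splice n x y)\<close>, and Jensen's inequality for the fourth power is integrated over \<open>x\<close>.\<close>

lemma local_approx_moment4:
  assumes int: "integrable M (\<lambda>\<omega>. (shifted b \<omega> - coupled n b \<omega>) ^ 4)"
  shows "integrable M (\<lambda>\<omega>. (shifted b \<omega> - local_approx n b \<omega>) ^ 4)"
    and "(\<integral>\<omega>. (shifted b \<omega> - local_approx n b \<omega>) ^ 4 \<partial>M) \<le> (\<integral>\<omega>. (shifted b \<omega> - coupled n b \<omega>) ^ 4 \<partial>M)"
proof -
  interpret P: prob_space path_law by (rule path_law_prob)
  interpret PP: pair_prob_space path_law path_law ..
  let ?H = "\<lambda>(x, y). (G x - G (splice n x y)) ^ 4"
  have H_meas: "?H \<in> borel_measurable (paths \<Otimes>\<^sub>M paths)"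
    using G_splice_measurable by (simp add: case_prod_beta) measurable
  have intH: "integrable (path_law \<Otimes>\<^sub>M path_law) ?H"
    unfolding past_pair_law[of b, symmetric]
    by (subst integrable_distr_eq[OF pair_measurable H_meas])
      (use int in \<open>simp add: shifted_def coupled_def\<close>)
  have eqH: "integral\<^sup>L (path_law \<Otimes>\<^sub>M path_law) ?H = (\<integral>\<omega>. (shifted b \<omega> - coupled n b \<omega>) ^ 4 \<partial>M)"
    unfolding past_pair_law[of b, symmetric]
    by (subst integral_distr[OF pair_measurable H_meas]) (simp add: shifted_def coupled_def)
  let ?I = "\<lambda>x. \<integral>y. ?H (x, y) \<partial>path_law"
  have intI: "integrable path_law ?I" by (rule PP.integrable_fst'[OF intH])
  have eqI: "integral\<^sup>L path_law ?I = integral\<^sup>L (path_law \<Otimes>\<^sub>M path_law) ?H"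
    by (rule PP.integral_fst'[OF intH])
  have AE_le: "AE x in path_law. (G x - window_mean n x) ^ 4 \<le> ?I x"
    using AE_space PP.AE_integrable_fst'[OF intH]
  proof eventually_elim
    case (elim x)
    have meas: "(\<lambda>y. G (splice n x y)) \<in> borel_measurable path_law"
    proof -
      have "x \<in> space paths"
        using elim(1) sets_eq_imp_space_eq[OF path_law_sets] by simp
      from measurable_compose[OF measurable_Pair1'[OF this] G_splice_measurable[of n]]
      have "(\<lambda>y. G (splice n x y)) \<in> borel_measurable paths" by simp
      then show ?thesis by (simp cong: measurable_cong_sets add: path_law_sets)
    qed
    have 1: "integrable path_law (\<lambda>y. G x - G (splice n x y))"
      "(\<integral>y. G x - G (splice n x y) \<partial>path_law) ^ 4 \<le> (\<integral>y. (G x - G (splice n x y)) ^ 4 \<partial>path_law)"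
      using P.expectation_power4_le[of "\<lambda>y. G x - G (splice n x y)"] meas elim(2) by auto
    have "integrable path_law (\<lambda>y. G (splice n x y))"
      using Bochner_Integration.integrable_diff[OF P.integrable_const[of "G x"] 1(1)] by simp
    then have "(\<integral>y. G x - G (splice n x y) \<partial>path_law) = G x - window_mean n x"
      by (simp add: window_mean_def P.prob_space)
    with 1(2) show ?case by simp
  qed
  have int4: "integrable path_law (\<lambda>x. (G x - window_mean n x) ^ 4)"
  proof (rule Bochner_Integration.integrable_bound[OF intI])
    show "AE x in path_law. norm ((G x - window_mean n x) ^ 4) \<le> norm (?I x)"
      using AE_le by eventually_elim (simp add: order_trans[OF _ abs_ge_self])
  qed measurable
  have "integrable (distr M paths (past b)) (\<lambda>x. (G x - window_mean n x) ^ 4)"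
    unfolding past_law by (rule int4)
  then show "integrable M (\<lambda>\<omega>. (shifted b \<omega> - local_approx n b \<omega>) ^ 4)"
    by (subst (asm) integrable_distr_eq) (auto simp: shifted_def local_approx_def)
  have "(\<integral>\<omega>. (shifted b \<omega> - local_approx n b \<omega>) ^ 4 \<partial>M)
      = integral\<^sup>L (distr M paths (past b)) (\<lambda>x. (G x - window_mean n x) ^ 4)"
    by (subst integral_distr) (auto simp: shifted_def local_approx_def)
  also have "\<dots> \<le> integral\<^sup>L path_law ?I"
    unfolding past_law by (rule integral_mono_AE[OF int4 intI AE_le])
  finally show "(\<integral>\<omega>. (shifted b \<omega> - local_approx n b \<omega>) ^ 4 \<partial>M) \<le> (\<integral>\<omega>. (shifted b \<omega> - coupled n b \<omega>) ^ 4 \<partial>M)"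
    by (simp only: eqI eqH)
qed

end

section \<open>Fourth moments and the contraction condition\<close>

context prob_space
begin

lemma product4_integrable:
  fixes x y z w :: "'a \<Rightarrow> real"
  assumes [measurable]: "x \<in> borel_measurable M" "y \<in> borel_measurable M" "z \<in> borel_measurable M" "w \<in> borel_measurable M"
    and int: "integrable M (\<lambda>\<omega>. x \<omega> ^ 4)" "integrable M (\<lambda>\<omega>. y \<omega> ^ 4)" "integrable M (\<lambda>\<omega>. z \<omega> ^ 4)" "integrable M (\<lambda>\<omega>. w \<omega> ^ 4)"
  shows "integrable M (\<lambda>\<omega>. x \<omega> * y \<omega> * z \<omega> * w \<omega>)"
proof (rule Bochner_Integration.integrable_bound)
  show "integrable M (\<lambda>\<omega>. (x \<omega> ^ 4 + y \<omega> ^ 4 + z \<omega> ^ 4 + w \<omega> ^ 4) / 4)"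
    using int by (intro integrable_divide_zero Bochner_Integration.integrable_add)
  show "AE \<omega> in M. norm (x \<omega> * y \<omega> * z \<omega> * w \<omega>) \<le> norm ((x \<omega> ^ 4 + y \<omega> ^ 4 + z \<omega> ^ 4 + w \<omega> ^ 4) / 4)"
    using abs_prod4_le unfolding real_norm_def by (intro AE_I2) (meson abs_ge_self order_trans)
qed measurable

lemma product4_small_factor:
  fixes x y z w :: "'a \<Rightarrow> real"
  assumes meas: "x \<in> borel_measurable M" "y \<in> borel_measurable M" "z \<in> borel_measurable M" "w \<in> borel_measurable M"
    and int: "integrable M (\<lambda>\<omega>. x \<omega> ^ 4)" "integrable M (\<lambda>\<omega>. y \<omega> ^ 4)" "integrable M (\<lambda>\<omega>. z \<omega> ^ 4)" "integrable M (\<lambda>\<omega>. w \<omega> ^ 4)"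
    and \<eta>: "\<eta> > 0" "(\<integral>\<omega>. x \<omega> ^ 4 \<partial>M) \<le> \<eta> ^ 4"
    and K: "(\<integral>\<omega>. y \<omega> ^ 4 \<partial>M) \<le> K" "(\<integral>\<omega>. z \<omega> ^ 4 \<partial>M) \<le> K" "(\<integral>\<omega>. w \<omega> ^ 4 \<partial>M) \<le> K"
  shows "\<bar>\<integral>\<omega>. x \<omega> * y \<omega> * z \<omega> * w \<omega> \<partial>M\<bar> \<le> \<eta> / 4 * (1 + 3 * K)"
proof -
  have "\<bar>\<integral>\<omega>. x \<omega> * y \<omega> * z \<omega> * w \<omega> \<partial>M\<bar> \<le> (\<integral>\<omega>. \<bar>x \<omega> * y \<omega> * z \<omega> * w \<omega>\<bar> \<partial>M)"
    by (rule integral_abs_bound)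
  also have "\<dots> \<le> (\<integral>\<omega>. \<eta> / 4 * (x \<omega> ^ 4 / \<eta> ^ 4 + y \<omega> ^ 4 + z \<omega> ^ 4 + w \<omega> ^ 4) \<partial>M)"
    by (intro integral_mono abs_prod4_small_factor \<eta> integrable_abs product4_integrable meas int
        integrable_mult_right Bochner_Integration.integrable_add integrable_divide_zero)
  also have "\<dots> = \<eta> / 4 * ((\<integral>\<omega>. x \<omega> ^ 4 \<partial>M) / \<eta> ^ 4 + (\<integral>\<omega>. y \<omega> ^ 4 \<partial>M) + (\<integral>\<omega>. z \<omega> ^ 4 \<partial>M) + (\<integral>\<omega>. w \<omega> ^ 4 \<partial>M))"
    using int by simp
  also have "\<dots> \<le> \<eta> / 4 * (1 + K + K + K)"
    using \<eta> K by (intro mult_left_mono add_mono) (auto simp: divide_le_eq_1)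
  also have "\<dots> = \<eta> / 4 * (1 + 3 * K)" by simp
  finally show ?thesis .
qed

lemma product4_perturbation:
  fixes x w :: "nat \<Rightarrow> 'a \<Rightarrow> real"
  assumes meas [measurable]: "\<And>i. x i \<in> borel_measurable M" "\<And>i. w i \<in> borel_measurable M"
    and int: "\<And>i. integrable M (\<lambda>\<omega>. x i \<omega> ^ 4)" "\<And>i. integrable M (\<lambda>\<omega>. w i \<omega> ^ 4)"
      "\<And>i. integrable M (\<lambda>\<omega>. (x i \<omega> - w i \<omega>) ^ 4)"
    and \<eta>: "\<eta> > 0" "\<And>i. (\<integral>\<omega>. (x i \<omega> - w i \<omega>) ^ 4 \<partial>M) \<le> \<eta> ^ 4"
    and K: "\<And>i. (\<integral>\<omega>. x i \<omega> ^ 4 \<partial>M) \<le> K" "\<And>i. (\<integral>\<omega>. w i \<omega> ^ 4 \<partial>M) \<le> K"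
  shows "\<bar>(\<integral>\<omega>. x 0 \<omega> * x 1 \<omega> * x 2 \<omega> * x 3 \<omega> \<partial>M) - (\<integral>\<omega>. w 0 \<omega> * w 1 \<omega> * w 2 \<omega> * w 3 \<omega> \<partial>M)\<bar>
    \<le> \<eta> * (1 + 3 * K)"
proof -
  let ?D = "\<lambda>i \<omega>. x i \<omega> - w i \<omega>"
  let ?t0 = "\<lambda>\<omega>. ?D 0 \<omega> * x 1 \<omega> * x 2 \<omega> * x 3 \<omega>" and ?t1 = "\<lambda>\<omega>. ?D 1 \<omega> * w 0 \<omega> * x 2 \<omega> * x 3 \<omega>"
    and ?t2 = "\<lambda>\<omega>. ?D 2 \<omega> * w 0 \<omega> * w 1 \<omega> * x 3 \<omega>" and ?t3 = "\<lambda>\<omega>. ?D 3 \<omega> * w 0 \<omega> * w 1 \<omega> * w 2 \<omega>"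
  have t_int: "integrable M ?t0" "integrable M ?t1" "integrable M ?t2" "integrable M ?t3"
    by (intro product4_integrable int; measurable)+
  have xw_int: "integrable M (\<lambda>\<omega>. x 0 \<omega> * x 1 \<omega> * x 2 \<omega> * x 3 \<omega>)" "integrable M (\<lambda>\<omega>. w 0 \<omega> * w 1 \<omega> * w 2 \<omega> * w 3 \<omega>)"
    by (intro product4_integrable int meas)+
  have "(\<integral>\<omega>. x 0 \<omega> * x 1 \<omega> * x 2 \<omega> * x 3 \<omega> \<partial>M) - (\<integral>\<omega>. w 0 \<omega> * w 1 \<omega> * w 2 \<omega> * w 3 \<omega> \<partial>M)
      = (\<integral>\<omega>. x 0 \<omega> * x 1 \<omega> * x 2 \<omega> * x 3 \<omega> - w 0 \<omega> * w 1 \<omega> * w 2 \<omega> * w 3 \<omega> \<partial>M)"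
    using xw_int by simp
  also have "\<dots> = (\<integral>\<omega>. ?t0 \<omega> + ?t1 \<omega> + ?t2 \<omega> + ?t3 \<omega> \<partial>M)"
    by (intro Bochner_Integration.integral_cong refl) (simp add: algebra_simps)
  also have "\<dots> = (\<integral>\<omega>. ?t0 \<omega> \<partial>M) + (\<integral>\<omega>. ?t1 \<omega> \<partial>M) + (\<integral>\<omega>. ?t2 \<omega> \<partial>M) + (\<integral>\<omega>. ?t3 \<omega> \<partial>M)"
    by (simp only: Bochner_Integration.integral_add t_int Bochner_Integration.integrable_add)
  finally have eq: "(\<integral>\<omega>. x 0 \<omega> * x 1 \<omega> * x 2 \<omega> * x 3 \<omega> \<partial>M) - (\<integral>\<omega>. w 0 \<omega> * w 1 \<omega> * w 2 \<omega> * w 3 \<omega> \<partial>M)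
      = (\<integral>\<omega>. ?t0 \<omega> \<partial>M) + (\<integral>\<omega>. ?t1 \<omega> \<partial>M) + (\<integral>\<omega>. ?t2 \<omega> \<partial>M) + (\<integral>\<omega>. ?t3 \<omega> \<partial>M)" .
  have "\<bar>\<integral>\<omega>. ?t0 \<omega> \<partial>M\<bar> \<le> \<eta> / 4 * (1 + 3 * K)" "\<bar>\<integral>\<omega>. ?t1 \<omega> \<partial>M\<bar> \<le> \<eta> / 4 * (1 + 3 * K)"
    "\<bar>\<integral>\<omega>. ?t2 \<omega> \<partial>M\<bar> \<le> \<eta> / 4 * (1 + 3 * K)" "\<bar>\<integral>\<omega>. ?t3 \<omega> \<partial>M\<bar> \<le> \<eta> / 4 * (1 + 3 * K)"
    by (intro product4_small_factor int \<eta> K; measurable)+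
  moreover have "\<bar>a + b + c + d\<bar> \<le> 4 * B" if "\<bar>a\<bar> \<le> B" "\<bar>b\<bar> \<le> B" "\<bar>c\<bar> \<le> B" "\<bar>d\<bar> \<le> B" for a b c d B :: real
    using that by linarith
  ultimately have "\<bar>(\<integral>\<omega>. ?t0 \<omega> \<partial>M) + (\<integral>\<omega>. ?t1 \<omega> \<partial>M) + (\<integral>\<omega>. ?t2 \<omega> \<partial>M) + (\<integral>\<omega>. ?t3 \<omega> \<partial>M)\<bar>
      \<le> 4 * (\<eta> / 4 * (1 + 3 * K))" by blast
  then show ?thesis unfolding eq by simp
qed

end

text \<open>Interpolation: values below \<open>t\<close>, between \<open>t\<close> and \<open>L\<close>, and above \<open>L\<close> are controlled by a constant, by
the low moment and by the high moment.\<close>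

lemma power4_le_moments:
  fixes x t L :: real
  assumes "0 \<le> x" "0 < t" "0 < L" "0 < \<alpha>" "4 \<le> \<phi>"
  shows "x ^ 4 \<le> t ^ 4 + L ^ 4 * (x / t) powr \<alpha> + L ^ 4 * (x / L) powr \<phi>"
proof -
  have nn: "0 \<le> t ^ 4" "0 \<le> L ^ 4 * (x / t) powr \<alpha>" "0 \<le> L ^ 4 * (x / L) powr \<phi>" using assms by auto
  consider "x \<le> t" | "t < x" "x \<le> L" | "L < x" by linarith
  then show ?thesis
  proof cases
    case 1
    then have "x ^ 4 \<le> t ^ 4" using assms by (intro power_mono) auto
    then show ?thesis using nn by linarith
  next
    case 2
    have "1 \<le> (x / t) powr \<alpha>" using 2 assms by (intro ge_one_powr_ge_zero) auto
    then have "L ^ 4 * 1 \<le> L ^ 4 * (x / t) powr \<alpha>" using assms by (intro mult_left_mono) auto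
    moreover have "x ^ 4 \<le> L ^ 4" using 2 assms by (intro power_mono) auto
    ultimately show ?thesis using nn by linarith
  next
    case 3
    have "(x / L) ^ 4 = (x / L) powr 4" using 3 assms by (subst powr_numeral) auto
    also have "\<dots> \<le> (x / L) powr \<phi>" using 3 assms by (intro powr_mono) auto
    finally have "L ^ 4 * (x / L) ^ 4 \<le> L ^ 4 * (x / L) powr \<phi>" using assms by (intro mult_left_mono) auto
    moreover have "L ^ 4 * (x / L) ^ 4 = x ^ 4" using assms by (simp add: power_divide)
    ultimately show ?thesis using nn by linarith
  qed
qed

lemma abs_diff_powr_le:
  fixes a b :: real
  assumes "p \<ge> 0"
  shows "\<bar>a - b\<bar> powr p \<le> 2 powr p * (\<bar>a\<bar> powr p + \<bar>b\<bar> powr p)"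
proof -
  have "\<bar>a - b\<bar> powr p \<le> (2 * max \<bar>a\<bar> \<bar>b\<bar>) powr p"
    using assms by (intro powr_mono2) (auto simp: max_def)
  also have "\<dots> = 2 powr p * (max \<bar>a\<bar> \<bar>b\<bar>) powr p" by (rule powr_mult)
  also have "\<dots> \<le> 2 powr p * (\<bar>a\<bar> powr p + \<bar>b\<bar> powr p)"
    by (intro mult_left_mono) (auto simp: max_def)
  finally show ?thesis .
qed

locale contracting_field = bernoulli_field M V \<mu> S G \<epsilon> \<epsilon>'
  for M :: "'w measure" and V \<mu> and S :: "'e measure" and G \<epsilon> \<epsilon>' +
  fixes \<phi> :: real
  assumes contraction: "geometric_moment_contraction M V \<mu> G \<epsilon> \<epsilon>'"
    and \<phi>: "4 < \<phi>" and V_moment: "integrable M (\<lambda>\<omega>. \<bar>V 0 \<omega>\<bar> powr \<phi>)"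
begin

lemma shifted_moment: "integrable M (\<lambda>\<omega>. \<bar>shifted b \<omega>\<bar> powr \<phi>)"
  and coupled_moment: "integrable M (\<lambda>\<omega>. \<bar>coupled n b \<omega>\<bar> powr \<phi>)"
  and shifted_moment_eq: "(\<integral>\<omega>. \<bar>shifted b \<omega>\<bar> powr \<phi> \<partial>M) = (\<integral>\<omega>. \<bar>shifted 0 \<omega>\<bar> powr \<phi> \<partial>M)"
  and coupled_moment_eq: "(\<integral>\<omega>. \<bar>coupled n b \<omega>\<bar> powr \<phi> \<partial>M) = (\<integral>\<omega>. \<bar>shifted 0 \<omega>\<bar> powr \<phi> \<partial>M)"
proof -
  have V_int: "integrable M (\<lambda>\<omega>. \<bar>V 0 \<omega> - \<mu>\<bar> powr \<phi>)"
  proof (rule Bochner_Integration.integrable_bound)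
    show "integrable M (\<lambda>\<omega>. 2 powr \<phi> * (\<bar>V 0 \<omega>\<bar> powr \<phi> + \<bar>\<mu>\<bar> powr \<phi>))"
      by (intro integrable_mult_right Bochner_Integration.integrable_add V_moment) simp
    show "AE \<omega> in M. norm (\<bar>V 0 \<omega> - \<mu>\<bar> powr \<phi>) \<le> norm (2 powr \<phi> * (\<bar>V 0 \<omega>\<bar> powr \<phi> + \<bar>\<mu>\<bar> powr \<phi>))"
      using abs_diff_powr_le[of \<phi>] \<phi> by (intro AE_I2) simp
  qed measurable
  have V_AE: "AE \<omega> in M. \<bar>V 0 \<omega> - \<mu>\<bar> powr \<phi> = \<bar>shifted 0 \<omega>\<bar> powr \<phi>"
    using V_eq_shifted[of 0] by eventually_elim simp
  have s0: "integrable M (\<lambda>\<omega>. \<bar>shifted 0 \<omega>\<bar> powr \<phi>)"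
    by (rule integrable_cong_AE_imp[OF V_int _ V_AE]) measurable
  let ?h = "\<lambda>x :: real. \<bar>x\<bar> powr \<phi>"
  have int: "integrable M (\<lambda>\<omega>. ?h (Y \<omega>))" and eq: "(\<integral>\<omega>. ?h (Y \<omega>) \<partial>M) = (\<integral>\<omega>. ?h (shifted 0 \<omega>) \<partial>M)"
    if [measurable]: "Y \<in> borel_measurable M" and "distr M borel Y = distr M borel (shifted 0)" for Y
  proof -
    have "integrable (distr M borel (shifted 0)) ?h" using s0 by (subst integrable_distr_eq) auto
    then show "integrable M (\<lambda>\<omega>. ?h (Y \<omega>))"
      unfolding that(2)[symmetric] by (subst (asm) integrable_distr_eq) auto
    have "(\<integral>\<omega>. ?h (Y \<omega>) \<partial>M) = integral\<^sup>L (distr M borel Y) ?h" by (subst integral_distr) auto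
    also have "\<dots> = (\<integral>\<omega>. ?h (shifted 0 \<omega>) \<partial>M)" unfolding that(2) by (subst integral_distr) auto
    finally show "(\<integral>\<omega>. ?h (Y \<omega>) \<partial>M) = (\<integral>\<omega>. ?h (shifted 0 \<omega>) \<partial>M)" .
  qed
  show "integrable M (\<lambda>\<omega>. ?h (shifted b \<omega>))" "(\<integral>\<omega>. ?h (shifted b \<omega>) \<partial>M) = (\<integral>\<omega>. ?h (shifted 0 \<omega>) \<partial>M)"
    by (rule int[OF shifted_measurable shifted_law] eq[OF shifted_measurable shifted_law])+
  have "distr M borel (coupled n b) = distr M borel (shifted 0)"
    by (simp only: coupled_law shifted_law[of b 0])
  from int[OF coupled_measurable this] eq[OF coupled_measurable this]
  show "integrable M (\<lambda>\<omega>. ?h (coupled n b \<omega>))" "(\<integral>\<omega>. ?h (coupled n b \<omega>) \<partial>M) = (\<integral>\<omega>. ?h (shifted 0 \<omega>) \<partial>M)" .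
qed

lemma coupling_contraction:
  obtains \<alpha> C \<rho> where "\<alpha> > 0" "C > 0" "0 < \<rho>" "\<rho> < 1"
    "\<And>n b. integrable M (\<lambda>\<omega>. \<bar>shifted b \<omega> - coupled n b \<omega>\<bar> powr \<alpha>)"
    "\<And>n b. (\<integral>\<omega>. \<bar>shifted b \<omega> - coupled n b \<omega>\<bar> powr \<alpha> \<partial>M) \<le> C * \<rho> ^ n"
proof -
  obtain \<alpha> C \<rho> where p: "\<alpha> > 0" "C > 0" "0 < \<rho>" "\<rho> < 1"
    and gmc: "\<And>j. (\<integral>\<^sup>+\<omega>. ennreal (\<bar>V j \<omega> - coupled_far \<mu> G \<epsilon> \<epsilon>' j \<omega>\<bar> powr \<alpha>) \<partial>M) \<le> ennreal (C * \<rho> ^ nat (max_norm j))"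
    using contraction unfolding geometric_moment_contraction_def by blast
  let ?H = "\<lambda>n (x, y). ennreal (\<bar>G x - G (splice n x y)\<bar> powr \<alpha>)"
  have H_meas: "?H n \<in> borel_measurable (paths \<Otimes>\<^sub>M paths)" for n
    using G_splice_measurable[of n] by (simp add: case_prod_beta) measurable
  have transport: "(\<integral>\<^sup>+\<omega>. ennreal (\<bar>shifted b \<omega> - coupled n b \<omega>\<bar> powr \<alpha>) \<partial>M)
      = integral\<^sup>N (path_law \<Otimes>\<^sub>M path_law) (?H n)" for n b
    unfolding past_pair_law[of b, symmetric]
    by (subst nn_integral_distr[OF pair_measurable]) (use H_meas in \<open>simp_all add: shifted_def coupled_def\<close>)
  have nn: "(\<integral>\<^sup>+\<omega>. ennreal (\<bar>shifted b \<omega> - coupled n b \<omega>\<bar> powr \<alpha>) \<partial>M) \<le> ennreal (C * \<rho> ^ n)" for n b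
  proof -
    let ?j = "(int n, 0) :: int \<times> int"
    have mn: "max_norm ?j = int n" by (simp add: max_norm_def)
    have "coupled_far \<mu> G \<epsilon> \<epsilon>' ?j \<omega> = \<mu> + coupled n ?j \<omega>" for \<omega>
      unfolding coupled_far_def mn coupled_def splice_def past_def past_copy_def ..
    then have "AE \<omega> in M. ennreal (\<bar>V ?j \<omega> - coupled_far \<mu> G \<epsilon> \<epsilon>' ?j \<omega>\<bar> powr \<alpha>)
        = ennreal (\<bar>shifted ?j \<omega> - coupled n ?j \<omega>\<bar> powr \<alpha>)"
      using V_eq_shifted[of ?j] by (auto simp: diff_diff_eq[symmetric] elim: eventually_mono)
    then have "(\<integral>\<^sup>+\<omega>. ennreal (\<bar>V ?j \<omega> - coupled_far \<mu> G \<epsilon> \<epsilon>' ?j \<omega>\<bar> powr \<alpha>) \<partial>M)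
        = (\<integral>\<^sup>+\<omega>. ennreal (\<bar>shifted ?j \<omega> - coupled n ?j \<omega>\<bar> powr \<alpha>) \<partial>M)"
      by (rule nn_integral_cong_AE)
    then show ?thesis using gmc[of ?j] unfolding transport mn by simp
  qed
  have int: "integrable M (\<lambda>\<omega>. \<bar>shifted b \<omega> - coupled n b \<omega>\<bar> powr \<alpha>)" for n b
  proof (rule integrableI_bounded)
    show "(\<integral>\<^sup>+\<omega>. ennreal (norm (\<bar>shifted b \<omega> - coupled n b \<omega>\<bar> powr \<alpha>)) \<partial>M) < \<infinity>"
      using le_less_trans[OF nn[of b n] ennreal_less_top] by simp
  qed measurable
  have "(\<integral>\<omega>. \<bar>shifted b \<omega> - coupled n b \<omega>\<bar> powr \<alpha> \<partial>M) \<le> C * \<rho> ^ n" for n b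
    using nn[of b n] p by (subst (asm) nn_integral_eq_integral[OF int]) auto
  with p int show thesis by (intro that[of \<alpha> C \<rho>]) auto
qed

text \<open>Take \<open>t = \<rho> powr (n \<theta>)\<close> and \<open>L = 1/t\<close> in \<open>power4_le_moments\<close>. The middle term is of order
\<open>\<rho> powr (n - n \<theta> (4 + \<alpha>))\<close>, so \<open>\<theta> = 1/(2 (4 + \<alpha>))\<close> leaves \<open>\<rho> powr (n/2)\<close>; the last term decays
because \<open>\<phi> > 4\<close>.\<close>

lemma coupling_moment4:
  obtains A \<kappa> where "A > 0" "0 < \<kappa>" "\<kappa> < 1"
    "\<And>n b. integrable M (\<lambda>\<omega>. (shifted b \<omega> - coupled n b \<omega>) ^ 4)"
    "\<And>n b. (\<integral>\<omega>. (shifted b \<omega> - coupled n b \<omega>) ^ 4 \<partial>M) \<le> (A * \<kappa> ^ n) ^ 4"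
proof -
  obtain \<alpha> C \<rho> where p: "\<alpha> > 0" "C > 0" "0 < \<rho>" "\<rho> < 1"
    and int_\<alpha>: "\<And>n b. integrable M (\<lambda>\<omega>. \<bar>shifted b \<omega> - coupled n b \<omega>\<bar> powr \<alpha>)"
    and le_\<alpha>: "\<And>n b. (\<integral>\<omega>. \<bar>shifted b \<omega> - coupled n b \<omega>\<bar> powr \<alpha> \<partial>M) \<le> C * \<rho> ^ n"
    by (rule coupling_contraction) blast
  let ?D = "\<lambda>n b \<omega>. shifted b \<omega> - coupled n b \<omega>"
  define K where "K = 2 powr \<phi> * (2 * (\<integral>\<omega>. \<bar>shifted 0 \<omega>\<bar> powr \<phi> \<partial>M))"
  have K0: "K \<ge> 0" unfolding K_def by (intro mult_nonneg_nonneg Bochner_Integration.integral_nonneg) auto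
  have bound_int: "integrable M (\<lambda>\<omega>. 2 powr \<phi> * (\<bar>shifted b \<omega>\<bar> powr \<phi> + \<bar>coupled n b \<omega>\<bar> powr \<phi>))" for n b
    by (intro integrable_mult_right Bochner_Integration.integrable_add shifted_moment coupled_moment)
  have int_\<phi>: "integrable M (\<lambda>\<omega>. \<bar>?D n b \<omega>\<bar> powr \<phi>)" for n b
  proof (rule Bochner_Integration.integrable_bound[OF bound_int])
    show "AE \<omega> in M. norm (\<bar>?D n b \<omega>\<bar> powr \<phi>) \<le> norm (2 powr \<phi> * (\<bar>shifted b \<omega>\<bar> powr \<phi> + \<bar>coupled n b \<omega>\<bar> powr \<phi>))"
      using abs_diff_powr_le[of \<phi>] \<phi> by (intro AE_I2) simp
  qed measurable
  have le_\<phi>: "(\<integral>\<omega>. \<bar>?D n b \<omega>\<bar> powr \<phi> \<partial>M) \<le> K" for n b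
  proof -
    have "(\<integral>\<omega>. \<bar>?D n b \<omega>\<bar> powr \<phi> \<partial>M) \<le> (\<integral>\<omega>. 2 powr \<phi> * (\<bar>shifted b \<omega>\<bar> powr \<phi> + \<bar>coupled n b \<omega>\<bar> powr \<phi>) \<partial>M)"
      using \<phi> by (intro integral_mono int_\<phi> bound_int abs_diff_powr_le) auto
    also have "\<dots> = K"
      using shifted_moment coupled_moment
      by (simp add: K_def shifted_moment_eq[of b] coupled_moment_eq[of n b])
    finally show ?thesis .
  qed
  define \<theta> where "\<theta> = 1 / (2 * (4 + \<alpha>))"
  \<comment> \<open>The smallest exponent among the three terms of the interpolation; the fourth root is taken because the
    bound is used through fourth roots of moments.\<close>
  define m where "m = min (4 * \<theta>) (min (1/2) (\<theta> * (\<phi> - 4)))"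
  have \<theta>: "\<theta> > 0" "\<theta> * (4 + \<alpha>) = 1/2" using p by (auto simp: \<theta>_def field_simps)
  have m: "m > 0" using \<theta> \<phi> by (simp add: m_def)
  define B where "B = 1 + C + K"
  define \<kappa> where "\<kappa> = \<rho> powr (m / 4)"
  have \<kappa>: "0 < \<kappa>" "\<kappa> < 1"
  proof -
    show "0 < \<kappa>" using p by (simp add: \<kappa>_def)
    have "\<rho> powr (m / 4) < \<rho> powr 0" using p m by (intro powr_less_mono') auto
    then show "\<kappa> < 1" using p by (simp add: \<kappa>_def)
  qed
  have \<kappa>4: "(\<kappa> ^ n) ^ 4 = \<rho> powr (real n * m)" for n
  proof -
    have "(\<kappa> ^ n) ^ 4 = \<kappa> ^ (n * 4)" by (simp add: power_mult)
    also have "\<dots> = \<kappa> powr (real (n * 4))" using \<kappa> by (simp only: powr_realpow)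
    also have "\<dots> = \<rho> powr (m / 4 * real (n * 4))" by (simp only: \<kappa>_def powr_powr)
    finally show ?thesis by (simp add: mult.commute)
  qed
  have small: "\<rho> powr (real n * c) \<le> (\<kappa> ^ n) ^ 4" if "m \<le> c" for n c
    unfolding \<kappa>4 using p that by (intro powr_mono') (auto intro: mult_left_mono)
  have main: "integrable M (\<lambda>\<omega>. ?D n b \<omega> ^ 4) \<and> (\<integral>\<omega>. ?D n b \<omega> ^ 4 \<partial>M) \<le> B * (\<kappa> ^ n) ^ 4" for n b
  proof -
    let ?t = "\<rho> powr (real n * \<theta>)" and ?L = "\<rho> powr (- (real n * \<theta>))"
    let ?F = "\<lambda>\<omega>. ?t ^ 4 + ?L ^ 4 * (\<bar>?D n b \<omega>\<bar> / ?t) powr \<alpha> + ?L ^ 4 * (\<bar>?D n b \<omega>\<bar> / ?L) powr \<phi>"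
    have tL: "?t > 0" "?L > 0" using p by auto
    have pw4: "x ^ 4 = x powr 4" if "x > 0" for x :: real using that by (subst powr_numeral) auto
    have t4: "?t ^ 4 = \<rho> powr (real n * (4 * \<theta>))"
      using tL by (simp add: pw4 powr_powr mult_ac)
    have La: "?L ^ 4 * (\<bar>x\<bar> / ?t) powr \<alpha> = \<rho> powr (- (real n * (\<theta> * (4 + \<alpha>)))) * \<bar>x\<bar> powr \<alpha>" for x
    proof -
      have "(\<bar>x\<bar> / ?t) powr \<alpha> = \<bar>x\<bar> powr \<alpha> / ?t powr \<alpha>" using tL by (intro powr_divide)
      also have "\<dots> = \<bar>x\<bar> powr \<alpha> * \<rho> powr (- (real n * \<theta> * \<alpha>))" by (simp add: powr_powr powr_minus divide_inverse)
      finally have "?L ^ 4 * (\<bar>x\<bar> / ?t) powr \<alpha>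
          = \<rho> powr (- (real n * \<theta>) * 4) * \<rho> powr (- (real n * \<theta> * \<alpha>)) * \<bar>x\<bar> powr \<alpha>"
        using tL by (simp only: pw4 powr_powr) simp
      also have "\<dots> = \<rho> powr (- (real n * \<theta>) * 4 + - (real n * \<theta> * \<alpha>)) * \<bar>x\<bar> powr \<alpha>"
        by (simp only: powr_add)
      also have "- (real n * \<theta>) * 4 + - (real n * \<theta> * \<alpha>) = - (real n * (\<theta> * (4 + \<alpha>)))"
        by (simp add: algebra_simps)
      finally show ?thesis .
    qed
    have Lp: "?L ^ 4 * (\<bar>x\<bar> / ?L) powr \<phi> = \<rho> powr (real n * (\<theta> * (\<phi> - 4))) * \<bar>x\<bar> powr \<phi>" for x
    proof -
      have "(\<bar>x\<bar> / ?L) powr \<phi> = \<bar>x\<bar> powr \<phi> / ?L powr \<phi>" using tL by (intro powr_divide)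
      also have "?L powr \<phi> = \<rho> powr (- (real n * \<theta> * \<phi>))" by (simp only: powr_powr mult_minus_left)
      also have "\<bar>x\<bar> powr \<phi> / \<rho> powr (- (real n * \<theta> * \<phi>)) = \<bar>x\<bar> powr \<phi> * \<rho> powr (real n * \<theta> * \<phi>)"
        by (simp only: powr_minus divide_inverse inverse_inverse_eq)
      finally have "?L ^ 4 * (\<bar>x\<bar> / ?L) powr \<phi>
          = \<rho> powr (- (real n * \<theta>) * 4) * \<rho> powr (real n * \<theta> * \<phi>) * \<bar>x\<bar> powr \<phi>"
        using tL by (simp only: pw4 powr_powr) simp
      also have "\<dots> = \<rho> powr (- (real n * \<theta>) * 4 + real n * \<theta> * \<phi>) * \<bar>x\<bar> powr \<phi>"
        by (simp only: powr_add)
      also have "- (real n * \<theta>) * 4 + real n * \<theta> * \<phi> = real n * (\<theta> * (\<phi> - 4))"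
        by (simp add: algebra_simps)
      finally show ?thesis .
    qed
    have intF: "integrable M ?F"
      unfolding La Lp by (intro Bochner_Integration.integrable_add integrable_mult_right int_\<alpha> int_\<phi>) auto
    have point: "?D n b \<omega> ^ 4 \<le> ?F \<omega>" for \<omega>
      using power4_le_moments[of "\<bar>?D n b \<omega>\<bar>" ?t ?L \<alpha> \<phi>] tL p \<phi> by simp
    have int4: "integrable M (\<lambda>\<omega>. ?D n b \<omega> ^ 4)"
    proof (rule Bochner_Integration.integrable_bound[OF intF])
      show "AE \<omega> in M. norm (?D n b \<omega> ^ 4) \<le> norm (?F \<omega>)"
        using point unfolding real_norm_def by (intro AE_I2) (simp add: order_trans[OF _ abs_ge_self])
    qed measurable
    have "(\<integral>\<omega>. ?D n b \<omega> ^ 4 \<partial>M) \<le> integral\<^sup>L M ?F" by (rule integral_mono[OF int4 intF point])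
    also have "\<dots> = \<rho> powr (real n * (4 * \<theta>)) + \<rho> powr (- (real n * (\<theta> * (4 + \<alpha>)))) * (\<integral>\<omega>. \<bar>?D n b \<omega>\<bar> powr \<alpha> \<partial>M)
        + \<rho> powr (real n * (\<theta> * (\<phi> - 4))) * (\<integral>\<omega>. \<bar>?D n b \<omega>\<bar> powr \<phi> \<partial>M)"
      unfolding La Lp t4 using int_\<alpha>[of b n] int_\<phi>[of b n] by (simp add: prob_space)
    also have "\<dots> \<le> \<rho> powr (real n * (4 * \<theta>)) + \<rho> powr (- (real n * (\<theta> * (4 + \<alpha>)))) * (C * \<rho> ^ n)
        + \<rho> powr (real n * (\<theta> * (\<phi> - 4))) * K"
      by (intro add_mono mult_left_mono le_\<alpha> le_\<phi>) auto
    also have "\<rho> powr (- (real n * (\<theta> * (4 + \<alpha>)))) * (C * \<rho> ^ n) = C * \<rho> powr (real n * (1/2))"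
    proof -
      have "\<rho> powr (- (real n * (1/2))) * \<rho> powr real n = \<rho> powr (real n * (1/2))"
        by (simp add: powr_add[symmetric])
      moreover have "\<rho> ^ n = \<rho> powr real n" using p by (simp only: powr_realpow)
      ultimately show ?thesis unfolding \<theta>(2) by (simp only: mult_ac)
    qed
    also have "\<rho> powr (real n * (4 * \<theta>)) + C * \<rho> powr (real n * (1/2)) + \<rho> powr (real n * (\<theta> * (\<phi> - 4))) * K
        \<le> (\<kappa> ^ n) ^ 4 + C * (\<kappa> ^ n) ^ 4 + (\<kappa> ^ n) ^ 4 * K"
      using p K0 by (intro add_mono mult_left_mono mult_right_mono small) (auto simp: m_def)
    also have "\<dots> = B * (\<kappa> ^ n) ^ 4" by (simp add: B_def algebra_simps)
    finally show ?thesis using int4 by simp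
  qed
  have B1: "1 \<le> B" using p K0 by (simp add: B_def)
  then have B4: "B \<le> B ^ 4" using power_increasing[of 1 4 B] by simp
  have "(\<integral>\<omega>. ?D n b \<omega> ^ 4 \<partial>M) \<le> (B * \<kappa> ^ n) ^ 4" for n b
  proof -
    have "B * (\<kappa> ^ n) ^ 4 \<le> B ^ 4 * (\<kappa> ^ n) ^ 4" by (intro mult_right_mono B4) auto
    then show ?thesis using main[of b n] by (simp add: power_mult_distrib)
  qed
  with \<kappa> B1 main show thesis by (intro that[of B \<kappa>]) auto
qed

end

section \<open>Decay of covariances\<close>

lemma geometric_summable_int:
  fixes \<tau> :: real
  assumes "0 < \<tau>" "\<tau> < 1"
  shows "(\<lambda>x :: int. \<tau> ^ nat \<bar>x\<bar>) summable_on UNIV"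
proof -
  have geo: "(\<lambda>n. c * \<tau> ^ n) summable_on UNIV" for c
    by (rule norm_summable_imp_summable_on)
      (use assms in \<open>auto simp: abs_mult power_abs intro!: summable_mult summable_geometric\<close>)
  have p: "(\<lambda>x :: int. \<tau> ^ nat \<bar>x\<bar>) summable_on range int"
    by (subst summable_on_reindex) (use geo[of 1] in \<open>auto simp: o_def inj_on_def\<close>)
  have "(\<lambda>n. \<tau> ^ nat \<bar>- int n - 1\<bar>) = (\<lambda>n. \<tau> * \<tau> ^ n)"
  proof
    fix n
    have "nat \<bar>- int n - 1\<bar> = Suc n" by simp
    then show "\<tau> ^ nat \<bar>- int n - 1\<bar> = \<tau> * \<tau> ^ n" by (simp only: power_Suc)
  qed
  then have m: "(\<lambda>x :: int. \<tau> ^ nat \<bar>x\<bar>) summable_on range (\<lambda>n. - int n - 1)"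
    using geo[of \<tau>] by (subst summable_on_reindex) (auto simp: o_def inj_on_def)
  have un: "range int \<union> range (\<lambda>n. - int n - 1) = UNIV"
  proof (intro equalityI subsetI UNIV_I)
    fix x :: int
    show "x \<in> range int \<union> range (\<lambda>n. - int n - 1)"
    proof (cases "0 \<le> x")
      case True
      then have "x = int (nat x)" by simp
      then show ?thesis by (metis UnI1 rangeI)
    next
      case False
      then have "x = - int (nat (- x - 1)) - 1" by simp
      then show ?thesis by (metis (mono_tags, lifting) UnI2 rangeI)
    qed
  qed
  have "range int \<inter> range (\<lambda>n. - int n - 1) = {}" by auto
  from summable_on_Un_disjoint[OF p m this] show ?thesis by (simp only: un)
qed

lemma geometric_summable_max_norm:
  fixes \<kappa> :: real
  assumes "0 < \<kappa>" "\<kappa> < 1"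
  shows "(\<lambda>s :: int \<times> int. \<kappa> ^ (nat (max_norm s) div 2)) summable_on UNIV"
proof -
  \<comment> \<open>Halving the exponent costs one square root, and the maximum of two coordinates is at least half their
    sum, which costs another.\<close>
  define \<tau> where "\<tau> = sqrt (sqrt \<kappa>)"
  have \<tau>: "0 < \<tau>" "\<tau> < 1" using assms by (auto simp: \<tau>_def)
  have "\<tau> ^ 4 = ((sqrt (sqrt \<kappa>))\<^sup>2)\<^sup>2" by (simp add: \<tau>_def power_mult[symmetric])
  then have \<tau>4: "\<tau> ^ 4 = \<kappa>" using assms by simp
  let ?f = "\<lambda>x :: int. \<tau> ^ nat \<bar>x\<bar>"
  have f: "?f summable_on UNIV" by (rule geometric_summable_int[OF \<tau>])
  have "(\<lambda>(x, y). ?f x * ?f y) summable_on (UNIV \<times> UNIV)"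
  proof (rule summable_on_SigmaI)
    show "((\<lambda>y. case (x, y) of (x, y) \<Rightarrow> ?f x * ?f y) has_sum ?f x * infsum ?f UNIV) UNIV" for x
      using has_sum_cmult_right[OF has_sum_infsum[OF f], of "?f x"] by simp
    show "(\<lambda>x. ?f x * infsum ?f UNIV) summable_on UNIV" by (rule summable_on_cmult_left[OF f])
  qed (use \<tau> in auto)
  then have "(\<lambda>s. (1 / \<tau>\<^sup>2) * (?f (fst s) * ?f (snd s))) summable_on UNIV"
    by (intro summable_on_cmult_right) (simp add: case_prod_unfold)
  then show ?thesis
  proof (rule summable_on_comparison_test)
    fix s :: "int \<times> int"
    let ?m = "nat (max_norm s)"
    have "nat \<bar>fst s\<bar> + nat \<bar>snd s\<bar> \<le> 2 * ?m" by (auto simp: max_norm_def max_def nat_mono)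
    also have "\<dots> \<le> 4 * (?m div 2) + 2" by linarith
    finally have le: "nat \<bar>fst s\<bar> + nat \<bar>snd s\<bar> \<le> 4 * (?m div 2) + 2" .
    have "\<kappa> ^ (?m div 2) * \<tau>\<^sup>2 = \<tau> ^ (4 * (?m div 2) + 2)"
      by (simp add: \<tau>4[symmetric] power_mult power_add power2_eq_square)
    also have "\<dots> \<le> \<tau> ^ (nat \<bar>fst s\<bar> + nat \<bar>snd s\<bar>)"
      using \<tau> le by (intro power_decreasing) auto
    also have "\<dots> = ?f (fst s) * ?f (snd s)" by (rule power_add)
    finally show "\<kappa> ^ (?m div 2) \<le> (1 / \<tau>\<^sup>2) * (?f (fst s) * ?f (snd s))"
      using \<tau> by (simp add: field_simps)
  qed (use assms in auto)
qed

context bernoulli_field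
begin

definition site_window :: "nat \<Rightarrow> int \<times> int \<Rightarrow> (int \<times> int) set" where
  "site_window n b = {i. max_norm (b - i) < int n}"

text \<open>The copies are integrated out in a product measure, so the measurability of the factor in the
remaining coordinates is part of Fubini's theorem.\<close>

lemma local_approx_factor:
  assumes N: "Inl ` site_window n b \<subseteq> N"
  obtains F where "F \<in> borel_measurable (PiM N (\<lambda>_. S))"
    "\<And>\<omega>. local_approx n b \<omega> = F (restrict (\<lambda>i. innovation i \<omega>) N)"
proof -
  let ?sp = "\<lambda>z y s. if max_norm s < int n then z (Inl (b - s)) else y s"
  let ?F = "\<lambda>z. \<integral>y. G (?sp z y) \<partial>path_law"
  have inN: "Inl (b - s) \<in> N" if "max_norm s < int n" for s
  proof -
    have "b - s \<in> site_window n b" using that by (simp add: site_window_def)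
    then show ?thesis using N by blast
  qed
  have comp: "(\<lambda>p. ?sp (fst p) (snd p) s) \<in> PiM N (\<lambda>_. S) \<Otimes>\<^sub>M paths \<rightarrow>\<^sub>M S" for s
  proof (cases "max_norm s < int n")
    case True
    then have [measurable]: "Inl (b - s) \<in> N" by (rule inN)
    have "(\<lambda>p. fst p (Inl (b - s))) \<in> PiM N (\<lambda>_. S) \<Otimes>\<^sub>M paths \<rightarrow>\<^sub>M S"
      by (rule measurable_compose[OF measurable_fst measurable_component_singleton]) fact
    then show ?thesis using True by simp
  next
    case False
    have "(\<lambda>p. snd p s) \<in> PiM N (\<lambda>_. S) \<Otimes>\<^sub>M paths \<rightarrow>\<^sub>M S"
      by (rule measurable_compose[OF measurable_snd measurable_component_singleton]) simp
    then show ?thesis using False by simp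
  qed
  have "(\<lambda>p. ?sp (fst p) (snd p)) \<in> PiM N (\<lambda>_. S) \<Otimes>\<^sub>M paths \<rightarrow>\<^sub>M paths"
  proof (rule measurable_PiM_single')
    show "(\<lambda>p s. ?sp (fst p) (snd p) s) \<in> space (PiM N (\<lambda>_. S) \<Otimes>\<^sub>M paths) \<rightarrow> (\<Pi>\<^sub>E i\<in>UNIV. space S)"
      using measurable_space[OF comp] by (auto simp: PiE_def Pi_def)
  qed (rule comp)
  from measurable_compose[OF this G_measurable]
  have joint: "(\<lambda>(z, y). G (?sp z y)) \<in> borel_measurable (PiM N (\<lambda>_. S) \<Otimes>\<^sub>M paths)"
    by (simp add: case_prod_beta)
  interpret P: prob_space path_law by (rule path_law_prob)
  have sets_eq: "sets (PiM N (\<lambda>_. S) \<Otimes>\<^sub>M path_law) = sets (PiM N (\<lambda>_. S) \<Otimes>\<^sub>M paths)"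
    by (intro sets_pair_measure_cong path_law_sets refl)
  have F: "?F \<in> borel_measurable (PiM N (\<lambda>_. S))"
    by (rule P.borel_measurable_lebesgue_integral) (use joint in \<open>simp cong: measurable_cong_sets add: sets_eq\<close>)
  have "local_approx n b \<omega> = ?F (restrict (\<lambda>i. innovation i \<omega>) N)" for \<omega>
    unfolding local_approx_def window_mean_def
  proof (intro Bochner_Integration.integral_cong refl arg_cong[of _ _ G] ext)
    fix y s
    show "splice n (past b \<omega>) y s = ?sp (restrict (\<lambda>i. innovation i \<omega>) N) y s"
      using inN[of s] by (simp add: splice_def past_def innovation_def)
  qed
  with F show thesis by (rule that)
qed

lemma local_approx_indep:
  assumes sep: "2 * int n \<le> max_norm (a - c)" "2 * int n \<le> max_norm (a - e)"
    "2 * int n \<le> max_norm (b - c)" "2 * int n \<le> max_norm (b - e)"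
  shows "indep_var borel (\<lambda>\<omega>. local_approx n a \<omega> * local_approx n b \<omega>)
    borel (\<lambda>\<omega>. local_approx n c \<omega> * local_approx n e \<omega>)"
proof -
  let ?N1 = "Inl ` (site_window n a \<union> site_window n b) :: ((int \<times> int) + (int \<times> int)) set"
  let ?N2 = "Inl ` (site_window n c \<union> site_window n e) :: ((int \<times> int) + (int \<times> int)) set"
  have disj: "site_window n p \<inter> site_window n q = {}" if "2 * int n \<le> max_norm (p - q)" for p q
  proof (intro equals0I)
    fix i assume "i \<in> site_window n p \<inter> site_window n q"
    then have "\<bar>fst p - fst i\<bar> < int n" "\<bar>snd p - snd i\<bar> < int n" "\<bar>fst q - fst i\<bar> < int n" "\<bar>snd q - snd i\<bar> < int n"
      by (auto simp: site_window_def max_norm_def)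
    then have "\<bar>fst p - fst q\<bar> < 2 * int n" "\<bar>snd p - snd q\<bar> < 2 * int n" by linarith+
    with that show False by (simp add: max_norm_def)
  qed
  have ind: "indep_var (PiM ?N1 (\<lambda>_. S)) (\<lambda>\<omega>. restrict (\<lambda>i. innovation i \<omega>) ?N1)
      (PiM ?N2 (\<lambda>_. S)) (\<lambda>\<omega>. restrict (\<lambda>i. innovation i \<omega>) ?N2)"
    using disj[OF sep(1)] disj[OF sep(2)] disj[OF sep(3)] disj[OF sep(4)]
    by (intro indep_var_restrict[OF innovation_indep]) auto
  obtain Fa where Fa: "Fa \<in> borel_measurable (PiM ?N1 (\<lambda>_. S))" "\<And>\<omega>. local_approx n a \<omega> = Fa (restrict (\<lambda>i. innovation i \<omega>) ?N1)"
    by (rule local_approx_factor[of n a ?N1]) blast+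
  obtain Fb where Fb: "Fb \<in> borel_measurable (PiM ?N1 (\<lambda>_. S))" "\<And>\<omega>. local_approx n b \<omega> = Fb (restrict (\<lambda>i. innovation i \<omega>) ?N1)"
    by (rule local_approx_factor[of n b ?N1]) blast+
  obtain Fc where Fc: "Fc \<in> borel_measurable (PiM ?N2 (\<lambda>_. S))" "\<And>\<omega>. local_approx n c \<omega> = Fc (restrict (\<lambda>i. innovation i \<omega>) ?N2)"
    by (rule local_approx_factor[of n c ?N2]) blast+
  obtain Fe where Fe: "Fe \<in> borel_measurable (PiM ?N2 (\<lambda>_. S))" "\<And>\<omega>. local_approx n e \<omega> = Fe (restrict (\<lambda>i. innovation i \<omega>) ?N2)"
    by (rule local_approx_factor[of n e ?N2]) blast+
  have "(\<lambda>z. Fa z * Fb z) \<in> borel_measurable (PiM ?N1 (\<lambda>_. S))" "(\<lambda>z. Fc z * Fe z) \<in> borel_measurable (PiM ?N2 (\<lambda>_. S))"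
    by (intro borel_measurable_times Fa(1) Fb(1) Fc(1) Fe(1))+
  from indep_var_compose[OF ind this] show ?thesis
    by (simp add: o_def Fa(2) Fb(2) Fc(2) Fe(2))
qed

end

context contracting_field
begin

lemma shifted_power4: "integrable M (\<lambda>\<omega>. shifted b \<omega> ^ 4)"
  and shifted_power4_le: "(\<integral>\<omega>. shifted b \<omega> ^ 4 \<partial>M) \<le> 1 + (\<integral>\<omega>. \<bar>shifted 0 \<omega>\<bar> powr \<phi> \<partial>M)"
proof -
  have int: "integrable M (\<lambda>\<omega>. 1 + \<bar>shifted b \<omega>\<bar> powr \<phi>)"
    by (intro Bochner_Integration.integrable_add shifted_moment) simp
  have point: "x ^ 4 \<le> 1 + \<bar>x\<bar> powr \<phi>" for x :: real
  proof (cases "\<bar>x\<bar> \<le> 1")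
    case True
    then have "\<bar>x\<bar> ^ 4 \<le> 1 ^ 4" by (intro power_mono) auto
    then have "x ^ 4 \<le> 1" by simp
    moreover have "0 \<le> \<bar>x\<bar> powr \<phi>" by simp
    ultimately show ?thesis by linarith
  next
    case False
    then have "\<bar>x\<bar> ^ 4 = \<bar>x\<bar> powr 4" by (subst powr_numeral) auto
    also have "\<dots> \<le> \<bar>x\<bar> powr \<phi>" using False \<phi> by (intro powr_mono) auto
    finally show ?thesis by simp
  qed
  show int4: "integrable M (\<lambda>\<omega>. shifted b \<omega> ^ 4)"
    by (rule Bochner_Integration.integrable_bound[OF int])
      (use point in \<open>auto simp: order_trans[OF _ abs_ge_self]\<close>)
  have "(\<integral>\<omega>. shifted b \<omega> ^ 4 \<partial>M) \<le> (\<integral>\<omega>. 1 + \<bar>shifted b \<omega>\<bar> powr \<phi> \<partial>M)"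
    by (rule integral_mono[OF int4 int point])
  also have "\<dots> = 1 + (\<integral>\<omega>. \<bar>shifted b \<omega>\<bar> powr \<phi> \<partial>M)"
    using shifted_moment[of b] by (simp add: prob_space)
  finally show "(\<integral>\<omega>. shifted b \<omega> ^ 4 \<partial>M) \<le> 1 + (\<integral>\<omega>. \<bar>shifted 0 \<omega>\<bar> powr \<phi> \<partial>M)"
    by (simp only: shifted_moment_eq[of b])
qed

text \<open>At distance \<open>2 n\<close> the windows of radius \<open>n\<close> around the two pairs of sites are disjoint. Replacing the
four variables by their local approximations makes the two products independent, and each
replacement costs \<open>O(\<kappa>\<^sup>n)\<close>.\<close>

lemma covariance_decay:
  obtains A \<kappa> where "A > 0" "0 < \<kappa>" "\<kappa> < 1"
    "\<And>n a b c e. 2 * int n \<le> max_norm (a - c) \<Longrightarrow> 2 * int n \<le> max_norm (a - e) \<Longrightarrow>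
      2 * int n \<le> max_norm (b - c) \<Longrightarrow> 2 * int n \<le> max_norm (b - e) \<Longrightarrow>
      \<bar>(\<integral>\<omega>. shifted a \<omega> * shifted b \<omega> * shifted c \<omega> * shifted e \<omega> \<partial>M)
        - (\<integral>\<omega>. shifted a \<omega> * shifted b \<omega> \<partial>M) * (\<integral>\<omega>. shifted c \<omega> * shifted e \<omega> \<partial>M)\<bar> \<le> A * \<kappa> ^ n"
proof -
  obtain A \<kappa> where A: "A > 0" and \<kappa>: "0 < \<kappa>" "\<kappa> < 1"
    and c_int: "\<And>n b. integrable M (\<lambda>\<omega>. (shifted b \<omega> - coupled n b \<omega>) ^ 4)"
    and c_le: "\<And>n b. (\<integral>\<omega>. (shifted b \<omega> - coupled n b \<omega>) ^ 4 \<partial>M) \<le> (A * \<kappa> ^ n) ^ 4"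
    by (rule coupling_moment4) blast
  note D_int = local_approx_moment4(1)[OF c_int]
  have D_le: "(\<integral>\<omega>. (shifted b \<omega> - local_approx n b \<omega>) ^ 4 \<partial>M) \<le> (A * \<kappa> ^ n) ^ 4" for n b
    by (rule order_trans[OF local_approx_moment4(2)[OF c_int] c_le])
  define K0 where "K0 = 1 + (\<integral>\<omega>. \<bar>shifted 0 \<omega>\<bar> powr \<phi> \<partial>M)"
  have K0: "1 \<le> K0" unfolding K0_def using Bochner_Integration.integral_nonneg[of M "\<lambda>\<omega>. \<bar>shifted 0 \<omega>\<bar> powr \<phi>"] by simp
  define K where "K = 8 * (K0 + A ^ 4)"
  have "x \<le> 8 * (x + y)" if "1 \<le> x" "0 < y" for x y :: real using that by simp
  from this[OF K0 zero_less_power[OF A]] have K: "K0 \<le> K" unfolding K_def .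
  then have K1: "1 \<le> K" using K0 by linarith
  have X_le: "(\<integral>\<omega>. shifted b \<omega> ^ 4 \<partial>M) \<le> K" for b
    using shifted_power4_le[of b] K by (simp add: K0_def)
  have W_bound: "local_approx n b \<omega> ^ 4 \<le> 8 * (shifted b \<omega> ^ 4 + (shifted b \<omega> - local_approx n b \<omega>) ^ 4)" for n b \<omega>
    using diff_power4_le[of "shifted b \<omega>" "shifted b \<omega> - local_approx n b \<omega>"] by simp
  have W_bint: "integrable M (\<lambda>\<omega>. 8 * (shifted b \<omega> ^ 4 + (shifted b \<omega> - local_approx n b \<omega>) ^ 4))" for n b
    by (intro integrable_mult_right Bochner_Integration.integrable_add shifted_power4 D_int)
  have W_int: "integrable M (\<lambda>\<omega>. local_approx n b \<omega> ^ 4)" for n b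
  proof (rule Bochner_Integration.integrable_bound[OF W_bint])
    show "AE \<omega> in M. norm (local_approx n b \<omega> ^ 4) \<le> norm (8 * (shifted b \<omega> ^ 4 + (shifted b \<omega> - local_approx n b \<omega>) ^ 4))"
      using W_bound by (intro AE_I2) (simp add: order_trans[OF _ abs_ge_self])
  qed measurable
  have W_le: "(\<integral>\<omega>. local_approx n b \<omega> ^ 4 \<partial>M) \<le> K" for n b
  proof -
    have "(\<integral>\<omega>. local_approx n b \<omega> ^ 4 \<partial>M) \<le> 8 * ((\<integral>\<omega>. shifted b \<omega> ^ 4 \<partial>M) + (\<integral>\<omega>. (shifted b \<omega> - local_approx n b \<omega>) ^ 4 \<partial>M))"
      using integral_mono[OF W_int W_bint W_bound, of n b] shifted_power4[of b] D_int[of b n] by simp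
    also have "(\<integral>\<omega>. (shifted b \<omega> - local_approx n b \<omega>) ^ 4 \<partial>M) \<le> A ^ 4"
    proof -
      have "A * \<kappa> ^ n \<le> A * 1" using A \<kappa> by (intro mult_left_mono power_le_one) auto
      then have "(A * \<kappa> ^ n) ^ 4 \<le> A ^ 4" using A \<kappa> by (intro power_mono) auto
      with D_le[of b n] show ?thesis by linarith
    qed
    also have "(\<integral>\<omega>. shifted b \<omega> ^ 4 \<partial>M) \<le> K0" using shifted_power4_le[of b] by (simp add: K0_def)
    finally show ?thesis by (simp add: K_def)
  qed
  let ?B = "1 + 3 * K"
  have B0: "0 \<le> ?B" using K1 by simp
  show thesis
  proof (rule that[of "A * ?B * (1 + 2 * K)" \<kappa>])
    show "0 < A * ?B * (1 + 2 * K)" using A K1 by (intro mult_pos_pos) auto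
    fix n a b c e
    assume sep: "2 * int n \<le> max_norm (a - c)" "2 * int n \<le> max_norm (a - e)"
      "2 * int n \<le> max_norm (b - c)" "2 * int n \<le> max_norm (b - e)"
    let ?\<eta> = "A * \<kappa> ^ n"
    have \<eta>: "?\<eta> > 0" using A \<kappa> by simp
    have one: "integrable M (\<lambda>\<omega>. (1 :: real) ^ 4)" "(\<integral>\<omega>. (1 :: real) ^ 4 \<partial>M) \<le> K"
      using K1 by (auto simp: prob_space)
    have zero: "integrable M (\<lambda>\<omega>. (1 - 1 :: real) ^ 4)" "(\<integral>\<omega>. (1 - 1 :: real) ^ 4 \<partial>M) \<le> ?\<eta> ^ 4" by simp_all
    have four: "\<bar>(\<integral>\<omega>. shifted a \<omega> * shifted b \<omega> * shifted c \<omega> * shifted e \<omega> \<partial>M)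
        - (\<integral>\<omega>. local_approx n a \<omega> * local_approx n b \<omega> * local_approx n c \<omega> * local_approx n e \<omega> \<partial>M)\<bar> \<le> ?\<eta> * ?B"
    proof -
      let ?i = "\<lambda>i :: nat. if i = 0 then a else if i = 1 then b else if i = 2 then c else e"
      show ?thesis
        using product4_perturbation[of "\<lambda>i. shifted (?i i)" "\<lambda>i. local_approx n (?i i)" ?\<eta> K]
          shifted_power4 W_int D_int \<eta> D_le X_le W_le by simp
    qed
    have two: "\<bar>(\<integral>\<omega>. shifted p \<omega> * shifted q \<omega> \<partial>M) - (\<integral>\<omega>. local_approx n p \<omega> * local_approx n q \<omega> \<partial>M)\<bar> \<le> ?\<eta> * ?B" for p q
    proof -
      let ?x = "\<lambda>i :: nat. if i = 0 then shifted p else if i = 1 then shifted q else (\<lambda>_. 1)"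
      let ?w = "\<lambda>i :: nat. if i = 0 then local_approx n p else if i = 1 then local_approx n q else (\<lambda>_. 1)"
      have "\<bar>(\<integral>\<omega>. ?x 0 \<omega> * ?x 1 \<omega> * ?x 2 \<omega> * ?x 3 \<omega> \<partial>M) - (\<integral>\<omega>. ?w 0 \<omega> * ?w 1 \<omega> * ?w 2 \<omega> * ?w 3 \<omega> \<partial>M)\<bar> \<le> ?\<eta> * ?B"
        by (rule product4_perturbation)
          (use shifted_power4 W_int D_int \<eta> D_le X_le W_le one zero in \<open>auto\<close>)
      then show ?thesis by simp
    qed
    have bound2: "\<bar>\<integral>\<omega>. x \<omega> * y \<omega> \<partial>M\<bar> \<le> K"
      if [measurable]: "x \<in> borel_measurable M" "y \<in> borel_measurable M"
        and i: "integrable M (\<lambda>\<omega>. x \<omega> ^ 4)" "integrable M (\<lambda>\<omega>. y \<omega> ^ 4)"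
        and l: "(\<integral>\<omega>. x \<omega> ^ 4 \<partial>M) \<le> K" "(\<integral>\<omega>. y \<omega> ^ 4 \<partial>M) \<le> K" for x y :: "'w \<Rightarrow> real"
    proof -
      have "\<bar>\<integral>\<omega>. x \<omega> * y \<omega> \<partial>M\<bar> \<le> (\<integral>\<omega>. \<bar>x \<omega> * y \<omega>\<bar> \<partial>M)" by (rule integral_abs_bound)
      also have "\<dots> \<le> (\<integral>\<omega>. (x \<omega> ^ 4 + y \<omega> ^ 4 + 1 + 1) / 4 \<partial>M)"
      proof (rule integral_mono)
        have "integrable M (\<lambda>\<omega>. x \<omega> * y \<omega> * 1 * 1)"
          by (rule product4_integrable) (use i in auto)
        then show "integrable M (\<lambda>\<omega>. \<bar>x \<omega> * y \<omega>\<bar>)" by simp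
        show "\<bar>x \<omega> * y \<omega>\<bar> \<le> (x \<omega> ^ 4 + y \<omega> ^ 4 + 1 + 1) / 4" for \<omega>
          using abs_prod4_le[of "x \<omega>" "y \<omega>" 1 1] by simp
      qed (use i in auto)
      also have "\<dots> = ((\<integral>\<omega>. x \<omega> ^ 4 \<partial>M) + (\<integral>\<omega>. y \<omega> ^ 4 \<partial>M) + 1 + 1) / 4"
        using i by (simp add: prob_space)
      also have "\<dots> \<le> K" using l K1 by simp
      finally show ?thesis .
    qed
    have WW_int: "integrable M (\<lambda>\<omega>. local_approx n p \<omega> * local_approx n q \<omega>)" for p q
      using product4_integrable[of "local_approx n p" "local_approx n q" "\<lambda>_. 1" "\<lambda>_. 1"] W_int by simp
    have ind: "(\<integral>\<omega>. local_approx n a \<omega> * local_approx n b \<omega> * local_approx n c \<omega> * local_approx n e \<omega> \<partial>M)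
        = (\<integral>\<omega>. local_approx n a \<omega> * local_approx n b \<omega> \<partial>M) * (\<integral>\<omega>. local_approx n c \<omega> * local_approx n e \<omega> \<partial>M)"
      using indep_var_lebesgue_integral[OF local_approx_indep[OF sep] WW_int WW_int] by (simp add: mult.assoc)
    have comb: "\<bar>x4 - x1 * x2\<bar> \<le> \<eta> * (1 + 2 * K)"
      if "\<bar>x4 - w1 * w2\<bar> \<le> \<eta>" "\<bar>x1 - w1\<bar> \<le> \<eta>" "\<bar>x2 - w2\<bar> \<le> \<eta>" "\<bar>x1\<bar> \<le> K" "\<bar>w2\<bar> \<le> K" for x4 x1 x2 w1 w2 \<eta> :: real
    proof -
      have "x4 - x1 * x2 = (x4 - w1 * w2) - (x1 - w1) * w2 - x1 * (x2 - w2)" by (simp add: algebra_simps)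
      then have "\<bar>x4 - x1 * x2\<bar> \<le> \<bar>x4 - w1 * w2\<bar> + \<bar>x1 - w1\<bar> * \<bar>w2\<bar> + \<bar>x1\<bar> * \<bar>x2 - w2\<bar>"
        unfolding abs_mult[symmetric] by linarith
      also have "\<dots> \<le> \<eta> + \<eta> * K + K * \<eta>" using that K1 by (intro add_mono mult_mono) auto
      finally show ?thesis by (simp add: algebra_simps)
    qed
    have "\<bar>(\<integral>\<omega>. shifted a \<omega> * shifted b \<omega> * shifted c \<omega> * shifted e \<omega> \<partial>M)
        - (\<integral>\<omega>. shifted a \<omega> * shifted b \<omega> \<partial>M) * (\<integral>\<omega>. shifted c \<omega> * shifted e \<omega> \<partial>M)\<bar> \<le> ?\<eta> * ?B * (1 + 2 * K)"
      by (rule comb[OF four[unfolded ind] two two]; rule bound2)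
        (auto intro: shifted_power4 X_le W_int W_le)
    then show "\<bar>(\<integral>\<omega>. shifted a \<omega> * shifted b \<omega> * shifted c \<omega> * shifted e \<omega> \<partial>M)
        - (\<integral>\<omega>. shifted a \<omega> * shifted b \<omega> \<partial>M) * (\<integral>\<omega>. shifted c \<omega> * shifted e \<omega> \<partial>M)\<bar> \<le> A * ?B * (1 + 2 * K) * \<kappa> ^ n"
      by (simp only: mult_ac)
  qed (use \<kappa> in auto)
qed

end

section \<open>Variance of the sample autocovariances\<close>

context contracting_field
begin

text \<open>The variance of the sample autocovariance at lag \<open>u\<close> is an average over pairs of sites \<open>j, i\<close> of
covariances of \<open>X\<^sub>j X\<^sub>j\<^sub>+\<^sub>u\<close> and \<open>X\<^sub>i X\<^sub>i\<^sub>+\<^sub>u\<close>. These decay in the smallest of the distances of \<open>j\<close> from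
\<open>i\<close>, \<open>i + u\<close> and \<open>i - u\<close>, so for fixed \<open>j\<close> their sum over \<open>i\<close> is bounded uniformly in \<open>u\<close>.\<close>

lemma autocov_noise_expectation:
  obtains B where "B > 0" "\<And>d u. integrable M (\<lambda>\<omega>. autocov_noise d \<omega> u)"
    "\<And>d u. fst d > 0 \<Longrightarrow> snd d > 0 \<Longrightarrow> (\<integral>\<omega>. autocov_noise d \<omega> u \<partial>M) \<le> sqrt (B / obs_size d)"
proof -
  obtain A \<kappa> where A: "A > 0" and \<kappa>: "0 < \<kappa>" "\<kappa> < 1"
    and decay: "\<And>n a b c e. 2 * int n \<le> max_norm (a - c) \<Longrightarrow> 2 * int n \<le> max_norm (a - e) \<Longrightarrow>
      2 * int n \<le> max_norm (b - c) \<Longrightarrow> 2 * int n \<le> max_norm (b - e) \<Longrightarrow>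
      \<bar>(\<integral>\<omega>. shifted a \<omega> * shifted b \<omega> * shifted c \<omega> * shifted e \<omega> \<partial>M)
        - (\<integral>\<omega>. shifted a \<omega> * shifted b \<omega> \<partial>M) * (\<integral>\<omega>. shifted c \<omega> * shifted e \<omega> \<partial>M)\<bar> \<le> A * \<kappa> ^ n"
    by (rule covariance_decay) blast
  define \<gamma> where "\<gamma> = autocov M V"
  define q where "q = (\<lambda>s :: int \<times> int. \<kappa> ^ (nat (max_norm s) div 2))"
  have q0: "0 \<le> q s" for s using \<kappa> by (simp add: q_def)
  have q_sum: "q summable_on UNIV" unfolding q_def by (rule geometric_summable_max_norm[OF \<kappa>])
  define H where "H = infsum q UNIV"
  have H0: "0 \<le> H" unfolding H_def by (intro infsum_nonneg q0)
  have q_shift: "(\<Sum>j\<in>J. q (p - j)) \<le> H" if "finite J" for J p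
  proof -
    have "(\<Sum>j\<in>J. q (p - j)) = sum q ((\<lambda>j. p - j) ` J)"
      by (subst sum.reindex) (auto simp: inj_on_def)
    also have "\<dots> \<le> H" unfolding H_def using that by (intro finite_sum_le_infsum q_sum) (auto intro: q0)
    finally show ?thesis .
  qed
  let ?Z = "\<lambda>u j \<omega>. shifted j \<omega> * shifted (j + u) \<omega>"
  have Z_int: "integrable M (?Z u j)" for u j
    using product4_integrable[of "shifted j" "shifted (j + u)" "\<lambda>_. 1" "\<lambda>_. 1"] shifted_power4 by simp
  have ZZ_int: "integrable M (\<lambda>\<omega>. ?Z u j \<omega> * ?Z u i \<omega>)" for u i j
    using product4_integrable[of "shifted j" "shifted (j + u)" "shifted i" "shifted (i + u)"] shifted_power4
    by (simp add: mult.assoc)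
  have Z_mean: "(\<integral>\<omega>. ?Z u j \<omega> \<partial>M) = \<gamma> u" for u j
  proof -
    have "(\<integral>\<omega>. ?Z u j \<omega> \<partial>M) = (\<integral>\<omega>. (V j \<omega> - \<mu>) * (V (j + u) \<omega> - \<mu>) \<partial>M)"
    proof (rule integral_cong_AE)
      show "AE \<omega> in M. ?Z u j \<omega> = (V j \<omega> - \<mu>) * (V (j + u) \<omega> - \<mu>)"
        using V_eq_shifted[of j] V_eq_shifted[of "j + u"] by eventually_elim simp
    qed measurable
    then show ?thesis by (simp add: centred_product_expectation \<gamma>_def)
  qed
  have cov: "(\<integral>\<omega>. (?Z u j \<omega> - \<gamma> u) * (?Z u i \<omega> - \<gamma> u) \<partial>M) \<le> A * (q (j - i) + q (j - u - i) + q (j + u - i))" for u j i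
  proof -
    have eq: "(\<integral>\<omega>. (?Z u j \<omega> - \<gamma> u) * (?Z u i \<omega> - \<gamma> u) \<partial>M) = (\<integral>\<omega>. ?Z u j \<omega> * ?Z u i \<omega> \<partial>M) - \<gamma> u * \<gamma> u"
    proof -
      have "(\<integral>\<omega>. (?Z u j \<omega> - \<gamma> u) * (?Z u i \<omega> - \<gamma> u) \<partial>M)
          = (\<integral>\<omega>. ?Z u j \<omega> * ?Z u i \<omega> - \<gamma> u * ?Z u j \<omega> - \<gamma> u * ?Z u i \<omega> + \<gamma> u * \<gamma> u \<partial>M)"
        by (intro Bochner_Integration.integral_cong refl) (simp add: algebra_simps)
      also have "\<dots> = (\<integral>\<omega>. ?Z u j \<omega> * ?Z u i \<omega> \<partial>M) - \<gamma> u * (\<integral>\<omega>. ?Z u j \<omega> \<partial>M) - \<gamma> u * (\<integral>\<omega>. ?Z u i \<omega> \<partial>M) + \<gamma> u * \<gamma> u"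
        using Z_int ZZ_int by (simp add: prob_space)
      finally show ?thesis by (simp add: Z_mean)
    qed
    define m where "m = min (max_norm (j - i)) (min (max_norm (j - (i + u))) (max_norm (j + u - i)))"
    let ?n = "nat m div 2"
    have m0: "0 \<le> m" by (simp add: m_def max_norm_nonneg)
    then have n2: "2 * int ?n \<le> m" by linarith
    have "\<bar>(\<integral>\<omega>. shifted j \<omega> * shifted (j + u) \<omega> * shifted i \<omega> * shifted (i + u) \<omega> \<partial>M)
        - (\<integral>\<omega>. ?Z u j \<omega> \<partial>M) * (\<integral>\<omega>. ?Z u i \<omega> \<partial>M)\<bar> \<le> A * \<kappa> ^ ?n"
      by (rule decay) (use n2 in \<open>auto simp: m_def\<close>)
    then have "(\<integral>\<omega>. ?Z u j \<omega> * ?Z u i \<omega> \<partial>M) - \<gamma> u * \<gamma> u \<le> A * \<kappa> ^ ?n"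
      by (simp add: Z_mean mult.assoc)
    also have "A * \<kappa> ^ ?n \<le> A * (q (j - i) + q (j - u - i) + q (j + u - i))"
    proof (rule mult_left_mono)
      have e: "j - (i + u) = j - u - i" by simp
      have "\<kappa> ^ ?n = q (j - i) \<or> \<kappa> ^ ?n = q (j - u - i) \<or> \<kappa> ^ ?n = q (j + u - i)"
        unfolding q_def m_def e min_def by presburger
      then show "\<kappa> ^ ?n \<le> q (j - i) + q (j - u - i) + q (j + u - i)"
        using q0[of "j - i"] q0[of "j - u - i"] q0[of "j + u - i"] by linarith
    qed (use A in auto)
    finally show ?thesis unfolding eq .
  qed
  have variance: "(\<integral>\<omega>. (sample_autocov \<mu> d (\<lambda>t. V t \<omega>) u - \<gamma> u * lag_fraction d u)\<^sup>2 \<partial>M) \<le> (3 * A * H) / obs_size d"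
    and variance_int: "integrable M (\<lambda>\<omega>. (sample_autocov \<mu> d (\<lambda>t. V t \<omega>) u - \<gamma> u * lag_fraction d u)\<^sup>2)"
    if d: "fst d > 0" "snd d > 0" for d u
  proof -
    define J where "J = {j \<in> obs_region d. j + u \<in> obs_region d}"
    have J: "finite J" "card J \<le> card (obs_region d)" unfolding J_def by (auto intro: card_mono)
    have T: "obs_size d > 0" using d by (simp add: obs_size_def)
    have cardT: "real (card (obs_region d)) = obs_size d" by (simp add: obs_region_def obs_size_def)
    have all: "AE \<omega> in M. \<forall>t. V t \<omega> - \<mu> = shifted t \<omega>"
      using V_eq_shifted by (simp add: AE_all_countable)
    let ?Q = "\<lambda>\<omega>. (\<Sum>j\<in>J. \<Sum>i\<in>J. (?Z u j \<omega> - \<gamma> u) * (?Z u i \<omega> - \<gamma> u)) / (obs_size d)\<^sup>2"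
    have eq: "AE \<omega> in M. ?Q \<omega> = (sample_autocov \<mu> d (\<lambda>t. V t \<omega>) u - \<gamma> u * lag_fraction d u)\<^sup>2"
      using all
    proof eventually_elim
      case (elim \<omega>)
      have "sample_autocov \<mu> d (\<lambda>t. V t \<omega>) u - \<gamma> u * lag_fraction d u
          = (\<Sum>j\<in>J. ?Z u j \<omega>) / obs_size d - \<gamma> u * (real (card J) / obs_size d)"
        unfolding sample_autocov_def lag_fraction_def J_def elim[rule_format] ..
      also have "\<dots> = (\<Sum>j\<in>J. ?Z u j \<omega> - \<gamma> u) / obs_size d"
        by (simp add: sum_subtractf diff_divide_distrib)
      finally show ?case by (simp add: power_divide power2_eq_square sum_product)
    qed
    have prod_int: "integrable M (\<lambda>\<omega>. (?Z u j \<omega> - \<gamma> u) * (?Z u i \<omega> - \<gamma> u))" for i j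
    proof -
      have "integrable M (\<lambda>\<omega>. ?Z u j \<omega> * ?Z u i \<omega> - \<gamma> u * ?Z u j \<omega> - \<gamma> u * ?Z u i \<omega> + \<gamma> u * \<gamma> u)"
        by (intro Bochner_Integration.integrable_add Bochner_Integration.integrable_diff integrable_mult_right Z_int ZZ_int) simp
      then show ?thesis by (simp add: algebra_simps)
    qed
    have Q_int: "integrable M ?Q"
      by (intro integrable_divide_zero Bochner_Integration.integrable_sum prod_int)
    show "integrable M (\<lambda>\<omega>. (sample_autocov \<mu> d (\<lambda>t. V t \<omega>) u - \<gamma> u * lag_fraction d u)\<^sup>2)"
      by (rule integrable_cong_AE_imp[OF Q_int _ eq]) measurable
    have "(\<integral>\<omega>. (sample_autocov \<mu> d (\<lambda>t. V t \<omega>) u - \<gamma> u * lag_fraction d u)\<^sup>2 \<partial>M) = integral\<^sup>L M ?Q"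
      by (rule integral_cong_AE[symmetric, OF _ _ eq]) measurable
    also have "\<dots> = (\<Sum>j\<in>J. \<Sum>i\<in>J. \<integral>\<omega>. (?Z u j \<omega> - \<gamma> u) * (?Z u i \<omega> - \<gamma> u) \<partial>M) / (obs_size d)\<^sup>2"
      using prod_int by (simp add: Bochner_Integration.integral_sum)
    also have "\<dots> \<le> (\<Sum>j\<in>J. 3 * A * H) / (obs_size d)\<^sup>2"
    proof (intro divide_right_mono sum_mono)
      fix j
      have "(\<Sum>i\<in>J. \<integral>\<omega>. (?Z u j \<omega> - \<gamma> u) * (?Z u i \<omega> - \<gamma> u) \<partial>M)
          \<le> (\<Sum>i\<in>J. A * (q (j - i) + q (j - u - i) + q (j + u - i)))"
        by (intro sum_mono cov)
      also have "\<dots> = A * ((\<Sum>i\<in>J. q (j - i)) + (\<Sum>i\<in>J. q (j - u - i)) + (\<Sum>i\<in>J. q (j + u - i)))"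
        by (simp only: sum_distrib_left[symmetric] sum.distrib)
      also have "\<dots> \<le> A * (H + H + H)"
        using A by (intro mult_left_mono add_mono q_shift J) auto
      finally show "(\<Sum>i\<in>J. \<integral>\<omega>. (?Z u j \<omega> - \<gamma> u) * (?Z u i \<omega> - \<gamma> u) \<partial>M) \<le> 3 * A * H" by simp
    qed simp
    also have "\<dots> = real (card J) * (3 * A * H) / (obs_size d)\<^sup>2" by simp
    also have "\<dots> \<le> obs_size d * (3 * A * H) / (obs_size d)\<^sup>2"
      using J(2) A H0 unfolding cardT[symmetric] by (intro divide_right_mono mult_right_mono) auto
    also have "\<dots> = 3 * A * H / obs_size d" using T by (simp add: power2_eq_square)
    finally show "(\<integral>\<omega>. (sample_autocov \<mu> d (\<lambda>t. V t \<omega>) u - \<gamma> u * lag_fraction d u)\<^sup>2 \<partial>M) \<le> (3 * A * H) / obs_size d" .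
  qed
  have noise_int: "integrable M (\<lambda>\<omega>. autocov_noise d \<omega> u)" for d u
    unfolding autocov_noise_def
    by (intro integrable_abs Bochner_Integration.integrable_diff sample_autocov_integrable) simp
  have "(\<integral>\<omega>. autocov_noise d \<omega> u \<partial>M) \<le> sqrt ((3 * A * H + 1) / obs_size d)" if d: "fst d > 0" "snd d > 0" for d u
  proof (rule real_le_rsqrt)
    have T: "obs_size d > 0" using d by (simp add: obs_size_def)
    have sq: "(autocov_noise d \<omega> u)\<^sup>2 = (sample_autocov \<mu> d (\<lambda>t. V t \<omega>) u - \<gamma> u * lag_fraction d u)\<^sup>2" for \<omega>
      by (simp add: autocov_noise_def \<gamma>_def)
    have "(\<integral>\<omega>. autocov_noise d \<omega> u \<partial>M)\<^sup>2 \<le> (\<integral>\<omega>. (autocov_noise d \<omega> u)\<^sup>2 \<partial>M)"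
    proof -
      have i2: "integrable M (\<lambda>\<omega>. (autocov_noise d \<omega> u)\<^sup>2)" unfolding sq by (rule variance_int[OF d])
      show ?thesis
        using variance_eq[OF noise_int i2] variance_positive[of "\<lambda>\<omega>. autocov_noise d \<omega> u"] by simp
    qed
    also have "\<dots> \<le> 3 * A * H / obs_size d" unfolding sq by (rule variance[OF d])
    also have "\<dots> \<le> (3 * A * H + 1) / obs_size d" using T by (intro divide_right_mono) auto
    finally show "(\<integral>\<omega>. autocov_noise d \<omega> u \<partial>M)\<^sup>2 \<le> (3 * A * H + 1) / obs_size d" .
  qed
  with noise_int A H0 show thesis
    by (intro that[of "3 * A * H + 1"]) (auto intro: add_nonneg_pos)
qed

end

section \<open>Consistency of the kernel estimator\<close>

lemma inv_fourier_isCont: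
  assumes K: "integrable lborel K"
  shows "isCont (inv_fourier K) x"
proof (rule continuous_at_sequentiallyI)
  fix X :: "nat \<Rightarrow> real \<times> real" assume X: "X \<longlonglongrightarrow> x"
  have [measurable]: "K \<in> borel_measurable borel" using K by auto
  have e_meas [measurable]: "(\<lambda>l. exp (\<i> * complex_of_real (y \<bullet> l))) \<in> borel_measurable borel" for y :: "real \<times> real"
    by (intro borel_measurable_continuous_onI continuous_intros)
  show "(\<lambda>n. inv_fourier K (X n)) \<longlonglongrightarrow> inv_fourier K x"
    unfolding inv_fourier_def
  proof (rule integral_dominated_convergence[where w = "\<lambda>l. norm (K l)"])
    show "integrable lborel (\<lambda>l. norm (K l))" using K by simp
    show "AE l in lborel. (\<lambda>n. of_real (K l) * exp (\<i> * of_real (X n \<bullet> l))) \<longlonglongrightarrow> of_real (K l) * exp (\<i> * of_real (x \<bullet> l))"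
      by (intro AE_I2 tendsto_intros X)
    show "AE l in lborel. norm (complex_of_real (K l) * exp (\<i> * of_real (X n \<bullet> l))) \<le> norm (K l)" for n
      by (intro AE_I2) (simp add: norm_mult)
  qed measurable
qed

lemma inv_fourier_norm_le:
  assumes "integrable lborel K" "\<And>l. 0 \<le> K l"
  shows "cmod (inv_fourier K x) \<le> integral\<^sup>L lborel K"
proof -
  have "cmod (inv_fourier K x) \<le> (\<integral>l. norm (complex_of_real (K l) * exp (\<i> * of_real (x \<bullet> l))) \<partial>lborel)"
    unfolding inv_fourier_def by (rule integral_norm_bound)
  also have "\<dots> = integral\<^sup>L lborel K" using assms(2) by (simp add: norm_mult)
  finally show ?thesis .
qed

lemma inv_fourier_0: "inv_fourier K 0 = of_real (integral\<^sup>L lborel K)"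
  by (simp add: inv_fourier_def)

text \<open>Symmetry in each coordinate carries monotonicity and integrability from the quadrant to the plane.\<close>

lemma radial_majorant_of_quadrant:
  fixes g :: "real \<times> real \<Rightarrow> real"
  assumes nonneg: "\<And>x. 0 \<le> g x"
    and even: "\<And>x1 x2. g (- x1, x2) = g (x1, x2) \<and> g (x1, - x2) = g (x1, x2)"
    and mono: "\<And>x y. x \<in> {0..} \<times> {0..} \<Longrightarrow> y \<in> {0..} \<times> {0..} \<Longrightarrow> max_norm x \<le> max_norm y \<Longrightarrow> g y \<le> g x"
    and int: "set_integrable lborel ({0..} \<times> {0..}) g"
  shows "radial_majorant g"
proof
  have g_abs: "g x = g (\<bar>fst x\<bar>, \<bar>snd x\<bar>)" for x
    using even[of "fst x" "snd x"] even[of "\<bar>fst x\<bar>" "snd x"] by (cases x) (auto simp: abs_if even)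
  show "0 \<le> g x" for x by (rule nonneg)
  show "g y \<le> g x" if "max_norm x \<le> max_norm y" for x y
    unfolding g_abs[of x] g_abs[of y] by (rule mono) (use that in \<open>auto simp: max_norm_def\<close>)
  define f where "f = (\<lambda>x. indicator ({0..} \<times> {0..}) x * g x)"
  have f_int: "integrable lborel f" using int by (simp add: set_integrable_def f_def)
  then have [measurable]: "f \<in> borel_measurable borel" by auto
  have g_f: "g x = f (\<bar>fst x\<bar>, \<bar>snd x\<bar>)" for x by (simp add: f_def g_abs[of x])
  have abs_meas: "(\<lambda>x :: real \<times> real. (\<bar>fst x\<bar>, \<bar>snd x\<bar>)) \<in> borel_measurable borel"
    by (intro borel_measurable_continuous_onI continuous_intros)
  have "g = (\<lambda>x. f (\<bar>fst x\<bar>, \<bar>snd x\<bar>))" using g_f by (rule ext)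
  then have "g \<in> borel_measurable borel"
    using measurable_compose[OF abs_meas, of f borel] by simp
  moreover have f0: "0 \<le> f x" for x by (simp add: f_def nonneg)
  let ?s = "\<lambda>x. f (1 * fst x, 1 * snd x) + f (-1 * fst x, 1 * snd x) + f (1 * fst x, -1 * snd x) + f (-1 * fst x, -1 * snd x)"
  have "integrable lborel ?s"
    by (intro Bochner_Integration.integrable_add integrable_diagonal_scaling f_int) auto
  moreover have "norm (g x) \<le> norm (?s x)" for x
  proof -
    have "g x \<le> ?s x"
      using f0[of x] f0[of "(- fst x, snd x)"] f0[of "(fst x, - snd x)"] f0[of "(- fst x, - snd x)"]
      unfolding g_f[of x] by (cases "0 \<le> fst x"; cases "0 \<le> snd x") auto
    then show ?thesis using nonneg[of x] by simp
  qed
  ultimately show "integrable lborel g"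
    by (intro Bochner_Integration.integrable_bound[of lborel ?s g]) auto
qed

lemma radial_majorant_square: "radial_majorant (indicator {x. max_norm x \<le> 1})"
proof
  have box: "{x :: real \<times> real. max_norm x \<le> 1} = cbox (-1, -1) (1, 1)"
    by (auto simp: max_norm_def cbox_def Basis_plane inner_prod_def abs_le_iff)
  show "integrable lborel (indicator {x :: real \<times> real. max_norm x \<le> 1} :: _ \<Rightarrow> real)"
    unfolding box
    by (rule integrable_real_indicator[OF _ emeasure_lborel_cbox_finite]) simp
qed (auto simp: indicator_def)

context stationary_field
begin

text \<open>The noise is left as a hypothesis, because it is the only term that the two parts of the theorem
treat differently.\<close>

lemma kernel_estimator_consistent:
  fixes d :: "nat \<Rightarrow> nat \<times> nat" and h :: "nat \<Rightarrow> real \<times> real" and g :: "real \<times> real \<Rightarrow> real"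
    and f :: "real \<times> real \<Rightarrow> real" and C :: real and \<delta> :: "nat \<Rightarrow> real" and W :: "nat \<Rightarrow> int \<times> int \<Rightarrow> real"
  assumes hd: "filterlim (\<lambda>n. fst (h n) * real (fst (d n))) at_top sequentially"
      "filterlim (\<lambda>n. snd (h n) * real (snd (d n))) at_top sequentially"
    and \<gamma>: "(\<lambda>u. \<bar>autocov M V u\<bar>) summable_on UNIV"
    and C: "C > 0" and \<delta>: "\<delta> \<longlonglongrightarrow> 0"
    and bound: "\<forall>\<^sub>F n in sequentially. \<forall>v l. \<bar>spec_est K (h n) (d n) v l - f l\<bar> \<le>
        C * (\<Sum>u\<in>lags (d n). \<bar>sample_autocov \<mu> (d n) v u - autocov M V u * lag_fraction (d n) u\<bar> * W n u)
        + C / (prod_abs (h n) * obs_size (d n)) * mean_periodogram \<mu> (d n) v + \<delta> n"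
    and noise: "conv_in_prob M (\<lambda>n \<omega>. C * (\<Sum>u\<in>lags (d n). autocov_noise (d n) \<omega> u * W n u)) 0"
    and I: "I \<noteq> {}"
  shows "conv_in_prob M (\<lambda>n \<omega>. SUP l\<in>I. \<bar>spec_est K (h n) (d n) (\<lambda>t. V t \<omega>) l - f l\<bar>) 0"
proof -
  let ?G = "\<Sum>\<^sub>\<infinity>u. \<bar>autocov M V u\<bar>"
  let ?c = "\<lambda>n. C / (prod_abs (h n) * obs_size (d n))"
  have size0: "0 \<le> obs_size (d n)" for n by (simp add: obs_size_def)
  have c0: "0 \<le> ?c n" for n using C size0 by (simp add: prod_abs_def)
  have "filterlim (\<lambda>n. (fst (h n) * real (fst (d n))) * (snd (h n) * real (snd (d n)))) at_top sequentially"
    by (rule filterlim_at_top_mult_at_top[OF hd])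
  then have "(\<lambda>n. \<bar>C / ((fst (h n) * real (fst (d n))) * (snd (h n) * real (snd (d n))))\<bar>) \<longlonglongrightarrow> \<bar>0\<bar>"
    by (intro tendsto_rabs tendsto_divide_0[OF tendsto_const] filterlim_at_top_imp_at_infinity)
  moreover have "\<bar>C / ((fst (h n) * real (fst (d n))) * (snd (h n) * real (snd (d n))))\<bar> = ?c n" for n
    using C by (simp add: prod_abs_def obs_size_def abs_mult mult_ac)
  ultimately have c_lim: "?c \<longlonglongrightarrow> 0" by simp
  have d_pos: "\<forall>\<^sub>F n in sequentially. 0 < fst (d n) \<and> 0 < snd (d n)"
  proof -
    have pos: "0 < n" if "1 \<le> x * real n" for x n using that by (cases "n = 0") auto
    have "\<forall>\<^sub>F n in sequentially. 1 \<le> fst (h n) * real (fst (d n)) \<and> 1 \<le> snd (h n) * real (snd (d n))"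
      using hd by (intro eventually_conj) (simp_all add: filterlim_at_top)
    then show ?thesis by eventually_elim (use pos in blast)
  qed
  let ?P = "\<lambda>n \<omega>. ?c n * mean_periodogram \<mu> (d n) (\<lambda>t. V t \<omega>)"
  have P0: "0 \<le> mean_periodogram \<mu> (d n) v" for n v using size0 by (simp add: mean_periodogram_def)
  have "conv_in_prob M ?P 0"
  proof (rule conv_in_prob_L1)
    show "integrable M (?P n)" for n by (intro integrable_mult_right mean_periodogram_integrable)
    show "0 \<le> ?P n \<omega>" for n \<omega> using c0 P0 by (intro mult_nonneg_nonneg)
    show "(\<lambda>n. \<integral>\<omega>. ?P n \<omega> \<partial>M) \<longlonglongrightarrow> 0"
    proof (rule tendsto_sandwich[where f = "\<lambda>_. 0" and h = "\<lambda>n. ?c n * ?G"])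
      show "(\<lambda>n. ?c n * ?G) \<longlonglongrightarrow> 0" using tendsto_mult[OF c_lim tendsto_const[of ?G]] by simp
      show "\<forall>\<^sub>F n in sequentially. 0 \<le> (\<integral>\<omega>. ?P n \<omega> \<partial>M)"
        using c0 P0 by (intro always_eventually allI Bochner_Integration.integral_nonneg mult_nonneg_nonneg)
      show "\<forall>\<^sub>F n in sequentially. (\<integral>\<omega>. ?P n \<omega> \<partial>M) \<le> ?c n * ?G"
        using d_pos
      proof eventually_elim
        case (elim n)
        have "(\<integral>\<omega>. ?P n \<omega> \<partial>M) = ?c n * (\<integral>\<omega>. mean_periodogram \<mu> (d n) (\<lambda>t. V t \<omega>) \<partial>M)" by simp
        also have "\<dots> \<le> ?c n * ?G"
          using elim c0 by (intro mult_left_mono mean_periodogram_expectation_le \<gamma>) auto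
        finally show ?case .
      qed
    qed simp
  qed
  from conv_in_prob_add[OF prob_space_axioms conv_in_prob_add[OF prob_space_axioms noise this] conv_in_prob_const[OF \<delta>]]
  show ?thesis
  proof (rule conv_in_prob_dominated)
    show "\<forall>\<^sub>F n in sequentially. \<forall>\<omega>\<in>space M. \<bar>SUP l\<in>I. \<bar>spec_est K (h n) (d n) (\<lambda>t. V t \<omega>) l - f l\<bar>\<bar>
        \<le> \<bar>C * (\<Sum>u\<in>lags (d n). autocov_noise (d n) \<omega> u * W n u) + ?P n \<omega> + \<delta> n\<bar>"
      using bound
    proof eventually_elim
      case (elim n)
      show ?case
      proof
        fix \<omega>
        have "\<bar>SUP l\<in>I. \<bar>spec_est K (h n) (d n) (\<lambda>t. V t \<omega>) l - f l\<bar>\<bar>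
            \<le> C * (\<Sum>u\<in>lags (d n). autocov_noise (d n) \<omega> u * W n u) + ?P n \<omega> + \<delta> n"

          by (rule abs_SUP_le[OF I], intro conjI abs_ge_zero, unfold autocov_noise_def, rule elim[rule_format])
        then show "\<bar>SUP l\<in>I. \<bar>spec_est K (h n) (d n) (\<lambda>t. V t \<omega>) l - f l\<bar>\<bar>
            \<le> \<bar>C * (\<Sum>u\<in>lags (d n). autocov_noise (d n) \<omega> u * W n u) + ?P n \<omega> + \<delta> n\<bar>"
          by (rule order_trans[OF _ abs_ge_self])
      qed
    qed
  qed
qed

end

theorem theorem5p1:
  fixes M :: "'w measure"
    and V :: "int \<times> int \<Rightarrow> 'w \<Rightarrow> real" and \<mu> :: real
    and d :: "nat \<Rightarrow> nat \<times> nat" and h :: "nat \<Rightarrow> real \<times> real"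
    and K :: "real \<times> real \<Rightarrow> real"
    and S :: "'e measure" and G :: "(int \<times> int \<Rightarrow> 'e) \<Rightarrow> real"
    and \<epsilon> \<epsilon>' :: "int \<times> int \<Rightarrow> 'w \<Rightarrow> 'e"
  defines "k \<equiv> inv_fourier K"
  defines "f \<equiv> spectral_density M V"
  defines "max_dev \<equiv> \<lambda>n \<omega>. SUP l\<in>{0..2*pi} \<times> {0..2*pi}.
             \<bar>spec_est K (h n) (d n) (\<lambda>t. V t \<omega>) l - f l\<bar>"
  assumes prob: "prob_space M"
    and stationary: "weakly_stationary M V"
    and mean: "(\<integral>\<omega>. V 0 \<omega> \<partial>M) = \<mu>"
    and d1: "filterlim (\<lambda>n. fst (d n)) at_top sequentially"
    and d2: "filterlim (\<lambda>n. snd (d n)) at_top sequentially"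
    and h_to_0: "(\<lambda>n. fst (h n)) \<longlonglongrightarrow> 0" "(\<lambda>n. snd (h n)) \<longlonglongrightarrow> 0"
    and h_asymp: "(\<lambda>n. fst (h n)) \<in> O(\<lambda>n. snd (h n))" "(\<lambda>n. snd (h n)) \<in> O(\<lambda>n. fst (h n))"
    and hd: "filterlim (\<lambda>n. fst (h n) * real (fst (d n))) at_top sequentially"
            "filterlim (\<lambda>n. snd (h n) * real (snd (d n))) at_top sequentially"
    and growth: "\<exists>\<xi> c1 c2. 0 < \<xi> \<and> \<xi> \<le> 1/2 \<and> 0 < c1 \<and> 0 < c2 \<and>
          (\<forall>\<^sub>F n in sequentially. real (fst (d n)) > c1 * obs_size (d n) powr \<xi> \<and>
                                   real (snd (d n)) > c2 * obs_size (d n) powr \<xi>)"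
    and autocov_summable: "(\<lambda>j. \<bar>autocov M V j\<bar>) summable_on UNIV"
    and K_nonneg: "\<And>l. K l \<ge> 0"
    and K_even: "\<And>l. K (- l) = K l"
    and K_integral: "integrable lborel K" "(\<integral>l. K l \<partial>lborel) = 1"
    and K_riemann: "(\<lambda>n. 4 * pi\<^sup>2 / (prod_abs (h n) * obs_size (d n)) *
          (\<Sum>\<^sub>\<infinity>j. K (2 * pi * real_of_int (fst j) / (fst (h n) * real (fst (d n))),
                     2 * pi * real_of_int (snd j) / (snd (h n) * real (snd (d n))))))
          \<longlonglongrightarrow> 1"
    and K_fourier: "\<And>l. complex_of_real (K l) = fourier k l"
  shows
    "((\<exists>kt v.
          integrable lborel (\<lambda>l. \<bar>K l\<bar>) \<and>
          (\<forall>x. cmod (k x) \<le> kt x) \<and>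
          (\<forall>x1 x2. kt (- x1, x2) = kt (x1, x2) \<and> kt (x1, - x2) = kt (x1, x2)) \<and>
          (\<forall>x\<in>{0..} \<times> {0..}. \<forall>y\<in>{0..} \<times> {0..}. max_norm x \<le> max_norm y \<longrightarrow> kt x \<ge> kt y) \<and>
          set_integrable lborel ({0..} \<times> {0..}) (kt :: real \<times> real \<Rightarrow> real) \<and>
          0 < v \<and> v \<le> 1/2 \<and>
          bigO_prob M
            (\<lambda>n \<omega>. SUP r. \<bar>sample_autocov \<mu> (d n) (\<lambda>t. V t \<omega>) r
                      - (\<integral>\<omega>'. sample_autocov \<mu> (d n) (\<lambda>t. V t \<omega>') r \<partial>M)\<bar>)
            (\<lambda>n. obs_size (d n) powr (- v)) \<and>
          (\<lambda>n. prod_abs (h n) + inverse (prod_abs (h n)) * obs_size (d n) powr (- v)) \<longlonglongrightarrow> 0)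
       \<longrightarrow> conv_in_prob M max_dev 0) \<and>
     ((iid_with_copy M S \<epsilon> \<epsilon>' \<and> bernoulli_shift M S V \<mu> G \<epsilon> \<and>
       (\<exists>L. L-lipschitz_on UNIV k) \<and>
       closure {x. k x \<noteq> 0} = {-1..1} \<times> {-1..1} \<and>
       (\<exists>c>0. \<forall>l\<in>{0..2*pi} \<times> {0..2*pi}. f l \<ge> c) \<and>
       (\<exists>p\<ge>2. p_stable M p V \<mu> G \<epsilon> \<epsilon>') \<and>
       geometric_moment_contraction M V \<mu> G \<epsilon> \<epsilon>' \<and>
       (\<exists>\<phi> \<eta>. 4 < \<phi> \<and> \<phi> \<le> 8 \<and> integrable M (\<lambda>\<omega>. \<bar>V 0 \<omega>\<bar> powr \<phi>) \<and>
          0 < \<eta> \<and> \<eta> < (\<phi> - 4) / \<phi> \<and>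
          (\<lambda>n. prod_abs (h n)) \<longlonglongrightarrow> 0 \<and>
          (\<lambda>n. inverse (prod_abs (h n) * obs_size (d n) powr \<eta>)) \<in> O(\<lambda>_. 1)))
       \<longrightarrow> conv_in_prob M max_dev 0)"
proof -
  have field: "stationary_field M V \<mu>"
    using prob stationary mean by (simp add: stationary_field_def stationary_field_axioms_def)
  interpret stationary_field M V \<mu> by (rule field)
  note \<gamma> = autocov_summable
  have prod_nonneg: "0 \<le> prod_abs (h n)" for n by (simp add: prod_abs_def)
  have noise_nonneg: "0 \<le> autocov_noise d \<omega> u" for d \<omega> u by (simp add: autocov_noise_def)
  have consistency: "conv_in_prob M max_dev 0"
    if g: "radial_majorant g" and dominated: "\<And>x. cmod (k x) \<le> g x"
      and noise: "\<And>C. C > 0 \<Longrightarrow>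
        \<forall>\<^sub>F n in sequentially. (\<Sum>u\<in>lags (d n). radial_majorant.coset_mass g (fst (h n)) (snd (h n)) (d n) u) \<le> C / prod_abs (h n) \<Longrightarrow>
        \<forall>\<^sub>F n in sequentially. 0 < prod_abs (h n) \<Longrightarrow>
        conv_in_prob M (\<lambda>n \<omega>. C * (\<Sum>u\<in>lags (d n). autocov_noise (d n) \<omega> u
            * radial_majorant.coset_mass g (fst (h n)) (snd (h n)) (d n) u)) 0"
    for g :: "real \<times> real \<Rightarrow> real"
  proof -
    interpret radial_majorant g by (rule g)
    interpret dominated_kernel g K k
    proof
      show "isCont k x" for x unfolding k_def by (rule inv_fourier_isCont[OF K_integral(1)])
    qed (use K_nonneg K_fourier dominated in auto)
    have k0: "k 0 = 1" using K_integral(2) by (simp add: k_def inv_fourier_0)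
    have "normalization (h n) (d n) = (\<Sum>\<^sub>\<infinity>j. K (2 * pi * real_of_int (fst j) / (fst (h n) * real (fst (d n))),
        2 * pi * real_of_int (snd j) / (snd (h n) * real (snd (d n)))))" for n
      unfolding normalization_def by (intro infsum_cong) (simp add: fourier_freq_def mult.commute)
    then have riemann: "(\<lambda>n. 4 * pi\<^sup>2 / (prod_abs (h n) * obs_size (d n)) * normalization (h n) (d n)) \<longlonglongrightarrow> 1"
      using K_riemann by simp
    have f: "f l = Re (1 / (4 * of_real pi ^ 2) * (\<Sum>\<^sub>\<infinity>j. exp (- \<i> * of_real (l \<bullet> real_pair j)) * of_real (autocov M V j)))" for l
      by (simp only: f_def spectral_density_def)
    obtain C \<delta> where C: "C > 0" and \<delta>: "\<delta> \<longlonglongrightarrow> 0"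
      and bound: "\<forall>\<^sub>F n in sequentially. \<forall>v l. \<bar>spec_est K (h n) (d n) v l - f l\<bar> \<le>
        C * (\<Sum>u\<in>lags (d n). \<bar>sample_autocov \<mu> (d n) v u - autocov M V u * lag_fraction (d n) u\<bar>
              * coset_mass (fst (h n)) (snd (h n)) (d n) u)
        + C / (prod_abs (h n) * obs_size (d n)) * mean_periodogram \<mu> (d n) v + \<delta> n"
      and mass: "\<forall>\<^sub>F n in sequentially. (\<Sum>u\<in>lags (d n). coset_mass (fst (h n)) (snd (h n)) (d n) u) \<le> C / prod_abs (h n)"
      and pos: "\<forall>\<^sub>F n in sequentially. 0 < prod_abs (h n)"
      by (rule uniform_deviation_bound[OF k0 d1 d2 h_to_0 h_asymp hd \<gamma> riemann f]) blast
    show ?thesis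
      unfolding max_dev_def
      by (rule kernel_estimator_consistent[OF hd \<gamma> C \<delta> bound noise[OF C mass pos]]) auto
  qed
  show ?thesis
  proof (intro conjI impI, goal_cases)
    case 1
    then obtain kt v where kt: "\<And>x. cmod (k x) \<le> kt x"
        "\<And>x1 x2. kt (- x1, x2) = kt (x1, x2) \<and> kt (x1, - x2) = kt (x1, x2)"
        "\<And>x y. x \<in> {0..} \<times> {0..} \<Longrightarrow> y \<in> {0..} \<times> {0..} \<Longrightarrow> max_norm x \<le> max_norm y \<Longrightarrow> kt y \<le> kt x"
        "set_integrable lborel ({0..} \<times> {0..}) kt"
      and O: "bigO_prob M
            (\<lambda>n \<omega>. SUP r. \<bar>sample_autocov \<mu> (d n) (\<lambda>t. V t \<omega>) r
                      - (\<integral>\<omega>'. sample_autocov \<mu> (d n) (\<lambda>t. V t \<omega>') r \<partial>M)\<bar>)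
            (\<lambda>n. obs_size (d n) powr (- v))"
      and lim: "(\<lambda>n. prod_abs (h n) + inverse (prod_abs (h n)) * obs_size (d n) powr (- v)) \<longlonglongrightarrow> 0"
      by blast
    have maj: "radial_majorant kt"
      by (rule radial_majorant_of_quadrant) (use kt order_trans[OF norm_ge_zero kt(1)] in auto)
    let ?Z = "\<lambda>n \<omega>. SUP u. autocov_noise (d n) \<omega> u"
    have O': "bigO_prob M ?Z (\<lambda>n. obs_size (d n) powr (- v))"
      using O by (simp add: autocov_noise_def sample_autocov_expectation)
    show "conv_in_prob M max_dev 0"
    proof (rule consistency[OF maj kt(1)])
      fix C :: real
      let ?m = "\<lambda>n. radial_majorant.coset_mass kt (fst (h n)) (snd (h n)) (d n)"
      assume C: "C > 0" and mass: "\<forall>\<^sub>F n in sequentially. (\<Sum>u\<in>lags (d n). ?m n u) \<le> C / prod_abs (h n)"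
      define w where "w = (\<lambda>n. C * (C / prod_abs (h n)))"
      have w0: "0 \<le> w n" for n using C prod_nonneg by (simp add: w_def)
      have "(\<lambda>n. inverse (prod_abs (h n)) * obs_size (d n) powr (- v)) \<longlonglongrightarrow> 0"
      proof (rule tendsto_sandwich[OF _ _ tendsto_const lim])
        show "\<forall>\<^sub>F n in sequentially. 0 \<le> inverse (prod_abs (h n)) * obs_size (d n) powr (- v)"
          using prod_nonneg by (intro always_eventually allI mult_nonneg_nonneg) auto
        show "\<forall>\<^sub>F n in sequentially. inverse (prod_abs (h n)) * obs_size (d n) powr (- v)
            \<le> prod_abs (h n) + inverse (prod_abs (h n)) * obs_size (d n) powr (- v)"
          using prod_nonneg by (intro always_eventually allI) simp
      qed
      from tendsto_mult[OF tendsto_const[of "C * C"] this]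
      have w_lim: "(\<lambda>n. obs_size (d n) powr (- v) * w n) \<longlonglongrightarrow> 0"
        by (simp add: w_def divide_inverse mult_ac)
      have "conv_in_prob M (\<lambda>n \<omega>. ?Z n \<omega> * w n) 0"
        by (rule conv_in_prob_of_bigO_prob[OF prob O' sup_autocov_noise_measurable w0 w_lim])
      then show "conv_in_prob M (\<lambda>n \<omega>. C * (\<Sum>u\<in>lags (d n). autocov_noise (d n) \<omega> u * ?m n u)) 0"
      proof (rule conv_in_prob_dominated)
        have m0: "0 \<le> ?m n u" for n u by (rule radial_majorant.coset_mass_nonneg[OF maj])
        show "\<forall>\<^sub>F n in sequentially. \<forall>\<omega>\<in>space M.
            \<bar>C * (\<Sum>u\<in>lags (d n). autocov_noise (d n) \<omega> u * ?m n u)\<bar> \<le> \<bar>?Z n \<omega> * w n\<bar>"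
          using mass
        proof eventually_elim
          case (elim n)
          show ?case
          proof
            fix \<omega>
            have Z0: "0 \<le> ?Z n \<omega>" by (rule order_trans[OF noise_nonneg autocov_noise_le_sup])
            have "(\<Sum>u\<in>lags (d n). autocov_noise (d n) \<omega> u * ?m n u) \<le> (\<Sum>u\<in>lags (d n). ?Z n \<omega> * ?m n u)"
              by (intro sum_mono mult_right_mono autocov_noise_le_sup m0)
            also have "\<dots> = ?Z n \<omega> * (\<Sum>u\<in>lags (d n). ?m n u)" by (rule sum_distrib_left[symmetric])
            also have "\<dots> \<le> ?Z n \<omega> * (C / prod_abs (h n))" by (intro mult_left_mono elim Z0)
            finally have "C * (\<Sum>u\<in>lags (d n). autocov_noise (d n) \<omega> u * ?m n u) \<le> C * (?Z n \<omega> * (C / prod_abs (h n)))"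
              using C by (intro mult_left_mono) auto
            also have "\<dots> = ?Z n \<omega> * w n" by (simp add: w_def)
            finally have "C * (\<Sum>u\<in>lags (d n). autocov_noise (d n) \<omega> u * ?m n u) \<le> ?Z n \<omega> * w n" .
            moreover have "0 \<le> C * (\<Sum>u\<in>lags (d n). autocov_noise (d n) \<omega> u * ?m n u)"
              using C by (intro mult_nonneg_nonneg sum_nonneg noise_nonneg m0) auto
            ultimately show "\<bar>C * (\<Sum>u\<in>lags (d n). autocov_noise (d n) \<omega> u * ?m n u)\<bar> \<le> \<bar>?Z n \<omega> * w n\<bar>"
              by simp
          qed
        qed
      qed
    qed
  next
    case 2
    note b = this
    then obtain \<phi> \<eta> where \<phi>: "4 < \<phi>" "\<phi> \<le> 8" "integrable M (\<lambda>\<omega>. \<bar>V 0 \<omega>\<bar> powr \<phi>)"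
      and \<eta>: "\<eta> < (\<phi> - 4) / \<phi>" "(\<lambda>n. inverse (prod_abs (h n) * obs_size (d n) powr \<eta>)) \<in> O(\<lambda>_. 1)"
      by blast
    \<comment> \<open>The noise at a single lag is of order \<open>1/\<surd>|T|\<close> in mean and the weights sum to \<open>O(1/|h|) = O(|T|\<^sup>\<eta>)\<close>,
      so the rate to beat is \<open>\<eta> < 1/2\<close>; as \<open>\<phi> \<le> 8\<close>, the moment condition gives it.\<close>
    have "(\<phi> - 4) / \<phi> \<le> 1 / 2" using \<phi> by (simp add: field_simps)
    from less_le_trans[OF \<eta>(1) this] have \<eta>_half: "\<eta> < 1 / 2" .
    have iid: "iid_with_copy M S \<epsilon> \<epsilon>'" and shift: "bernoulli_shift M S V \<mu> G \<epsilon>"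
      and contraction: "geometric_moment_contraction M V \<mu> G \<epsilon> \<epsilon>'"
      and k_support: "closure {x. k x \<noteq> 0} = {-1..1} \<times> {-1..1}"
      using b by blast+
    interpret contracting_field M V \<mu> S G \<epsilon> \<epsilon>' \<phi>
      by (intro contracting_field.intro bernoulli_field.intro bernoulli_field_axioms.intro
          contracting_field_axioms.intro field iid shift contraction \<phi>)
    obtain B where B: "B > 0" and noise_int: "\<And>d u. integrable M (\<lambda>\<omega>. autocov_noise d \<omega> u)"
      and noise_le: "\<And>d u. fst d > 0 \<Longrightarrow> snd d > 0 \<Longrightarrow> (\<integral>\<omega>. autocov_noise d \<omega> u \<partial>M) \<le> sqrt (B / obs_size d)"
      by (rule autocov_noise_expectation) blast
    obtain c where c: "\<forall>\<^sub>F n in sequentially. norm (inverse (prod_abs (h n) * obs_size (d n) powr \<eta>)) \<le> c * norm (1 :: real)"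
      using \<eta>(2) by (auto elim: landau_o.bigE)
    have d_pos: "\<forall>\<^sub>F n in sequentially. 0 < fst (d n) \<and> 0 < snd (d n)"
    proof -
      have "\<forall>\<^sub>F n in sequentially. 1 \<le> fst (d n) \<and> 1 \<le> snd (d n)"
        using d1 d2 by (intro eventually_conj) (simp_all add: filterlim_at_top)
      then show ?thesis by eventually_elim auto
    qed
    have size_lim: "filterlim (\<lambda>n. obs_size (d n)) at_top sequentially"
      unfolding obs_size_def
      by (intro filterlim_at_top_mult_at_top filterlim_compose[OF filterlim_real_sequentially] d1 d2)
    have k_le: "cmod (k x) \<le> indicator {x. max_norm x \<le> 1} x" for x
    proof (cases "k x = 0")
      case False
      then have "x \<in> {x. k x \<noteq> 0}" by simp
      then have "x \<in> closure {x. k x \<noteq> 0}" by (rule subsetD[OF closure_subset])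
      then have "x \<in> {-1..1} \<times> {-1..1}" unfolding k_support .
      then have "max_norm x \<le> 1" by (auto simp: max_norm_def abs_le_iff)
      moreover have "cmod (k x) \<le> 1"
        unfolding k_def using inv_fourier_norm_le[OF K_integral(1) K_nonneg] K_integral(2) by simp
      ultimately show ?thesis by simp
    qed simp
    let ?g = "indicator {x. max_norm x \<le> 1} :: real \<times> real \<Rightarrow> real"
    show "conv_in_prob M max_dev 0"
    proof (rule consistency[OF radial_majorant_square k_le])
      fix C :: real
      let ?m = "\<lambda>n. radial_majorant.coset_mass ?g (fst (h n)) (snd (h n)) (d n)"
      assume C: "C > 0" and mass: "\<forall>\<^sub>F n in sequentially. (\<Sum>u\<in>lags (d n). ?m n u) \<le> C / prod_abs (h n)"
        and pos: "\<forall>\<^sub>F n in sequentially. 0 < prod_abs (h n)"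
      have m0: "0 \<le> ?m n u" for n u by (rule radial_majorant.coset_mass_nonneg[OF radial_majorant_square])
      show "conv_in_prob M (\<lambda>n \<omega>. C * (\<Sum>u\<in>lags (d n). autocov_noise (d n) \<omega> u * ?m n u)) 0"
      proof (rule conv_in_prob_L1)
        have term_int: "integrable M (\<lambda>\<omega>. autocov_noise (d n) \<omega> u * ?m n u)" for n u
          by (intro integrable_mult_left noise_int)
        show "integrable M (\<lambda>\<omega>. C * (\<Sum>u\<in>lags (d n). autocov_noise (d n) \<omega> u * ?m n u))" for n
          by (intro integrable_mult_right Bochner_Integration.integrable_sum term_int)
        show nn: "0 \<le> C * (\<Sum>u\<in>lags (d n). autocov_noise (d n) \<omega> u * ?m n u)" for n \<omega>
          using C by (intro mult_nonneg_nonneg sum_nonneg noise_nonneg m0) auto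
        let ?K = "C * C * sqrt B * c"
        show "(\<lambda>n. \<integral>\<omega>. C * (\<Sum>u\<in>lags (d n). autocov_noise (d n) \<omega> u * ?m n u) \<partial>M) \<longlonglongrightarrow> 0"
        proof (rule tendsto_sandwich[where f = "\<lambda>_. 0" and h = "\<lambda>n. ?K * obs_size (d n) powr (\<eta> - 1 / 2)"])
          have "(\<lambda>n. obs_size (d n) powr (\<eta> - 1 / 2)) \<longlonglongrightarrow> 0"
            using \<eta>_half by (intro tendsto_neg_powr size_lim) simp
          from tendsto_mult[OF tendsto_const[of ?K] this]
          show "(\<lambda>n. ?K * obs_size (d n) powr (\<eta> - 1 / 2)) \<longlonglongrightarrow> 0" by simp
          show "\<forall>\<^sub>F n in sequentially. 0 \<le> (\<integral>\<omega>. C * (\<Sum>u\<in>lags (d n). autocov_noise (d n) \<omega> u * ?m n u) \<partial>M)"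
            by (intro always_eventually allI Bochner_Integration.integral_nonneg nn)
          show "\<forall>\<^sub>F n in sequentially. (\<integral>\<omega>. C * (\<Sum>u\<in>lags (d n). autocov_noise (d n) \<omega> u * ?m n u) \<partial>M)
              \<le> ?K * obs_size (d n) powr (\<eta> - 1 / 2)"
            using mass pos c d_pos
          proof eventually_elim
            case (elim n)
            have T: "0 < obs_size (d n)" using elim by (simp add: obs_size_def)
            let ?s = "sqrt (B / obs_size (d n))"
            have s0: "0 \<le> ?s" using B T by simp
            have "(\<integral>\<omega>. C * (\<Sum>u\<in>lags (d n). autocov_noise (d n) \<omega> u * ?m n u) \<partial>M)
                = C * (\<Sum>u\<in>lags (d n). (\<integral>\<omega>. autocov_noise (d n) \<omega> u \<partial>M) * ?m n u)"
              using term_int noise_int by (simp add: Bochner_Integration.integral_sum)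
            also have "\<dots> \<le> C * (\<Sum>u\<in>lags (d n). ?s * ?m n u)"
              using C elim by (intro mult_left_mono sum_mono mult_right_mono noise_le m0) auto
            also have "(\<Sum>u\<in>lags (d n). ?s * ?m n u) = ?s * (\<Sum>u\<in>lags (d n). ?m n u)" by (rule sum_distrib_left[symmetric])
            also have "C * (?s * (\<Sum>u\<in>lags (d n). ?m n u)) \<le> C * (?s * (C / prod_abs (h n)))"
              using C by (intro mult_left_mono elim s0) auto
            also have "\<dots> = (C * C * ?s) * inverse (prod_abs (h n))" by (simp add: divide_inverse)
            also have "\<dots> \<le> (C * C * ?s) * (c * obs_size (d n) powr \<eta>)"
            proof (rule mult_left_mono)
              have "inverse (prod_abs (h n)) * inverse (obs_size (d n) powr \<eta>) \<le> c"
                using elim T by (simp add: inverse_mult_distrib)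
              then show "inverse (prod_abs (h n)) \<le> c * obs_size (d n) powr \<eta>"
                using T by (simp add: divide_inverse[symmetric] pos_divide_le_eq)
            qed (use C s0 in auto)
            also have "\<dots> = ?K * obs_size (d n) powr (\<eta> - 1 / 2)"
              using T B by (simp add: real_sqrt_divide powr_diff powr_half_sqrt)
            finally show ?case .
          qed
        qed simp
      qed
    qed
  qed
qed

end
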